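(* Let $M$ be a compact connected $C^\infty$ Riemannian manifold of dimension $n\ge 3$, let $X$ be a $C^1$ vector field on $M$ with flow $X_t$, and let $\Lambda\subset M$ be a compact invariant set of $X$ such that every singularity in $\Lambda$ is hyperbolic. There exists a continuous invariant splitting $T_\Lambda M=E\oplus F$ of the tangent bundle of $\Lambda$ where (1) the Lyapunov exponents on $E$ are negative (or positive on $F$), and (2) $\displaystyle\liminf_{t\to+\infty}\frac1t\log\|DX_t|_{E_x}\|-\limsup_{t\to+\infty}\frac1t\log m(DX_t|_{F_x})<0$, in a total probability set of $\Lambda$, if and only if $T_\Lambda M=E\oplus F$ is a partially hyperbolic splitting.
   Context: $M$ may have boundary, in which case $X$ is assumed inwardly transverse to $\partial M$. A set $\Lambda$ is invariant if $X_t(\Lambda)=\Lambda$ for all $t\in\mathbb{R}$. A singularity is a point $\sigma$ with $X(\sigma)=0$; it is hyperbolic if all eigenvalues of $DX(\sigma)$ have nonzero real part. A splitting $T_\Lambda M=E\oplus F$ is invariant if $E$ and $F$ are invariant under $DX_t$. A dominated splitting over $\Lambda$ is a continuous $DX_t$-invariant splitting $T_\Lambda M=E\oplus F$ with $E_x\neq\{0\}$, $F_x\ne\{0\}$ for all $x\in\Lambda$, for which there are $K,\lambda>0$ with $\|DX_t|_{E_x}\|\cdot\|DX_{-t}|_{F_{X_t(x)}}\|<Ke^{-\lambda t}$ for all $x\in\Lambda$, $t>0$. A splitting $T_\Lambda M=E\oplus F$ is partially hyperbolic if it is dominated and the subbundle $E$ is uniformly contracted, i.e. there are $K,\lambda>0$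 with $\|DX_t|_{E_x}\|\le Ke^{-\lambda t}$ for all $x\in\Lambda$, $t>0$. The Lyapunov exponents at $x$ on an invariant subbundle $G$ are the limits $\lim_{t\to+\infty}\frac1t\log\|DX_t(x)v\|$, $v\in G_x\setminus\{0\}$, whenever they exist (by Oseledets' theorem they exist on a set of total probability). For a linear isomorphism $A$, $\|A\|$ is the operator norm and $m(A)=\inf_{\|v\|=1}\|Av\|=\|A^{-1}\|^{-1}$ is the minimum norm (co-norm). A subset $Y\subset\Lambda$ is a total probability set of $\Lambda$ if $\mu(Y)=1$ for every probability measure $\mu$ on $\Lambda$ that is invariant under $X_t$ for all $t\in\mathbb{R}$.
   Formalization: In the variant "positive on F", partially hyperbolic is read as dominated with F uniformly expanded instead of E uniformly contracted (a hyperbolic source refutes the literal claim); both subbundles of the splitting are taken nonzero. *)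

theory Defs
  imports "HOL-Probability.Probability"
begin

section \<open>Smooth manifolds with boundary\<close>

text \<open>
  A manifold is a topological type \<open>'m\<close> with an atlas of charts into the closed half-space of a
  Euclidean space \<open>'e\<close>; its dimension is \<open>DIM('e)\<close>. Interior charts are those whose image
  misses the bounding hyperplane, so the boundary may be empty.
\<close>

type_synonym ('m, 'e) chart = "'m set \<times> ('m \<Rightarrow> 'e)"
type_synonym ('m, 'e) atlas = "('m, 'e) chart set"

definition inward_normal :: "'e::euclidean_space" where
  "inward_normal = (SOME b. b \<in> Basis)"

definition half_space :: "'e::euclidean_space set" where
  "half_space = {y. 0 \<le> y \<bullet> inward_normal}"

text \<open>
  Class \<open>C\<^sup>k\<close> on a set \<open>S\<close>, with derivatives taken within \<open>S\<close>. It is used only for sets \<open>S\<close> that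
  are open, or relatively open in the half-space; there the derivative within \<open>S\<close> is unique.
\<close>

primrec Ck_on :: "nat \<Rightarrow> ('a::real_normed_vector \<Rightarrow> 'b::real_normed_vector) \<Rightarrow> 'a set \<Rightarrow> bool" where
  "Ck_on 0 f S \<longleftrightarrow> continuous_on S f"
| "Ck_on (Suc k) f S \<longleftrightarrow>
     (\<exists>f'. (\<forall>x\<in>S. (f has_derivative f' x) (at x within S)) \<and> (\<forall>v. Ck_on k (\<lambda>x. f' x v) S))"

definition smooth_on :: "('a::real_normed_vector \<Rightarrow> 'b::real_normed_vector) \<Rightarrow> 'a set \<Rightarrow> bool" where
  "smooth_on f S \<longleftrightarrow> (\<forall>k. Ck_on k f S)"

definition chart_image :: "('m, 'e) chart \<Rightarrow> 'e set" where
  "chart_image c = snd c ` fst c"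

definition chart_inv :: "('m, 'e) chart \<Rightarrow> 'e \<Rightarrow> 'm" where
  "chart_inv c = inv_into (fst c) (snd c)"

definition smooth_atlas ::
  "('m::{t2_space,second_countable_topology}, 'e::euclidean_space) atlas \<Rightarrow> bool" where
  "smooth_atlas A \<longleftrightarrow>
     (\<Union>c\<in>A. fst c) = UNIV \<and>
     (\<forall>c\<in>A. open (fst c) \<and> openin (top_of_set half_space) (chart_image c) \<and>
        homeomorphism (fst c) (chart_image c) (snd c) (chart_inv c)) \<and>
     (\<forall>c\<in>A. \<forall>d\<in>A. smooth_on (\<lambda>y. snd d (chart_inv c y)) (snd c ` (fst c \<inter> fst d)))"

text \<open>
  Every point gets a preferred chart, and the tangent space \<open>T\<^sub>xM\<close> is identified with \<open>'e\<close> by the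
  preferred chart at \<open>x\<close>. In another chart \<open>c\<close> at \<open>x\<close> the tangent vector \<open>v\<close> has the
  coordinates \<open>coord_change (chart_at A x) c x v\<close>.
\<close>

definition chart_at :: "('m, 'e) atlas \<Rightarrow> 'm \<Rightarrow> ('m, 'e) chart" where
  "chart_at A x = (SOME c. c \<in> A \<and> x \<in> fst c)"

definition coord_change ::
  "('m, 'e::euclidean_space) chart \<Rightarrow> ('m, 'e) chart \<Rightarrow> 'm \<Rightarrow> 'e \<Rightarrow> 'e" where
  "coord_change c d x =
     frechet_derivative (\<lambda>y. snd d (chart_inv c y)) (at (snd c x) within snd c ` (fst c \<inter> fst d))"

definition mboundary :: "('m, 'e::euclidean_space) atlas \<Rightarrow> 'm set" where
  "mboundary A = {x. snd (chart_at A x) x \<bullet> inward_normal = 0}"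

definition mderiv :: "('m, 'e::euclidean_space) atlas \<Rightarrow> ('m \<Rightarrow> 'm) \<Rightarrow> 'm \<Rightarrow> 'e \<Rightarrow> 'e" where
  "mderiv A f x =
     frechet_derivative (\<lambda>y. snd (chart_at A (f x)) (f (chart_inv (chart_at A x) y)))
       (at (snd (chart_at A x) x) within chart_image (chart_at A x))"

definition riemannian_metric ::
  "('m, 'e::euclidean_space) atlas \<Rightarrow> ('m \<Rightarrow> 'e \<Rightarrow> 'e \<Rightarrow> real) \<Rightarrow> bool" where
  "riemannian_metric A g \<longleftrightarrow>
     (\<forall>x. bilinear (g x) \<and> (\<forall>u v. g x u v = g x v u) \<and> (\<forall>v. v \<noteq> 0 \<longrightarrow> 0 < g x v v)) \<and>
     (\<forall>c\<in>A. \<forall>u v. smooth_on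
        (\<lambda>y. let x = chart_inv c y; T = coord_change c (chart_at A x) x in g x (T u) (T v))
        (chart_image c))"

definition tnorm :: "('m \<Rightarrow> 'e \<Rightarrow> 'e \<Rightarrow> real) \<Rightarrow> 'm \<Rightarrow> 'e \<Rightarrow> real" where
  "tnorm g x v = sqrt (g x v v)"


section \<open>Vector fields and their flows\<close>

definition field_in_chart ::
  "('m, 'e::euclidean_space) atlas \<Rightarrow> ('m \<Rightarrow> 'e) \<Rightarrow> ('m, 'e) chart \<Rightarrow> 'e \<Rightarrow> 'e" where
  "field_in_chart A X c y = (let x = chart_inv c y in coord_change (chart_at A x) c x (X x))"

definition C1_vector_field :: "('m, 'e::euclidean_space) atlas \<Rightarrow> ('m \<Rightarrow> 'e) \<Rightarrow> bool" where
  "C1_vector_field A X \<longleftrightarrow> (\<forall>c\<in>A. Ck_on 1 (field_in_chart A X c) (chart_image c))"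

definition inwardly_transverse :: "('m, 'e::euclidean_space) atlas \<Rightarrow> ('m \<Rightarrow> 'e) \<Rightarrow> bool" where
  "inwardly_transverse A X \<longleftrightarrow> (\<forall>x\<in>mboundary A. 0 < X x \<bullet> inward_normal)"

definition integral_curve ::
  "('m::topological_space, 'e::euclidean_space) atlas \<Rightarrow> ('m \<Rightarrow> 'e) \<Rightarrow> (real \<Rightarrow> 'm) \<Rightarrow> real set \<Rightarrow> bool"
where
  "integral_curve A X \<gamma> I \<longleftrightarrow>
     continuous_on I \<gamma> \<and>
     (\<forall>t\<in>I. ((\<lambda>s. snd (chart_at A (\<gamma> t)) (\<gamma> s)) has_vector_derivative X (\<gamma> t)) (at t within I))"

definition flow_domain ::
  "('m::topological_space, 'e::euclidean_space) atlas \<Rightarrow> ('m \<Rightarrow> 'e) \<Rightarrow> (real \<times> 'm) set" where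
  "flow_domain A X = {(t, x). \<exists>\<gamma>. integral_curve A X \<gamma> (closed_segment 0 t) \<and> \<gamma> 0 = x}"

definition interior_flow_domain ::
  "('m::topological_space, 'e::euclidean_space) atlas \<Rightarrow> ('m \<Rightarrow> 'e) \<Rightarrow> (real \<Rightarrow> 'm \<Rightarrow> 'm) \<Rightarrow>
   (real \<times> 'm) set" where
  "interior_flow_domain A X \<phi> =
     {(t, x) \<in> flow_domain A X. x \<notin> mboundary A \<and> \<phi> t x \<notin> mboundary A}"

text \<open>
  \<open>\<phi>\<close> is the maximal flow of \<open>X\<close>. The first clause determines \<open>\<phi>\<close> on the flow domain; outside
  (which can happen for negative times only, when the backward orbit has left \<open>M\<close>) \<open>\<phi>\<close> is
  arbitrary. The remaining clauses say that away from the boundary the flow is, as usual, a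
  \<open>C\<^sup>1\<close> map on an open domain; for a \<open>C\<^sup>1\<close> field they follow from the first one.
\<close>

definition flow_of ::
  "('m::topological_space, 'e::euclidean_space) atlas \<Rightarrow> ('m \<Rightarrow> 'e) \<Rightarrow> (real \<Rightarrow> 'm \<Rightarrow> 'm) \<Rightarrow> bool" where
  "flow_of A X \<phi> \<longleftrightarrow>
     (\<forall>\<gamma> t. integral_curve A X \<gamma> (closed_segment 0 t) \<longrightarrow> \<phi> t (\<gamma> 0) = \<gamma> t) \<and>
     open (interior_flow_domain A X \<phi>) \<and>
     continuous_on (interior_flow_domain A X \<phi>) (\<lambda>(t, x). \<phi> t x) \<and>
     (\<forall>c\<in>A. \<forall>d\<in>A. Ck_on 1 (\<lambda>(t, y). snd d (\<phi> t (chart_inv c y)))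
        {(t, y). y \<in> chart_image c \<and> (t, chart_inv c y) \<in> interior_flow_domain A X \<phi> \<and>
                 \<phi> t (chart_inv c y) \<in> fst d})"

definition invariant_set ::
  "('m::topological_space, 'e::euclidean_space) atlas \<Rightarrow> ('m \<Rightarrow> 'e) \<Rightarrow> (real \<Rightarrow> 'm \<Rightarrow> 'm) \<Rightarrow>
   'm set \<Rightarrow> bool" where
  "invariant_set A X \<phi> \<Lambda> \<longleftrightarrow>
     (\<forall>t. (\<forall>x\<in>\<Lambda>. (t, x) \<in> flow_domain A X) \<and> \<phi> t ` \<Lambda> = \<Lambda>)"

text \<open>Eigenvalues of the complexification of a real linear map \<open>L\<close>, with eigenvector \<open>u + \<i> w\<close>.\<close>

definition complex_eigenvalue :: "('e::real_vector \<Rightarrow> 'e) \<Rightarrow> complex \<Rightarrow> bool" where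
  "complex_eigenvalue L z \<longleftrightarrow>
     (\<exists>u w. (u, w) \<noteq> (0, 0) \<and>
        L u = Re z *\<^sub>R u - Im z *\<^sub>R w \<and> L w = Im z *\<^sub>R u + Re z *\<^sub>R w)"

definition hyperbolic_singularity ::
  "('m, 'e::euclidean_space) atlas \<Rightarrow> ('m \<Rightarrow> 'e) \<Rightarrow> 'm \<Rightarrow> bool" where
  "hyperbolic_singularity A X \<sigma> \<longleftrightarrow>
     X \<sigma> = 0 \<and>
     (\<forall>z. complex_eigenvalue
            (frechet_derivative (field_in_chart A X (chart_at A \<sigma>))
               (at (snd (chart_at A \<sigma>) \<sigma>) within chart_image (chart_at A \<sigma>))) z
          \<longrightarrow> Re z \<noteq> 0)"


section \<open>Splittings of the tangent bundle over an invariant set\<close>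

definition continuous_subbundle ::
  "('m::topological_space, 'e::euclidean_space) atlas \<Rightarrow> 'm set \<Rightarrow> ('m \<Rightarrow> 'e set) \<Rightarrow> bool" where
  "continuous_subbundle A \<Lambda> E \<longleftrightarrow>
     (\<forall>x\<in>\<Lambda>. \<exists>c\<in>A. \<exists>W k. \<exists>s :: nat \<Rightarrow> 'm \<Rightarrow> 'e.
        open W \<and> x \<in> W \<and> W \<subseteq> fst c \<and>
        (\<forall>i<k. continuous_on (W \<inter> \<Lambda>) (\<lambda>y. coord_change (chart_at A y) c y (s i y))) \<and>
        (\<forall>y\<in>W \<inter> \<Lambda>. inj_on (\<lambda>i. s i y) {..<k} \<and> independent ((\<lambda>i. s i y) ` {..<k}) \<and>
                   span ((\<lambda>i. s i y) ` {..<k}) = E y))"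

text \<open>Both summands of a splitting are nonzero at every point.\<close>

definition continuous_invariant_splitting ::
  "('m::topological_space, 'e::euclidean_space) atlas \<Rightarrow> (real \<Rightarrow> 'm \<Rightarrow> 'm) \<Rightarrow> 'm set \<Rightarrow>
   ('m \<Rightarrow> 'e set) \<Rightarrow> ('m \<Rightarrow> 'e set) \<Rightarrow> bool" where
  "continuous_invariant_splitting A \<phi> \<Lambda> E F \<longleftrightarrow>
     continuous_subbundle A \<Lambda> E \<and> continuous_subbundle A \<Lambda> F \<and>
     (\<forall>x\<in>\<Lambda>. subspace (E x) \<and> subspace (F x) \<and> E x \<noteq> {0} \<and> F x \<noteq> {0} \<and>
        E x \<inter> F x = {0} \<and> {u + v | u v. u \<in> E x \<and> v \<in> F x} = UNIV \<and>
        (\<forall>t. mderiv A (\<phi> t) x ` E x = E (\<phi> t x) \<and> mderiv A (\<phi> t) x ` F x = F (\<phi> t x)))"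

definition flow_norm ::
  "('m, 'e::euclidean_space) atlas \<Rightarrow> ('m \<Rightarrow> 'e \<Rightarrow> 'e \<Rightarrow> real) \<Rightarrow> (real \<Rightarrow> 'm \<Rightarrow> 'm) \<Rightarrow>
   ('m \<Rightarrow> 'e set) \<Rightarrow> real \<Rightarrow> 'm \<Rightarrow> real" where
  "flow_norm A g \<phi> G t x =
     (SUP v\<in>{v \<in> G x. tnorm g x v = 1}. tnorm g (\<phi> t x) (mderiv A (\<phi> t) x v))"

definition flow_conorm ::
  "('m, 'e::euclidean_space) atlas \<Rightarrow> ('m \<Rightarrow> 'e \<Rightarrow> 'e \<Rightarrow> real) \<Rightarrow> (real \<Rightarrow> 'm \<Rightarrow> 'm) \<Rightarrow>
   ('m \<Rightarrow> 'e set) \<Rightarrow> real \<Rightarrow> 'm \<Rightarrow> real" where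
  "flow_conorm A g \<phi> G t x =
     (INF v\<in>{v \<in> G x. tnorm g x v = 1}. tnorm g (\<phi> t x) (mderiv A (\<phi> t) x v))"

definition dominated_splitting ::
  "('m::topological_space, 'e::euclidean_space) atlas \<Rightarrow> ('m \<Rightarrow> 'e \<Rightarrow> 'e \<Rightarrow> real) \<Rightarrow>
   (real \<Rightarrow> 'm \<Rightarrow> 'm) \<Rightarrow> 'm set \<Rightarrow> ('m \<Rightarrow> 'e set) \<Rightarrow> ('m \<Rightarrow> 'e set) \<Rightarrow> bool" where
  "dominated_splitting A g \<phi> \<Lambda> E F \<longleftrightarrow>
     continuous_invariant_splitting A \<phi> \<Lambda> E F \<and>
     (\<exists>K>0. \<exists>\<alpha>>0. \<forall>x\<in>\<Lambda>. \<forall>t>0.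
        flow_norm A g \<phi> E t x * flow_norm A g \<phi> F (- t) (\<phi> t x) < K * exp (- \<alpha> * t))"

definition uniformly_contracted ::
  "('m, 'e::euclidean_space) atlas \<Rightarrow> ('m \<Rightarrow> 'e \<Rightarrow> 'e \<Rightarrow> real) \<Rightarrow> (real \<Rightarrow> 'm \<Rightarrow> 'm) \<Rightarrow> 'm set \<Rightarrow>
   ('m \<Rightarrow> 'e set) \<Rightarrow> bool" where
  "uniformly_contracted A g \<phi> \<Lambda> G \<longleftrightarrow>
     (\<exists>K>0. \<exists>\<alpha>>0. \<forall>x\<in>\<Lambda>. \<forall>t>0. flow_norm A g \<phi> G t x \<le> K * exp (- \<alpha> * t))"

definition uniformly_expanded ::
  "('m, 'e::euclidean_space) atlas \<Rightarrow> ('m \<Rightarrow> 'e \<Rightarrow> 'e \<Rightarrow> real) \<Rightarrow> (real \<Rightarrow> 'm \<Rightarrow> 'm) \<Rightarrow> 'm set \<Rightarrow>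
   ('m \<Rightarrow> 'e set) \<Rightarrow> bool" where
  "uniformly_expanded A g \<phi> \<Lambda> G \<longleftrightarrow> uniformly_contracted A g (\<lambda>t. \<phi> (- t)) \<Lambda> G"

definition partially_hyperbolic ::
  "('m::topological_space, 'e::euclidean_space) atlas \<Rightarrow> ('m \<Rightarrow> 'e \<Rightarrow> 'e \<Rightarrow> real) \<Rightarrow>
   (real \<Rightarrow> 'm \<Rightarrow> 'm) \<Rightarrow> 'm set \<Rightarrow> ('m \<Rightarrow> 'e set) \<Rightarrow> ('m \<Rightarrow> 'e set) \<Rightarrow> bool" where
  "partially_hyperbolic A g \<phi> \<Lambda> E F \<longleftrightarrow>
     dominated_splitting A g \<phi> \<Lambda> E F \<and> uniformly_contracted A g \<phi> \<Lambda> E"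

text \<open>
  The time-reversed notion: \<open>F \<oplus> E\<close> is partially hyperbolic for the flow of \<open>- X\<close>.
\<close>

definition partially_hyperbolic_expanding ::
  "('m::topological_space, 'e::euclidean_space) atlas \<Rightarrow> ('m \<Rightarrow> 'e \<Rightarrow> 'e \<Rightarrow> real) \<Rightarrow>
   (real \<Rightarrow> 'm \<Rightarrow> 'm) \<Rightarrow> 'm set \<Rightarrow> ('m \<Rightarrow> 'e set) \<Rightarrow> ('m \<Rightarrow> 'e set) \<Rightarrow> bool" where
  "partially_hyperbolic_expanding A g \<phi> \<Lambda> E F \<longleftrightarrow>
     dominated_splitting A g \<phi> \<Lambda> E F \<and> uniformly_expanded A g \<phi> \<Lambda> F"


section \<open>Lyapunov exponents and total probability\<close>

definition lyapunov_exponents ::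
  "('m, 'e::euclidean_space) atlas \<Rightarrow> ('m \<Rightarrow> 'e \<Rightarrow> 'e \<Rightarrow> real) \<Rightarrow> (real \<Rightarrow> 'm \<Rightarrow> 'm) \<Rightarrow>
   ('m \<Rightarrow> 'e set) \<Rightarrow> 'm \<Rightarrow> real set" where
  "lyapunov_exponents A g \<phi> G x =
     {l. \<exists>v\<in>G x - {0}.
        ((\<lambda>t. 1 / t * ln (tnorm g (\<phi> t x) (mderiv A (\<phi> t) x v))) \<longlongrightarrow> l) at_top}"

definition negative_growth_gap ::
  "('m, 'e::euclidean_space) atlas \<Rightarrow> ('m \<Rightarrow> 'e \<Rightarrow> 'e \<Rightarrow> real) \<Rightarrow> (real \<Rightarrow> 'm \<Rightarrow> 'm) \<Rightarrow>
   ('m \<Rightarrow> 'e set) \<Rightarrow> ('m \<Rightarrow> 'e set) \<Rightarrow> 'm \<Rightarrow> bool" where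
  "negative_growth_gap A g \<phi> E F x \<longleftrightarrow>
     Liminf at_top (\<lambda>t. ereal (1 / t * ln (flow_norm A g \<phi> E t x)))
     - Limsup at_top (\<lambda>t. ereal (1 / t * ln (flow_conorm A g \<phi> F t x))) < 0"

definition invariant_prob ::
  "(real \<Rightarrow> 'm \<Rightarrow> 'm) \<Rightarrow> 'm::topological_space set \<Rightarrow> 'm measure \<Rightarrow> bool" where
  "invariant_prob \<phi> \<Lambda> \<mu> \<longleftrightarrow>
     prob_space \<mu> \<and> space \<mu> = \<Lambda> \<and> sets \<mu> = sets (restrict_space borel \<Lambda>) \<and>
     (\<forall>t. \<forall>B\<in>sets \<mu>. emeasure \<mu> (\<phi> t -` B \<inter> \<Lambda>) = emeasure \<mu> B)"

text \<open>Non-measurable sets have \<open>emeasure\<close> zero, so \<open>Y\<close> is measurable for every such \<open>\<mu>\<close>.\<close>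

definition total_probability ::
  "(real \<Rightarrow> 'm \<Rightarrow> 'm) \<Rightarrow> 'm::topological_space set \<Rightarrow> 'm set \<Rightarrow> bool" where
  "total_probability \<phi> \<Lambda> Y \<longleftrightarrow> Y \<subseteq> \<Lambda> \<and> (\<forall>\<mu>. invariant_prob \<phi> \<Lambda> \<mu> \<longrightarrow> emeasure \<mu> Y = 1)"

text \<open>
  Conditions (1) and (2) on one common total probability set, in the variant with negative
  exponents on \<open>E\<close> and in the variant with positive exponents on \<open>F\<close>.
\<close>

definition contracting_exponents_condition ::
  "('m::topological_space, 'e::euclidean_space) atlas \<Rightarrow> ('m \<Rightarrow> 'e \<Rightarrow> 'e \<Rightarrow> real) \<Rightarrow>
   (real \<Rightarrow> 'm \<Rightarrow> 'm) \<Rightarrow> 'm set \<Rightarrow> ('m \<Rightarrow> 'e set) \<Rightarrow> ('m \<Rightarrow> 'e set) \<Rightarrow> bool" where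
  "contracting_exponents_condition A g \<phi> \<Lambda> E F \<longleftrightarrow>
     (\<exists>Y. total_probability \<phi> \<Lambda> Y \<and>
       (\<forall>x\<in>Y. (\<forall>l\<in>lyapunov_exponents A g \<phi> E x. l < 0) \<and> negative_growth_gap A g \<phi> E F x))"

definition expanding_exponents_condition ::
  "('m::topological_space, 'e::euclidean_space) atlas \<Rightarrow> ('m \<Rightarrow> 'e \<Rightarrow> 'e \<Rightarrow> real) \<Rightarrow>
   (real \<Rightarrow> 'm \<Rightarrow> 'm) \<Rightarrow> 'm set \<Rightarrow> ('m \<Rightarrow> 'e set) \<Rightarrow> ('m \<Rightarrow> 'e set) \<Rightarrow> bool" where
  "expanding_exponents_condition A g \<phi> \<Lambda> E F \<longleftrightarrow>
     (\<exists>Y. total_probability \<phi> \<Lambda> Y \<and>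
       (\<forall>x\<in>Y. (\<forall>l\<in>lyapunov_exponents A g \<phi> F x. 0 < l) \<and> negative_growth_gap A g \<phi> E F x))"

end

(* The ergodic input is needed only for additive cocycles. On the compact space Z of triples (x, u, v),
   with u and v unit vectors in E_x and F_x, the normalised derivative acts as a continuous flow, and
   a(t) = log |DX_t u| and b(t) = log |DX_t v| are additive cocycles over it. If a - b (or a, or -b)
   fails to decay linearly in t uniformly on Z, a Krylov-Bogoliubov argument yields an invariant
   probability on Z with nonnegative mean of the time-one cocycle, and Birkhoff's theorem yields, with
   positive probability, points at which a(t)/t and b(t)/t converge to limits in the forbidden order.
   These limits are Lyapunov exponents along u and v, and they bound the liminf and the limsup in
   condition (2). Projecting the measure to Lambda contradicts the hypothesis on the total probability
   set, so neither the subadditive ergodic theorem nor Oseledets' theorem is required. *)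

theory Submission
  imports Defs
begin

section \<open>Limits of empirical measures on compact metric spaces\<close>

text \<open>The ergodic argument runs on a compact subset of a metric space, whereas
  \<open>Z\<close> lies over a bare topological manifold, and its vectors are stored in preferred
  charts that jump from point to point. The obstacle is to give \<open>Z\<close> a metric for which
  the normalised derivative flow is continuous; bump functions times chart coordinates embed it into
  a countable product. Weak compactness of measures is imported from the real line, every compact
  metric space being a continuous image of a compact set of reals. The boundary causes no trouble,
  since complete orbits avoid it and all derivatives are taken at interior points. That u and v vary
  independently within a fibre turns a uniform bound on a - b into a bound on the norm on E against
  the co-norm on F. The sign conditions on exponents are the same dichotomy with one cocycle
  replaced by 0. In the converse direction all estimates hold at every point, so \<Lambda> itself is
  the total probability set; there the limsup of the co-norm rate has to be shown finite, so that
  the extended difference behaves like a real one.\<close>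

lemma abs_le_one: "x \<in> {0,1} \<Longrightarrow> \<bar>x\<bar> \<le> (1::real)"
  by auto

text \<open>Base 3 leaves no ambiguity: at the first differing digit \<open>m\<close> the sums
  differ by \<open>1 / 3 ^ m\<close>, while all later digits together account for at most half of
  that.\<close>

lemma ternary_code_inj:
  fixes a b :: "nat \<Rightarrow> real"
  assumes a: "\<And>n. a n \<in> {0,1}" and b: "\<And>n. b n \<in> {0,1}"
    and eq: "(\<Sum>n. a n / 3 ^ n) = (\<Sum>n. b n / 3 ^ n)"
  shows "a = b"
proof (rule ccontr)
  assume "a \<noteq> b"
  then obtain k where "a k \<noteq> b k" by auto
  define m where "m = (LEAST n. a n \<noteq> b n)"
  have m: "a m \<noteq> b m" unfolding m_def by (rule LeastI[of _ k]) fact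
  have less: "a n = b n" if "n < m" for n
    using not_less_Least[of n "\<lambda>n. a n \<noteq> b n"] that by (auto simp: m_def)
  have geo: "summable (\<lambda>n. (1/3::real) ^ n)" by (rule summable_geometric) simp
  have sa: "summable (\<lambda>n. a n / 3 ^ n)" "summable (\<lambda>n. b n / 3 ^ n)"
    by (rule summable_comparison_test'[OF geo, of 0],
        use a b in \<open>auto simp: power_one_over abs_divide intro!: divide_right_mono abs_le_one\<close>)+
  define d where "d n = (a n - b n) / 3 ^ n" for n
  have sd: "summable d" unfolding d_def diff_divide_distrib by (rule summable_diff[OF sa])
  have "suminf d = 0"
    unfolding d_def diff_divide_distrib using suminf_diff[OF sa] eq by simp
  moreover have "suminf d = (\<Sum>n. d (n + Suc m)) + (\<Sum>n<Suc m. d n)"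
    by (rule suminf_split_initial_segment[OF sd])
  moreover have "(\<Sum>n<Suc m. d n) = d m" using less by (simp add: d_def)
  ultimately have dm: "d m = - (\<Sum>n. d (n + Suc m))" by simp
  have dle: "norm (d (n + Suc m)) \<le> (1/3) ^ Suc m * (1/3) ^ n" for n
  proof -
    have "\<bar>a k - b k\<bar> \<le> 1" for k using a[of k] b[of k] by auto
    then show ?thesis
      by (simp add: d_def abs_divide power_add power_one_over divide_simps)
  qed
  have gg: "summable (\<lambda>n. (1/3) ^ Suc m * (1/3::real) ^ n)" by (intro summable_mult geo)
  have "norm (\<Sum>n. d (n + Suc m)) \<le> (\<Sum>n. (1/3) ^ Suc m * (1/3::real) ^ n)"
    by (rule norm_suminf_le[OF dle gg])
  also have "\<dots> = (1/3) ^ Suc m * (3/2)"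
    using suminf_geometric[of "1/3::real"] by (subst suminf_mult[OF geo]) simp
  finally have "norm (d m) \<le> (1/3) ^ Suc m * (3/2)" using dm by simp
  moreover have "norm (d m) = (1/3) ^ m"
    using m a[of m] b[of m] by (auto simp: d_def power_one_over)
  ultimately show False by simp
qed

lemma continuous_on_ternary_code:
  "continuous_on {b :: nat \<Rightarrow> real. \<forall>n. b n \<in> {0,1}} (\<lambda>b. \<Sum>n. b n / 3 ^ n)"
    (is "continuous_on ?B _")
proof -
  have geo: "summable (\<lambda>n. (1/3::real) ^ n)" by (rule summable_geometric) simp
  have "uniform_limit ?B (\<lambda>n b. \<Sum>i<n. b i / 3 ^ i) (\<lambda>b. \<Sum>i. b i / 3 ^ i) sequentially"
    by (rule Weierstrass_m_test[OF _ geo])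
       (auto simp: power_one_over abs_divide intro!: divide_right_mono abs_le_one)
  then show ?thesis
    by (rule uniform_limit_theorem[rotated])
       (auto intro!: always_eventually continuous_intros
          continuous_on_subset[OF continuous_on_product_coordinates] simp del: sum.lessThan_Suc)
qed

lemma compact_sequences:
  fixes K :: "real set"
  assumes "compact K"
  shows "compact {b :: nat \<Rightarrow> real. \<forall>n. b n \<in> K}"
proof -
  have "{b :: nat \<Rightarrow> real. \<forall>n. b n \<in> K} = PiE UNIV (\<lambda>_. K)"
    by (auto simp: PiE_def Pi_def)
  moreover have "compactin (product_topology (\<lambda>_::nat. euclidean) UNIV) (PiE UNIV (\<lambda>_. K))"
    using assms by (subst compactin_PiE) auto
  ultimately show ?thesis by (simp add: euclidean_product_topology)
qed

text \<open>Countably many closed pairs \<open>P\<^sub>n \<union> Q\<^sub>n = S\<close> separate the points of \<open>S\<close>. Recording for each \<open>n\<close> a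
  side on which a point lies codes \<open>S\<close> by zero-one sequences, and a code determines its point.\<close>

lemma compact_is_image_of_real_compact:
  fixes S :: "'a::{metric_space, second_countable_topology} set"
  assumes "compact S"
  obtains K :: "real set" and p where "compact K" "continuous_on K p" "p ` K = S"
proof -
  obtain D :: "'a set" where D: "countable D" "\<And>X. open X \<Longrightarrow> X \<noteq> {} \<Longrightarrow> \<exists>d\<in>D. d \<in> X"
    using countable_dense_exists by blast
  have ne: "D \<noteq> {}" using D(2)[of UNIV] by auto
  define e where "e = from_nat_into (D \<times> (\<rat> :: real set))"
  have rat_ne: "(\<rat> :: real set) \<noteq> {}" using Rats_0 by blast
  have e: "range e = D \<times> \<rat>" unfolding e_def
    by (rule range_from_nat_into) (use ne rat_ne D countable_rat in auto)
  define B where "B = {b :: nat \<Rightarrow> real. \<forall>n. b n \<in> {0,1}}"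
  \<comment> \<open>At distance exactly equal to the radius both digits are allowed, so that each
    condition, and hence \<open>R\<close>, is closed.\<close>
  define R where "R = (S \<times> B) \<inter> (\<Inter>n. {z. (snd z n = 0 \<or> dist (fst z) (fst (e n)) \<le> snd (e n)) \<and>
                        (snd z n = 1 \<or> dist (fst z) (fst (e n)) \<ge> snd (e n))})"
  have cB: "compact B" unfolding B_def by (rule compact_sequences) simp
  have cR: "compact R" unfolding R_def
    by (intro compact_Int_closed compact_Times assms cB closed_INT ballI closed_Collect_conj
        closed_Collect_disj closed_Collect_eq closed_Collect_le continuous_intros
        continuous_on_product_then_coordinatewise)
  define c where "c z = (\<Sum>n. snd z n / 3 ^ n)" for z :: "'a \<times> (nat \<Rightarrow> real)"
  have cont_c: "continuous_on R c" unfolding c_def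
    by (rule continuous_on_compose2[OF continuous_on_ternary_code continuous_on_snd[OF continuous_on_id]])
       (auto simp: R_def B_def)
  have inj: "inj_on c R"
  proof (rule inj_onI)
    fix z w assume z: "z \<in> R" and w: "w \<in> R" and eq: "c z = c w"
    have s: "snd z = snd w"
      by (rule ternary_code_inj) (use z w eq in \<open>auto simp: R_def B_def c_def mem_Times_iff\<close>)
    have "fst z = fst w"
    proof (rule ccontr)
      assume neq: "fst z \<noteq> fst w"
      \<comment> \<open>\<open>q\<close> lies within \<open>r\<close> of the first point and, the
        points being \<open>3 * r\<close> apart, more than \<open>2 * r\<close> from the second. A
        rational radius strictly between \<open>r\<close> and \<open>2 * r\<close> then forces
        different digits.\<close>
      define r where "r = dist (fst z) (fst w) / 3"
      have r: "r > 0" using neq by (simp add: r_def)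
      obtain q where q: "q \<in> D" "q \<in> ball (fst z) r" using D(2)[of "ball (fst z) r"] r by auto
      obtain \<rho> where \<rho>: "\<rho> \<in> \<rat>" "r < \<rho>" "\<rho> < 2 * r" using Rats_dense_in_real[of r "2 * r"] r by auto
      obtain n where n: "e n = (q, \<rho>)" using e q(1) \<rho>(1) by (metis (mono_tags, lifting) SigmaI rangeE)
      have 1: "dist (fst z) q < \<rho>" using q \<rho> by simp
      have 2: "dist (fst w) q > \<rho>"
        using dist_triangle[of "fst z" "fst w" q] q \<rho> by (simp add: r_def dist_commute)
      have "snd z n = 1" "snd w n = 0" using z w 1 2 n unfolding R_def by force+
      then show False using s by simp
    qed
    then show "z = w" using s by (simp add: prod_eq_iff)
  qed
  \<comment> \<open>A continuous injection of a compact set is a homeomorphism onto its image, so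
    points can be decoded continuously.\<close>
  obtain h where h: "homeomorphism R (c ` R) c h"
    using homeomorphism_compact[OF cR cont_c refl inj] by blast
  have "fst ` R = S"
  proof
    show "S \<subseteq> fst ` R"
    proof
      fix x assume x: "x \<in> S"
      define b where "b n = (if dist x (fst (e n)) \<le> snd (e n) then 1 else 0::real)" for n
      have "(x, b) \<in> R" using x by (auto simp: R_def B_def b_def)
      then show "x \<in> fst ` R" by force
    qed
  qed (auto simp: R_def)
  show ?thesis
  proof
    show "compact (c ` R)" by (rule compact_continuous_image[OF cont_c cR])
    show "continuous_on (c ` R) (fst \<circ> h)"
      using h by (intro continuous_on_compose continuous_intros) (auto simp: homeomorphism_def)
    show "(fst \<circ> h) ` (c ` R) = S"
      unfolding image_comp[symmetric] using h \<open>fst ` R = S\<close> by (simp add: homeomorphism_def)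
  qed
qed

text \<open>The sample points are lifted along \<open>p\<close> to a compact set \<open>K\<close> of
  reals. The lifted empirical laws are tight, so a subsequence converges weakly on the line; the
  limit is carried by \<open>K\<close>, and its image under \<open>p\<close> is the required
  measure.\<close>

lemma empirical_measures_subseq_limit:
  fixes S :: "'a::{metric_space, second_countable_topology} set" and z :: "nat \<Rightarrow> nat \<Rightarrow> 'a"
  assumes S: "compact S" and N: "\<And>n. N n > 0" and z: "\<And>n i. z n i \<in> S"
  obtains r :: "nat \<Rightarrow> nat" and \<nu> where "strict_mono r" "prob_space \<nu>"
    "sets \<nu> = sets (restrict_space borel S)"
    "\<And>h :: 'a \<Rightarrow> real. continuous_on S h \<Longrightarrow>
       (\<lambda>n. (\<Sum>i<N (r n). h (z (r n) i)) / real (N (r n))) \<longlonglongrightarrow> integral\<^sup>L \<nu> h"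
proof -
  obtain K :: "real set" and p where K: "compact K" "continuous_on K p" "p ` K = S"
    using compact_is_image_of_real_compact[OF S] .
  have "\<exists>t\<in>K. p t = z n i" for n i using z[of n i] K(3) by auto
  then obtain y where y: "y n i \<in> K" "p (y n i) = z n i" for n i by metis
  obtain b where b: "b > 0" "\<And>t. t \<in> K \<Longrightarrow> \<bar>t\<bar> \<le> b"
    using compact_imp_bounded[OF K(1)] by (auto simp: bounded_pos)
  define u where "u n = measure_pmf (pmf_of_set {..<N n})" for n
  define m where "m n = distr (u n) borel (y n)" for n
  interpret u: prob_space "u n" for n unfolding u_def by (rule measure_pmf.prob_space_axioms)
  have rd: "real_distribution (m n)" for n
    unfolding m_def by (rule u.real_distribution_distr) (simp add: u_def)
  have int_m: "integral\<^sup>L (m n) f = (\<Sum>i<N n. f (y n i)) / real (N n)"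
    if "f \<in> borel_measurable borel" for n and f :: "real \<Rightarrow> real"
  proof -
    have "integral\<^sup>L (m n) f = measure_pmf.expectation (pmf_of_set {..<N n}) (\<lambda>i. f (y n i))"
      unfolding m_def u_def using that by (subst integral_distr) auto
    also have "\<dots> = (\<Sum>i<N n. f (y n i)) / real (N n)"
      by (subst integral_pmf_of_set) (use N[of n] in auto)
    finally show ?thesis .
  qed
  \<comment> \<open>The interval is open on the left, hence the margin of 1: a lifted point may
    equal \<open>- b\<close>.\<close>
  have "measure (m n) {- b - 1<..b} = 1" for n
  proof -
    interpret m: real_distribution "m n" by (rule rd)
    have "AE t in m n. t \<in> {- b - 1<..b}"
    proof -
      have "- b - 1 < y n i \<and> y n i \<le> b" for i using b(2)[OF y(1)[of n i]] b(1) by linarith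
      then show ?thesis unfolding m_def u_def by (subst AE_distr_iff) auto
    qed
    then show ?thesis by (subst m.prob_eq_1) auto
  qed
  then have "tight m"
    unfolding tight_def
    by (intro conjI allI impI exI[of _ "- b - 1"] exI[of _ b]) (use rd b in auto)
  from tight_imp_convergent_subsubsequence[OF this, of id]
  obtain r M where r: "strict_mono r" "real_distribution M" "weak_conv_m (m \<circ> id \<circ> r) M"
    by (auto simp: strict_mono_def)
  interpret M: real_distribution M by (rule r)
  have lim: "(\<lambda>n. (\<Sum>i<N (r n). f (y (r n) i)) / real (N (r n))) \<longlonglongrightarrow> integral\<^sup>L M f"
    if f: "continuous_on UNIV f" "\<And>t. \<bar>f t\<bar> \<le> B" for f :: "real \<Rightarrow> real" and B
  proof -
    have "f \<in> borel_measurable borel" using f(1) by (rule borel_measurable_continuous_onI)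
    note int_m[OF this]
    moreover have "(\<lambda>n. integral\<^sup>L ((m \<circ> id \<circ> r) n) f) \<longlonglongrightarrow> integral\<^sup>L M f"
      by (rule weak_conv_imp_integral_bdd_continuous_conv[OF _ r(2) r(3), of f B])
        (use f rd in \<open>auto simp: continuous_on_eq_continuous_at\<close>)
    ultimately show ?thesis by simp
  qed
  have clK: "closed K" using K(1) by (rule compact_imp_closed)
  have Kne: "K \<noteq> {}" using y by blast
  have AEK: "AE t in M. t \<in> K"
  proof -
    \<comment> \<open>The truncated distance to \<open>K\<close> vanishes at every sample point, so
      its limit integral is 0, and closedness of \<open>K\<close> turns this into concentration on
      \<open>K\<close>.\<close>
    let ?f = "\<lambda>t. min 1 (infdist t K)"
    have c: "continuous_on UNIV ?f" by (intro continuous_intros)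
    have le: "\<bar>?f t\<bar> \<le> 1" for t using infdist_nonneg[of t K] by (auto simp: min_def)
    have "(\<lambda>n. (\<Sum>i<N (r n). ?f (y (r n) i)) / real (N (r n))) \<longlonglongrightarrow> integral\<^sup>L M ?f"
      by (rule lim[OF c le])
    moreover have "?f (y n i) = 0" for n i using y[of n i] by simp
    ultimately have "(\<lambda>n::nat. 0) \<longlonglongrightarrow> integral\<^sup>L M ?f" by simp
    then have 0: "integral\<^sup>L M ?f = 0" using LIMSEQ_unique tendsto_const by blast
    have "?f \<in> borel_measurable M" using borel_measurable_continuous_onI[OF c] by simp
    then have "AE t in M. ?f t = 0"
      by (subst integral_nonneg_eq_0_iff_AE[symmetric])
         (use 0 le infdist_nonneg in \<open>auto intro!: M.integrable_const_bound[where B=1]\<close>)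
    then show ?thesis
      by eventually_elim
        (use clK Kne in \<open>auto simp: in_closed_iff_infdist_zero min_def split: if_splits\<close>)
  qed
  \<comment> \<open>Off the full-measure set \<open>K\<close> the value only has to lie in
    \<open>S\<close>; \<open>z 0 0\<close> is such a point.\<close>
  define q where "q t = (if t \<in> K then p t else z 0 0)" for t
  have q_meas: "q \<in> M \<rightarrow>\<^sub>M restrict_space borel S"
  proof (rule measurable_restrict_space2)
    show "q \<in> space M \<rightarrow> S" using K(3) z by (auto simp: q_def)
    have "q \<in> borel_measurable borel" unfolding q_def
      by (rule borel_measurable_continuous_on_if) (use K clK in auto)
    then show "q \<in> borel_measurable M" by simp
  qed
  define \<nu> where "\<nu> = distr M (restrict_space borel S) q"
  show ?thesis
  proof
    show "prob_space \<nu>" unfolding \<nu>_def by (rule M.prob_space_distr[OF q_meas])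
    show "sets \<nu> = sets (restrict_space borel S)" by (simp add: \<nu>_def)
    fix h :: "'a \<Rightarrow> real" assume h: "continuous_on S h"
    have chp: "continuous_on K (\<lambda>t. h (p t))"
      by (rule continuous_on_compose2[OF h K(2)]) (use K in auto)
    obtain B where B: "B > 0" "\<And>x. x \<in> S \<Longrightarrow> \<bar>h x\<bar> \<le> B"
      using compact_imp_bounded[OF compact_continuous_image[OF h S]] by (auto simp: bounded_pos)
    \<comment> \<open>Weak convergence is tested against bounded continuous functions on the whole
      line, so the composite of \<open>h\<close> and \<open>p\<close> is extended from
      \<open>K\<close> by Tietze with the same bound.\<close>
    obtain f where f: "continuous_on UNIV f" "\<And>t. t \<in> K \<Longrightarrow> f t = h (p t)" "\<And>t. norm (f t) \<le> B"
      using Tietze[OF chp, of UNIV B] clK B K(3) by auto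
    have "integral\<^sup>L \<nu> h = (\<integral>t. h (q t) \<partial>M)"
      unfolding \<nu>_def by (rule integral_distr[OF q_meas borel_measurable_continuous_on_restrict[OF h]])
    also have "\<dots> = integral\<^sup>L M f"
    proof (rule integral_cong_AE)
      show "(\<lambda>t. h (q t)) \<in> borel_measurable M"
        by (rule measurable_compose[OF q_meas borel_measurable_continuous_on_restrict[OF h]])
      show "f \<in> borel_measurable M" using borel_measurable_continuous_onI[OF f(1)] by simp
      show "AE t in M. h (q t) = f t" using AEK by eventually_elim (simp add: q_def f)
    qed
    finally show "(\<lambda>n. (\<Sum>i<N (r n). h (z (r n) i)) / real (N (r n))) \<longlonglongrightarrow> integral\<^sup>L \<nu> h"
      using lim[OF f(1), of B] f(2,3) y by simp
  qed fact
qed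

text \<open>The traces of closed sets on \<open>S\<close> form a generator stable under
  intersection, and the indicator of a nonempty closed set is the decreasing limit of the continuous
  functions \<open>max 0 (1 - real n * infdist x C)\<close>, so the integrals determine the measure
  of each trace.\<close>

lemma finite_measure_eqI_continuous_integrals:
  fixes S :: "'a::metric_space set"
  assumes "finite_measure M" "finite_measure N"
    and S: "closed S"
    and sM: "sets M = sets (restrict_space borel S)" and sN: "sets N = sets (restrict_space borel S)"
    and eq: "\<And>h :: 'a \<Rightarrow> real. continuous_on S h \<Longrightarrow> (\<And>x. \<bar>h x\<bar> \<le> 1) \<Longrightarrow> integral\<^sup>L M h = integral\<^sup>L N h"
  shows "M = N"
proof -
  interpret M: finite_measure M by fact
  interpret N: finite_measure N by fact
  have spM: "space M = S" using sets_eq_imp_space_eq[OF sM] by (simp add: space_restrict_space)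
  define G where "G = (\<inter>) S ` {C. closed C}"
  have gen: "sets (restrict_space borel S) = sigma_sets S G"
    unfolding sets_restrict_space G_def borel_eq_closed
    by (subst sets_measure_of, simp, rule sigma_sets_Int)
       (use S in \<open>auto simp: borel_eq_closed[symmetric]\<close>)
  have int: "(\<lambda>n. integral\<^sup>L P (\<lambda>x. max 0 (1 - real n * infdist x C))) \<longlonglongrightarrow> measure P (C \<inter> S)"
    if C: "closed C" "C \<noteq> {}" and P: "finite_measure P" "sets P = sets (restrict_space borel S)" for P C
  proof -
    interpret P: finite_measure P by (rule P)
    have sp: "space P = S" using sets_eq_imp_space_eq[OF P(2)] by (simp add: space_restrict_space)
    have CS: "C \<inter> S \<in> sets P" using C P by (auto simp: sets_restrict_space)
    have meas: "(\<lambda>x. max 0 (1 - real n * infdist x C)) \<in> borel_measurable P" for n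
    proof -
      have "continuous_on S (\<lambda>x. max 0 (1 - real n * infdist x C))" by (intro continuous_intros)
      from borel_measurable_continuous_on_restrict[OF this] show ?thesis
        using measurable_cong_sets[OF P(2) refl] by auto
    qed
    have "(\<lambda>n. integral\<^sup>L P (\<lambda>x. max 0 (1 - real n * infdist x C))) \<longlonglongrightarrow> integral\<^sup>L P (indicator (C \<inter> S))"
    proof (rule integral_dominated_convergence[where w="\<lambda>_. 1"])
      show "AE x in P. (\<lambda>n. max 0 (1 - real n * infdist x C)) \<longlonglongrightarrow> indicator (C \<inter> S) x"
      proof (rule AE_I2)
        fix x assume x: "x \<in> space P"
        show "(\<lambda>n. max 0 (1 - real n * infdist x C)) \<longlonglongrightarrow> indicator (C \<inter> S) x"
        proof (cases "x \<in> C")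
          case True then show ?thesis using x sp by simp
        next
          case False
          then have d: "infdist x C > 0"
            using C infdist_nonneg[of x C] by (metis in_closed_iff_infdist_zero less_eq_real_def)
          obtain n0 where n0: "real n0 * infdist x C > 1" using reals_Archimedean3[OF d] by blast
          have "eventually (\<lambda>n. max 0 (1 - real n * infdist x C) = 0) sequentially"
            using eventually_ge_at_top[of n0]
          proof eventually_elim
            fix n assume "n0 \<le> n"
            then have "real n0 * infdist x C \<le> real n * infdist x C" using d by (intro mult_right_mono) auto
            then show "max 0 (1 - real n * infdist x C) = 0" using n0 by simp
          qed
          then show ?thesis using False by (simp add: tendsto_eventually)
        qed
      qed
      show "AE x in P. norm (max 0 (1 - real n * infdist x C)) \<le> 1" for n
        by (rule AE_I2) (auto simp: infdist_nonneg)
    qed (use meas CS in auto)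
    then show ?thesis using CS P.emeasure_finite by simp
  qed
  show ?thesis
  proof (rule measure_eqI_generator_eq[where E=G and \<Omega>=S and A="\<lambda>_. S"])
    show "Int_stable G" unfolding G_def Int_stable_def
    proof clarsimp
      fix C D :: "'a set" assume "closed C" "closed D"
      then have "S \<inter> C \<inter> (S \<inter> D) = S \<inter> (C \<inter> D)" "closed (C \<inter> D)" by auto
      then show "S \<inter> C \<inter> (S \<inter> D) \<in> (\<inter>) S ` {C. closed C}" by blast
    qed
    show "range (\<lambda>_::nat. S) \<subseteq> G" unfolding G_def by (auto intro!: image_eqI[of _ _ UNIV])
    show "sets M = sigma_sets S G" "sets N = sigma_sets S G" using sM sN gen by auto
    fix X assume "X \<in> G"
    then obtain C where C: "closed C" "X = C \<inter> S" by (auto simp: G_def)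
    show "emeasure M X = emeasure N X"
    \<comment> \<open>\<open>infdist\<close> to the empty set is 0, which would make the
      approximating functions constantly 1; the empty set is therefore settled separately.\<close>
    proof (cases "C = {}")
      case False
      have "integral\<^sup>L M (\<lambda>x. max 0 (1 - real n * infdist x C)) = integral\<^sup>L N (\<lambda>x. max 0 (1 - real n * infdist x C))" for n
        by (rule eq) (auto intro!: continuous_intros simp: infdist_nonneg)
      then have "measure M (C \<inter> S) = measure N (C \<inter> S)"
        using LIMSEQ_unique[OF int[OF C(1) False assms(1) sM]] int[OF C(1) False assms(2) sN] by simp
      then show ?thesis using C by (simp add: M.emeasure_eq_measure N.emeasure_eq_measure)
    qed (use C in simp)
  qed (use spM in \<open>auto simp: G_def\<close>)
qed

section \<open>Birkhoff's ergodic theorem\<close>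

definition birkhoff_sum :: "('a \<Rightarrow> 'a) \<Rightarrow> ('a \<Rightarrow> real) \<Rightarrow> nat \<Rightarrow> 'a \<Rightarrow> real" where
  "birkhoff_sum T f n x = (\<Sum>k<n. f ((T ^^ k) x))"

lemma birkhoff_sum_Suc: "birkhoff_sum T f (Suc n) x = f x + birkhoff_sum T f n (T x)"
  unfolding birkhoff_sum_def by (subst sum.lessThan_Suc_shift) (simp add: funpow_swap1)

locale measure_preserving = prob_space +
  fixes T :: "'a \<Rightarrow> 'a"
  assumes T_meas [measurable]: "T \<in> M \<rightarrow>\<^sub>M M" and T_inv: "distr M M T = M"
begin

lemma T_pow_meas [measurable]: "T ^^ k \<in> M \<rightarrow>\<^sub>M M"
  by (induction k) (auto intro!: measurable_comp[OF _ T_meas] simp: id_def)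

lemma integral_T:
  fixes h :: "'a \<Rightarrow> real"
  assumes [measurable]: "h \<in> borel_measurable M"
  shows "(\<integral>x. h (T x) \<partial>M) = integral\<^sup>L M h"
  using integral_distr[OF T_meas assms] by (simp add: T_inv)

lemma integral_T_pow:
  fixes h :: "'a \<Rightarrow> real"
  assumes [measurable]: "h \<in> borel_measurable M"
  shows "(\<integral>x. h ((T ^^ k) x) \<partial>M) = integral\<^sup>L M h"
proof (induction k)
  case (Suc k)
  have "(\<integral>x. h ((T ^^ Suc k) x) \<partial>M) = (\<integral>x. h ((T ^^ k) (T x)) \<partial>M)" by (simp add: funpow_swap1)
  also have "\<dots> = (\<integral>x. h ((T ^^ k) x) \<partial>M)" by (rule integral_T) measurable
  finally show ?case using Suc by simp
qed simp

lemma birkhoff_sum_meas [measurable]: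
  "f \<in> borel_measurable M \<Longrightarrow> birkhoff_sum T f n \<in> borel_measurable M"
  unfolding birkhoff_sum_def[abs_def]
  by (intro borel_measurable_sum measurable_compose[OF T_pow_meas])

text \<open>Garsia's argument: where the running maximum \<open>m\<^sub>n\<close> of the Birkhoff sums is positive,
  \<open>f \<ge> m\<^sub>n - m\<^sub>n \<circ> T\<close>, and the right-hand side has nonnegative integral over the positive part.\<close>

lemma maximal_ergodic_inequality:
  fixes f :: "'a \<Rightarrow> real"
  assumes f [measurable]: "f \<in> borel_measurable M" and B: "\<And>x. x \<in> space M \<Longrightarrow> \<bar>f x\<bar> \<le> B"
    and A [measurable]: "A \<in> sets M" and inv: "\<And>x. x \<in> space M \<Longrightarrow> T x \<in> A \<longleftrightarrow> x \<in> A"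
    and pos: "\<And>x. x \<in> A \<Longrightarrow> \<exists>n. birkhoff_sum T f n x > 0"
  shows "0 \<le> (\<integral>x. indicator A x * f x \<partial>M)"
proof -
  \<comment> \<open>\<open>k = 0\<close> is included, so \<open>m n\<close> is never negative; where
    it is positive, the maximum is attained at some \<open>Suc j\<close>, which lets one step of the
    orbit be split off.\<close>
  define m where "m n x = Max ((\<lambda>k. birkhoff_sum T f k x) ` {..n})" for n x
  have m_meas [measurable]: "m n \<in> borel_measurable M" for n
    unfolding m_def[abs_def] by (rule borel_measurable_Max) auto
  have m_ge: "birkhoff_sum T f k x \<le> m n x" if "k \<le> n" for k n x
    unfolding m_def using that by (intro Max_ge) auto
  have m_nonneg: "0 \<le> m n x" for n x using m_ge[of 0 n x] by (simp add: birkhoff_sum_def)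
  have T_space: "T x \<in> space M" if "x \<in> space M" for x using measurable_space[OF T_meas that] .
  have B0: "0 \<le> B" using B not_empty by (meson abs_ge_zero ex_in_conv order_trans)
  have bsum: "birkhoff_sum T f k x \<le> real k * B" if "x \<in> space M" for k x
    using that
  proof (induction k arbitrary: x)
    case (Suc k)
    show ?case using Suc.IH[OF T_space[OF Suc.prems]] B[OF Suc.prems]
      by (simp add: birkhoff_sum_Suc algebra_simps)
  qed (simp add: birkhoff_sum_def)
  have m_le: "m n x \<le> real n * B" if "x \<in> space M" for n x
  proof -
    have "birkhoff_sum T f k x \<le> real n * B" if "k \<le> n" for k
      using bsum[OF \<open>x \<in> space M\<close>, of k] mult_right_mono[of "real k" "real n" B] that B0 by simp
    then show ?thesis unfolding m_def by (subst Max_le_iff) auto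
  qed
  have garsia: "m n x - m n (T x) \<le> f x" if "m n x > 0" for n x
  proof -
    have "m n x \<in> (\<lambda>k. birkhoff_sum T f k x) ` {..n}" unfolding m_def by (rule Max_in) auto
    then obtain k where k: "k \<le> n" "m n x = birkhoff_sum T f k x" by auto
    then obtain j where "k = Suc j" using \<open>m n x > 0\<close> by (cases k) (auto simp: birkhoff_sum_def)
    then show ?thesis using k m_ge[of j n "T x"] by (simp add: birkhoff_sum_Suc)
  qed
  define P where "P n = {x \<in> A. m n x > 0}" for n
  have AS: "A \<subseteq> space M" using sets.sets_into_space[OF A] .
  have P_eq: "P n = A \<inter> {x \<in> space M. m n x > 0}" for n using AS by (auto simp: P_def)
  have P_meas [measurable]: "P n \<in> sets M" for n unfolding P_eq by measurable
  have step: "0 \<le> (\<integral>x. indicator (P n) x * f x \<partial>M)" for n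
  proof -
    have mi: "integrable M (\<lambda>x. indicator A x * m n x)"
      by (rule integrable_const_bound[where B="real n * B"])
         (use m_le m_nonneg B0 in \<open>auto intro!: AE_I2 simp: indicator_def\<close>)
    have mTi: "integrable M (\<lambda>x. indicator A x * m n (T x))"
      by (rule integrable_const_bound[where B="real n * B"])
         (use m_le m_nonneg B0 T_space in \<open>auto intro!: AE_I2 simp: indicator_def\<close>)
    have fi: "integrable M (\<lambda>x. indicator (P n) x * f x)"
      by (rule integrable_const_bound[where B=B])
         (use B B0 in \<open>auto intro!: AE_I2 simp: indicator_def\<close>)
    \<comment> \<open>Invariance of \<open>A\<close> lets the indicator move along with
      \<open>T\<close> before invariance of the measure is applied.\<close>
    have "(\<integral>x. indicator A x * m n (T x) \<partial>M) = (\<integral>x. indicator A (T x) * m n (T x) \<partial>M)"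
      by (rule Bochner_Integration.integral_cong) (auto simp: indicator_def inv)
    also have "\<dots> = (\<integral>x. indicator A x * m n x \<partial>M)" by (rule integral_T) measurable
    finally have "0 = (\<integral>x. indicator A x * m n x - indicator A x * m n (T x) \<partial>M)"
      using mi mTi by (simp add: Bochner_Integration.integral_diff)
    also have "\<dots> \<le> (\<integral>x. indicator (P n) x * f x \<partial>M)"
    proof (rule integral_mono[OF Bochner_Integration.integrable_diff[OF mi mTi] fi])
      fix x
      show "indicator A x * m n x - indicator A x * m n (T x) \<le> indicator (P n) x * f x"
        using garsia[of n x] m_nonneg[of n x] m_nonneg[of n "T x"]
        by (auto simp: indicator_def P_def not_less)
    qed
    finally show ?thesis .
  qed
  have "(\<lambda>n. \<integral>x. indicator (P n) x * f x \<partial>M) \<longlonglongrightarrow> (\<integral>x. indicator A x * f x \<partial>M)"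
  proof (rule integral_dominated_convergence[where w="\<lambda>_. B"])
    show "AE x in M. (\<lambda>n. indicator (P n) x * f x) \<longlonglongrightarrow> indicator A x * f x"
    proof (rule AE_I2)
      fix x assume "x \<in> space M"
      show "(\<lambda>n. indicator (P n) x * f x) \<longlonglongrightarrow> indicator A x * f x"
      proof (cases "x \<in> A")
        case True
        then obtain N where N: "birkhoff_sum T f N x > 0" using pos by blast
        have "eventually (\<lambda>n. indicator (P n) x * f x = indicator A x * f x) sequentially"
          using eventually_ge_at_top[of N]
        proof eventually_elim
          fix n assume "N \<le> n"
          then have "m n x > 0" using N m_ge[of N n x] by linarith
          then show "indicator (P n) x * f x = indicator A x * f x" using True by (simp add: P_def)
        qed
        then show ?thesis by (rule tendsto_eventually)
      qed (simp add: P_def)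
    qed
    show "AE x in M. norm (indicator (P n) x * f x) \<le> B" for n
      using B B0 by (auto intro!: AE_I2 simp: indicator_def)
  qed auto
  then show ?thesis by (rule LIMSEQ_le_const) (use step in auto)
qed

text \<open>The maximal inequality is applied to \<open>f - b\<close>, whose Birkhoff sum is
  positive where the average of \<open>f\<close> exceeds \<open>b\<close>.\<close>

lemma integral_ge_of_averages:
  fixes f :: "'a \<Rightarrow> real"
  assumes f [measurable]: "f \<in> borel_measurable M" and B: "\<And>x. x \<in> space M \<Longrightarrow> \<bar>f x\<bar> \<le> B"
    and A [measurable]: "A \<in> sets M" and inv: "\<And>x. x \<in> space M \<Longrightarrow> T x \<in> A \<longleftrightarrow> x \<in> A"
    and avg: "\<And>x. x \<in> A \<Longrightarrow> \<exists>n>0. b < birkhoff_sum T f n x / real n"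
  shows "b * prob A \<le> (\<integral>x. indicator A x * f x \<partial>M)"
proof -
  have "0 \<le> (\<integral>x. indicator A x * (f x - b) \<partial>M)"
  proof (rule maximal_ergodic_inequality[where f="\<lambda>x. f x - b" and B="B + \<bar>b\<bar>" and A=A])
    fix x assume "x \<in> A"
    then obtain n where n: "n > 0" "b < birkhoff_sum T f n x / real n" using avg by blast
    have "birkhoff_sum T (\<lambda>x. f x - b) n x = birkhoff_sum T f n x - b * real n"
      by (simp add: birkhoff_sum_def sum_subtractf)
    then show "\<exists>n. birkhoff_sum T (\<lambda>x. f x - b) n x > 0"
      using n by (intro exI[of _ n]) (simp add: field_simps)
  qed (use B inv in \<open>auto intro: order_trans[OF abs_triangle_ineq4]\<close>)
  also have "\<dots> = (\<integral>x. indicator A x * f x - b * indicator A x \<partial>M)" by (simp add: algebra_simps)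
  also have "\<dots> = (\<integral>x. indicator A x * f x \<partial>M) - (\<integral>x. b * indicator A x \<partial>M)"
  proof (rule Bochner_Integration.integral_diff)
    show "integrable M (\<lambda>x. indicator A x * f x)"
    proof (rule integrable_const_bound[where B=B], rule AE_I2)
      fix x assume "x \<in> space M"
      then show "norm (indicator A x * f x) \<le> B" using B[of x] by (auto simp: indicator_def)
    qed measurable
    show "integrable M (\<lambda>x. b * indicator A x)"
      by (rule integrable_const_bound[where B="\<bar>b\<bar>"]) (auto simp: indicator_def)
  qed
  finally show ?thesis by simp
qed

text \<open>The upper and lower limits \<open>U\<close> and \<open>L\<close> of the averages are
  unchanged by \<open>T\<close>, so the points with \<open>L < a\<close> and \<open>b < U\<close>
  form an invariant set \<open>A\<close>. \<open>integral_ge_of_averages\<close>, applied to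
  \<open>f\<close> with \<open>b\<close> and to \<open>- f\<close> with \<open>- a\<close>, gives
  \<open>b * prob A \<le> a * prob A\<close>, which forces \<open>prob A = 0\<close> when
  \<open>a < b\<close>.\<close>

theorem birkhoff_ergodic:
  fixes f :: "'a \<Rightarrow> real"
  assumes f [measurable]: "f \<in> borel_measurable M" and B: "\<And>x. x \<in> space M \<Longrightarrow> \<bar>f x\<bar> \<le> B"
  obtains F where "F \<in> borel_measurable M" "AE x in M. (\<lambda>n. birkhoff_sum T f n x / real n) \<longlonglongrightarrow> F x"
    "integrable M F" "integral\<^sup>L M F = integral\<^sup>L M f"
proof -
  have T_space: "T x \<in> space M" if "x \<in> space M" for x using measurable_space[OF T_meas that] .
  have Tk_space: "(T ^^ k) x \<in> space M" if "x \<in> space M" for x k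
    using measurable_space[OF T_pow_meas that] .
  have B0: "0 \<le> B" using B not_empty by (meson abs_ge_zero ex_in_conv order_trans)
  define avg where "avg n x = birkhoff_sum T f n x / real n" for n x
  have avg_meas [measurable]: "avg n \<in> borel_measurable M" for n
    unfolding avg_def[abs_def] by measurable
  have avg_le: "\<bar>avg n x\<bar> \<le> B" if x: "x \<in> space M" for n x
  proof -
    have "\<bar>birkhoff_sum T f n x\<bar> \<le> (\<Sum>k<n. B)"
      unfolding birkhoff_sum_def using B[OF Tk_space[OF x]]
      by (intro order_trans[OF sum_abs] sum_mono) auto
    then show ?thesis using B0 by (cases n) (auto simp: avg_def field_simps)
  qed
  define U where "U x = limsup (\<lambda>n. ereal (avg n x))" for x
  define L where "L x = liminf (\<lambda>n. ereal (avg n x))" for x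
  have [measurable]: "U \<in> borel_measurable M" "L \<in> borel_measurable M"
    unfolding U_def[abs_def] L_def[abs_def] by measurable
  have shift: "(\<lambda>n. ereal (avg n (T x) - avg n x)) \<longlonglongrightarrow> 0" if x: "x \<in> space M" for x
  proof -
    have "\<bar>avg n (T x) - avg n x\<bar> \<le> 2 * B / real n" for n
    proof -
      have "birkhoff_sum T f n x + f ((T ^^ n) x) = birkhoff_sum T f (Suc n) x"
        by (simp add: birkhoff_sum_def)
      then have "birkhoff_sum T f n (T x) - birkhoff_sum T f n x = f ((T ^^ n) x) - f x"
        by (simp add: birkhoff_sum_Suc)
      moreover have "\<bar>f ((T ^^ n) x) - f x\<bar> \<le> 2 * B" using B[OF Tk_space[OF x, of n]] B[OF x] by linarith
      ultimately show ?thesis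
        by (simp add: avg_def diff_divide_distrib[symmetric] abs_divide divide_right_mono)
    qed
    then have "\<forall>\<^sub>F n in sequentially. norm (avg n (T x) - avg n x) \<le> 2 * B / real n" by simp
    from Lim_null_comparison[OF this lim_const_over_n]
    have "(\<lambda>n. avg n (T x) - avg n x) \<longlonglongrightarrow> 0" .
    then show ?thesis by (simp add: zero_ereal_def)
  qed
  have UT: "U (T x) = U x" if x: "x \<in> space M" for x
    using ereal_limsup_lim_add[OF shift[OF x], of "\<lambda>n. ereal (avg n x)"] by (simp add: U_def)
  have LT: "L (T x) = L x" if x: "x \<in> space M" for x
    using ereal_liminf_lim_add[OF shift[OF x], of "\<lambda>n. ereal (avg n x)"] by (simp add: L_def)
  have null: "AE x in M. \<not> (L x < ereal a \<and> ereal b < U x)" if ab: "a < b" for a b :: real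
  proof -
    define A where "A = {x \<in> space M. L x < ereal a \<and> ereal b < U x}"
    have [measurable]: "A \<in> sets M" unfolding A_def by measurable
    have inv: "T x \<in> A \<longleftrightarrow> x \<in> A" if "x \<in> space M" for x
      using that UT LT T_space by (simp add: A_def)
    have "b * prob A \<le> (\<integral>x. indicator A x * f x \<partial>M)"
    proof (rule integral_ge_of_averages[OF f B])
      fix x assume "x \<in> A"
      then have "ereal b < U x" by (simp add: A_def)
      show "\<exists>n>0. b < birkhoff_sum T f n x / real n"
      proof (rule ccontr)
        assume neg: "\<not> ?thesis"
        have "avg n x \<le> b" if "n > 0" for n
          using neg that unfolding avg_def by (meson not_le_imp_less)
        then have "U x \<le> ereal b" unfolding U_def
          by (intro Limsup_bounded eventually_mono[OF eventually_gt_at_top[of 0]]) simp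
        then show False using \<open>ereal b < U x\<close> by simp
      qed
    qed (use inv in auto)
    moreover have "- a * prob A \<le> (\<integral>x. indicator A x * - f x \<partial>M)"
    proof (rule integral_ge_of_averages[where B=B])
      fix x assume "x \<in> A"
      then have "L x < ereal a" by (simp add: A_def)
      have neg_avg: "birkhoff_sum T (\<lambda>x. - f x) n x / real n = - avg n x" for n
        by (simp add: birkhoff_sum_def avg_def sum_negf)
      show "\<exists>n>0. - a < birkhoff_sum T (\<lambda>x. - f x) n x / real n"
      proof (rule ccontr)
        assume neg: "\<not> ?thesis"
        have "a \<le> avg n x" if "n > 0" for n
          using neg that unfolding neg_avg neg_less_iff_less by (meson not_le_imp_less)
        then have "ereal a \<le> L x" unfolding L_def
          by (intro Liminf_bounded eventually_mono[OF eventually_gt_at_top[of 0]]) simp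
        then show False using \<open>L x < ereal a\<close> by simp
      qed
    qed (use B inv in auto)
    ultimately have "(b - a) * prob A \<le> 0" by (simp add: left_diff_distrib)
    then have "prob A = 0" using ab by (simp add: mult_le_0_iff measure_le_0_iff)
    then have "AE x in M. x \<notin> A" by (subst prob_eq_0[symmetric]) auto
    then show ?thesis using AE_space by eventually_elim (auto simp: A_def)
  qed
  \<comment> \<open>Rational thresholds leave only countably many exceptional sets.\<close>
  have "AE x in M. \<forall>a b :: rat. a < b \<longrightarrow> \<not> (L x < ereal (of_rat a) \<and> ereal (of_rat b) < U x)"
    unfolding AE_all_countable
    by (intro allI) (use null in \<open>auto simp: of_rat_less intro!: AE_impI\<close>)
  then have AE_lim: "AE x in M. (\<lambda>n. avg n x) \<longlonglongrightarrow> real_of_ereal (U x)"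
    using AE_space
  proof eventually_elim
    fix x
    assume *: "\<forall>a b :: rat. a < b \<longrightarrow> \<not> (L x < ereal (of_rat a) \<and> ereal (of_rat b) < U x)"
      and x: "x \<in> space M"
    have LU: "L x \<le> U x" unfolding L_def U_def by (rule Liminf_le_Limsup) simp
    have "\<not> L x < U x"
    proof
      assume "L x < U x"
      then obtain a where a: "L x < ereal (of_rat a)" "ereal (of_rat a) < U x" using ereal_dense3 by blast
      then obtain b where b: "ereal (of_rat a) < ereal (of_rat b)" "ereal (of_rat b) < U x"
        using ereal_dense3 by blast
      then show False using * a by (auto simp: of_rat_less)
    qed
    then have eq: "L x = U x" using LU by simp
    have "U x \<le> ereal B" unfolding U_def
      by (rule Limsup_bounded) (use avg_le[OF x] in \<open>auto simp: abs_le_iff\<close>)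
    moreover have "ereal (- B) \<le> L x" unfolding L_def
      by (rule Liminf_bounded) (use avg_le[OF x] in \<open>auto simp: abs_le_iff minus_le_iff\<close>)
    ultimately obtain r where r: "U x = ereal r" using eq by (cases "U x") auto
    have "(\<lambda>n. ereal (avg n x)) \<longlonglongrightarrow> U x"
      using eq by (intro tendsto_iff_Liminf_eq_Limsup[THEN iffD2]) (auto simp: L_def U_def)
    then show "(\<lambda>n. avg n x) \<longlonglongrightarrow> real_of_ereal (U x)" by (simp add: r)
  qed
  define F where "F x = real_of_ereal (U x)" for x
  have [measurable]: "F \<in> borel_measurable M" unfolding F_def[abs_def] by measurable
  have avg_AE: "AE x in M. norm (avg n x) \<le> B" for n using avg_le by (auto intro!: AE_I2)
  have wi: "integrable M (\<lambda>_. B)" by simp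
  have "(\<lambda>n. integral\<^sup>L M (avg n)) \<longlonglongrightarrow> integral\<^sup>L M F"
    by (rule integral_dominated_convergence[OF _ _ wi])
       (use AE_lim avg_AE in \<open>auto simp: F_def\<close>)
  moreover have "integral\<^sup>L M (avg n) = integral\<^sup>L M f" if "n > 0" for n
  proof -
    have "integrable M (\<lambda>x. f ((T ^^ k) x))" for k
      by (rule integrable_const_bound[where B=B])
         (use B Tk_space in \<open>auto intro!: AE_I2 measurable_compose[OF T_pow_meas]\<close>)
    then have "integral\<^sup>L M (avg n) = (\<Sum>k<n. (\<integral>x. f ((T ^^ k) x) \<partial>M)) / real n"
      unfolding avg_def birkhoff_sum_def
      by (simp add: Bochner_Integration.integral_sum)
    then show ?thesis using that by (simp add: integral_T_pow)
  qed
  then have "(\<lambda>n. integral\<^sup>L M (avg n)) \<longlonglongrightarrow> integral\<^sup>L M f"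
    by (intro tendsto_eventually eventually_sequentiallyI[of 1]) auto
  ultimately have eq: "integral\<^sup>L M F = integral\<^sup>L M f" by (rule LIMSEQ_unique)
  have int_F: "integrable M F"
    by (rule integrable_dominated_convergence[OF _ _ wi, where s=avg])
       (use AE_lim avg_AE in \<open>auto simp: F_def\<close>)
  show ?thesis
    using that[of F] AE_lim int_F eq by (simp add: F_def avg_def)
qed

end

section \<open>Additive cocycles over compact flows\<close>

text \<open>The overlap of the two blocks cancels, whatever the relative size of \<open>N\<close>
  and \<open>j\<close>. In the Krylov-Bogoliubov argument this shows that a translated average
  differs only by boundary terms.\<close>

lemma sum_shift_diff:
  fixes f :: "nat \<Rightarrow> real"
  shows "(\<Sum>i<N. f (i + j)) - (\<Sum>i<N. f i) = (\<Sum>i<j. f (i + N)) - (\<Sum>i<j. f i)"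
proof (induction N)
  case (Suc N)
  have "(\<Sum>i<j. f (i + Suc N)) - (\<Sum>i<j. f (i + N)) = f (j + N) - f N"
    using sum_lessThan_telescope[of "\<lambda>i. f (i + N)" j] by (simp add: sum_subtractf)
  then show ?case using Suc by (simp add: add.commute)
qed simp

text \<open>The laws are imposed on \<open>S\<close> only: the flow to which they are applied is
  conjugated by an embedding and has no meaning off its image.\<close>

locale compact_flow =
  fixes S :: "'a::{metric_space, second_countable_topology} set" and \<psi> :: "real \<Rightarrow> 'a \<Rightarrow> 'a"
  assumes compact: "compact S"
    and cont: "continuous_on (UNIV \<times> S) (\<lambda>(t, z). \<psi> t z)"
    and maps: "z \<in> S \<Longrightarrow> \<psi> t z \<in> S"
    and flow_0: "z \<in> S \<Longrightarrow> \<psi> 0 z = z"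
    and flow_add: "z \<in> S \<Longrightarrow> \<psi> (s + t) z = \<psi> s (\<psi> t z)"
begin

definition cocycle :: "(real \<Rightarrow> 'a \<Rightarrow> real) \<Rightarrow> bool" where
  "cocycle a \<longleftrightarrow> continuous_on (UNIV \<times> S) (\<lambda>(t, z). a t z) \<and>
     (\<forall>z\<in>S. \<forall>s t. a (s + t) z = a s (\<psi> t z) + a t z)"

text \<open>The forbidden order of the limits. They are taken over real times, so that they can be
  read as Lyapunov exponents.\<close>

abbreviation ordered_averages :: "(real \<Rightarrow> 'a \<Rightarrow> real) \<Rightarrow> (real \<Rightarrow> 'a \<Rightarrow> real) \<Rightarrow> 'a \<Rightarrow> bool" where
  "ordered_averages a b z \<equiv> \<exists>l m. ((\<lambda>t. a t z / t) \<longlongrightarrow> l) at_top \<and> ((\<lambda>t. b t z / t) \<longlongrightarrow> m) at_top \<and> m \<le> l"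

definition flow_invariant :: "'a measure \<Rightarrow> bool" where
  "flow_invariant \<nu> \<longleftrightarrow> prob_space \<nu> \<and> sets \<nu> = sets (restrict_space borel S) \<and>
     (\<forall>t. \<psi> t \<in> \<nu> \<rightarrow>\<^sub>M \<nu> \<and> distr \<nu> \<nu> (\<psi> t) = \<nu>)"

section \<open>Elementary properties of cocycles\<close>

lemma cont_time: "continuous_on S (\<psi> t)"
proof -
  have "continuous_on S (\<lambda>z. (t, z))" by (intro continuous_intros)
  from continuous_on_compose2[OF cont this] show ?thesis by auto
qed

lemma cocycle_cont:
  assumes "cocycle a"
  shows "continuous_on S (a t)"
proof -
  have "continuous_on (UNIV \<times> S) (\<lambda>(t, z). a t z)" using assms by (simp add: cocycle_def)
  moreover have "continuous_on S (\<lambda>z. (t, z))" by (intro continuous_intros)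
  ultimately have "continuous_on S (\<lambda>z. case (t, z) of (t, z) \<Rightarrow> a t z)"
    by (rule continuous_on_compose2) auto
  then show ?thesis by simp
qed

lemma cocycle_add: "cocycle a \<Longrightarrow> z \<in> S \<Longrightarrow> a (s + t) z = a s (\<psi> t z) + a t z"
  by (simp add: cocycle_def)

lemma cocycle_0: "cocycle a \<Longrightarrow> z \<in> S \<Longrightarrow> a 0 z = 0"
  using cocycle_add[of a z 0 0] by (simp add: flow_0)

lemma cocycle_diff: "cocycle a \<Longrightarrow> cocycle b \<Longrightarrow> cocycle (\<lambda>t z. a t z - b t z)"
  unfolding cocycle_def by (auto simp: case_prod_beta intro!: continuous_intros)

text \<open>Serves as a comparison cocycle: the dichotomy for pairs then also decides the sign of a
  single average.\<close>

lemma cocycle_zero: "cocycle (\<lambda>t z. 0)"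
  by (simp add: cocycle_def case_prod_beta)

lemma cocycle_bounded:
  assumes "cocycle a"
  obtains C where "C > 0" "\<And>s z. 0 \<le> s \<Longrightarrow> s \<le> r \<Longrightarrow> z \<in> S \<Longrightarrow> \<bar>a s z\<bar> \<le> C"
proof -
  have "compact ({0..r} \<times> S)" by (intro compact_Times compact compact_Icc)
  moreover have "continuous_on ({0..r} \<times> S) (\<lambda>(t, z). a t z)"
    using assms by (auto simp: cocycle_def intro: continuous_on_subset)
  ultimately have "bounded ((\<lambda>(t, z). a t z) ` ({0..r} \<times> S))"
    by (intro compact_imp_bounded compact_continuous_image)
  then obtain C where C: "C > 0" "\<forall>x \<in> (\<lambda>(t, z). a t z) ` ({0..r} \<times> S). norm x \<le> C"
    by (auto simp: bounded_pos)
  show ?thesis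
    by (rule that[OF C(1)]) (use C(2) in force)
qed

lemma cocycle_multiple:
  assumes "cocycle a" "z \<in> S"
  shows "a (real n * r) z = (\<Sum>k<n. a r (\<psi> (real k * r) z))"
proof (induction n)
  case (Suc n)
  have "a (real (Suc n) * r) z = a (r + real n * r) z" by (simp add: algebra_simps)
  then show ?case using Suc cocycle_add[OF assms, of r "real n * r"] by simp
qed (simp add: cocycle_0 assms)

lemma flow_pow: "z \<in> S \<Longrightarrow> (\<psi> r ^^ n) z = \<psi> (real n * r) z"
proof (induction n)
  case (Suc n)
  have "\<psi> (real (Suc n) * r) z = \<psi> (r + real n * r) z" by (simp add: algebra_simps)
  then show ?case using Suc flow_add[OF Suc.prems, of r "real n * r"] by simp
qed (simp add: flow_0)

text \<open>By compactness \<open>b\<close> is at most \<open>- \<delta>\<close> at time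
  \<open>n\<close> on all of \<open>S\<close>. A time \<open>t\<close> consists of \<open>k\<close>
  such blocks and a remainder on which \<open>b\<close> is at most \<open>C\<close>; the extra
  \<open>\<delta>\<close> in the constant pays for rounding \<open>t / real n\<close> down to
  \<open>k\<close>.\<close>

lemma cocycle_linear_decay:
  assumes b: "cocycle b" and n: "n > (0::nat)" and neg: "\<And>z. z \<in> S \<Longrightarrow> b (real n) z < 0"
  shows "\<exists>K. \<exists>\<delta>>0. \<forall>z\<in>S. \<forall>t\<ge>0. b t z \<le> K - \<delta> * t"
proof (cases "S = {}")
  case False
  obtain w where w: "w \<in> S" "\<And>z. z \<in> S \<Longrightarrow> b (real n) z \<le> b (real n) w"
    using continuous_attains_sup[OF compact False cocycle_cont[OF b]] by blast
  define \<delta> where "\<delta> = - b (real n) w"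
  have \<delta>: "\<delta> > 0" using neg[OF w(1)] by (simp add: \<delta>_def)
  obtain C where C: "C > 0" "\<And>s z. 0 \<le> s \<Longrightarrow> s \<le> real n \<Longrightarrow> z \<in> S \<Longrightarrow> \<bar>b s z\<bar> \<le> C"
    using cocycle_bounded[OF b] by blast
  have "b t z \<le> (C + \<delta>) - \<delta> / real n * t" if z: "z \<in> S" and t: "t \<ge> 0" for z t
  proof -
    define k where "k = nat \<lfloor>t / real n\<rfloor>"
    have k: "real k \<le> t / real n" "t / real n < real k + 1" using t by (auto simp: k_def)
    define s where "s = t - real k * real n"
    have s: "0 \<le> s" "s \<le> real n" using k n by (auto simp: s_def field_simps)
    have "b t z = b s (\<psi> (real k * real n) z) + b (real k * real n) z"
      using cocycle_add[OF b z, of s "real k * real n"] by (simp add: s_def)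
    moreover have "b s (\<psi> (real k * real n) z) \<le> C" using C(2)[OF s maps[OF z]] by (rule abs_le_D1)
    moreover have "b (real k * real n) z \<le> (\<Sum>j<k. - \<delta>)"
      unfolding cocycle_multiple[OF b z] using w(2)[OF maps[OF z]] by (intro sum_mono) (simp add: \<delta>_def)
    moreover have "\<delta> * (t / real n) \<le> \<delta> * (real k + 1)" using k(2) \<delta> by (intro mult_left_mono) auto
    ultimately show ?thesis by (simp add: algebra_simps)
  qed
  then show ?thesis using \<delta> n by (intro exI[of _ "C + \<delta>"] exI[of _ "\<delta> / real n"]) auto
qed (auto intro!: exI[of _ 1])

text \<open>Dyadic times approximate every \<open>s \<ge> 0\<close>, and dominated convergence
  passes to the limit; negative times follow by substitution. Since integrals of continuous
  functions determine a finite measure on \<open>S\<close>, equality of integrals is equality of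
  measures.\<close>

lemma flow_invariantI:
  assumes \<nu>: "prob_space \<nu>" "sets \<nu> = sets (restrict_space borel S)"
    and dyadic: "\<And>h :: 'a \<Rightarrow> real. \<And>p q :: nat. continuous_on S h \<Longrightarrow>
      (\<integral>z. h (\<psi> (real p / 2 ^ q) z) \<partial>\<nu>) = integral\<^sup>L \<nu> h"
  shows "flow_invariant \<nu>"
proof -
  interpret prob_space \<nu> by fact
  have sp: "space \<nu> = S" using sets_eq_imp_space_eq[OF \<nu>(2)] by (simp add: space_restrict_space)
  have meas: "h \<in> borel_measurable \<nu>" if "continuous_on S h" for h :: "'a \<Rightarrow> real"
    using borel_measurable_continuous_on_restrict[OF that] measurable_cong_sets[OF \<nu>(2) refl] by auto
  have \<psi>_meas: "\<psi> t \<in> \<nu> \<rightarrow>\<^sub>M \<nu>" for t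
  proof -
    have "\<psi> t \<in> restrict_space borel S \<rightarrow>\<^sub>M restrict_space borel S"
      by (rule measurable_restrict_space2)
         (use maps in \<open>auto simp: space_restrict_space borel_measurable_continuous_on_restrict[OF cont_time]\<close>)
    then show ?thesis using measurable_cong_sets[OF \<nu>(2) \<nu>(2)] by auto
  qed
  have cont_h: "continuous_on S (\<lambda>z. h (\<psi> t z))" if "continuous_on S h" for h :: "'a \<Rightarrow> real" and t
    by (rule continuous_on_compose2[OF that cont_time]) (use maps in auto)
  have nonneg: "(\<integral>z. h (\<psi> s z) \<partial>\<nu>) = integral\<^sup>L \<nu> h"
    if h: "continuous_on S h" and s: "s \<ge> 0" for h :: "'a \<Rightarrow> real" and s
  proof -
    obtain B where B: "\<And>z. z \<in> S \<Longrightarrow> \<bar>h z\<bar> \<le> B"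
      using compact_imp_bounded[OF compact_continuous_image[OF h compact]] by (auto simp: bounded_iff)
    define d where "d n = real (nat \<lfloor>2 ^ n * s\<rfloor>) / 2 ^ n" for n
    have "d \<longlonglongrightarrow> s"
    proof (rule LIMSEQ_I)
      fix e :: real assume "e > 0"
      then obtain n0 where n0: "(1/2) ^ n0 < e" using real_arch_pow_inv[of e "1/2"] by auto
      have "norm (d n - s) < e" if "n \<ge> n0" for n
      proof -
        have "real (nat \<lfloor>2 ^ n * s\<rfloor>) \<le> 2 ^ n * s" "2 ^ n * s < real (nat \<lfloor>2 ^ n * s\<rfloor>) + 1"
          using s by auto
        then have "d n \<le> s" "s < d n + (1/2) ^ n"
          by (simp_all add: d_def field_simps power_one_over)
        moreover have "(1/2::real) ^ n \<le> (1/2) ^ n0" using that by (intro power_decreasing) auto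
        ultimately show ?thesis using n0 unfolding real_norm_def by linarith
      qed
      then show "\<exists>n0. \<forall>n\<ge>n0. norm (d n - s) < e" by blast
    qed
    then have pt: "(\<lambda>n. h (\<psi> (d n) z)) \<longlonglongrightarrow> h (\<psi> s z)" if z: "z \<in> S" for z
    proof -
      have "continuous_on UNIV (\<lambda>t. (t, z))" by (intro continuous_intros)
      from continuous_on_compose2[OF cont this] z have "continuous_on UNIV (\<lambda>t. \<psi> t z)" by auto
      from continuous_on_compose2[OF h this] have c: "continuous_on UNIV (\<lambda>t. h (\<psi> t z))"
        using maps[OF z] by auto
      show ?thesis using \<open>d \<longlonglongrightarrow> s\<close> c by (intro continuous_on_tendsto_compose[OF c]) auto
    qed
    have "(\<lambda>n. \<integral>z. h (\<psi> (d n) z) \<partial>\<nu>) \<longlonglongrightarrow> (\<integral>z. h (\<psi> s z) \<partial>\<nu>)"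
      by (rule integral_dominated_convergence[where w="\<lambda>_. B"])
         (use pt B maps in \<open>auto intro!: meas cont_h h AE_I2 simp: sp\<close>)
    then show ?thesis using dyadic[OF h] LIMSEQ_unique[OF _ tendsto_const] by (simp add: d_def)
  qed
  have all: "(\<integral>z. h (\<psi> s z) \<partial>\<nu>) = integral\<^sup>L \<nu> h" if h: "continuous_on S h" for h :: "'a \<Rightarrow> real" and s
  proof (cases "s \<ge> 0")
    case False
    \<comment> \<open>For negative \<open>s\<close> the known invariance is applied at time
      \<open>- s\<close> to the function \<open>\<lambda>z. h (\<psi> s z)\<close>.\<close>
    have "(\<integral>z. h (\<psi> s z) \<partial>\<nu>) = (\<integral>z. h (\<psi> s (\<psi> (- s) z)) \<partial>\<nu>)"
      using nonneg[OF cont_h[OF h], of "- s" s] False by simp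
    also have "\<dots> = integral\<^sup>L \<nu> h"
      by (rule Bochner_Integration.integral_cong) (use flow_add[of _ s "- s"] in \<open>auto simp: sp flow_0\<close>)
    finally show ?thesis .
  qed (use nonneg h in auto)
  have "distr \<nu> \<nu> (\<psi> t) = \<nu>" for t
  proof (rule finite_measure_eqI_continuous_integrals[OF _ _ compact_imp_closed[OF compact]])
    show "finite_measure (distr \<nu> \<nu> (\<psi> t))"
      using prob_space_distr[OF \<psi>_meas] by (simp add: prob_space_def)
    fix h :: "'a \<Rightarrow> real" assume h: "continuous_on S h"
    show "integral\<^sup>L (distr \<nu> \<nu> (\<psi> t)) h = integral\<^sup>L \<nu> h"
      using all[OF h] by (subst integral_distr[OF \<psi>_meas meas[OF h]]) auto
  qed (use \<nu> in \<open>auto intro: finite_measure_axioms\<close>)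
  then show ?thesis using \<nu> \<psi>_meas by (simp add: flow_invariant_def)
qed

text \<open>Krylov-Bogoliubov. Sampling the orbits at times \<open>i / 2\<^sup>m\<close>, with \<open>m\<close> growing along the sequence,
  makes the limit invariant under all dyadic times while the sampled measures stay finitely supported.\<close>

lemma invariant_measure_nonneg_integral:
  assumes b: "cocycle b" and nn: "\<And>n::nat. n > 0 \<Longrightarrow> \<exists>z\<in>S. b (real n) z \<ge> 0"
  obtains \<nu> where "flow_invariant \<nu>" "integral\<^sup>L \<nu> (b 1) \<ge> 0"
proof -
  have "\<forall>n. \<exists>z. z \<in> S \<and> b (real (Suc n)) z \<ge> 0" using nn[OF zero_less_Suc] by blast
  from choice[OF this] obtain z where "\<forall>n. z n \<in> S \<and> b (real (Suc n)) (z n) \<ge> 0" ..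
  then have z: "z n \<in> S" "b (real (Suc n)) (z n) \<ge> 0" for n by simp_all
  define y where "y m i = \<psi> (real i / 2 ^ m) (z m)" for m i :: nat
  \<comment> \<open>The \<open>m\<close>-th sample follows the orbit of \<open>z m\<close> in steps
    of \<open>1 / 2 ^ m\<close> during time \<open>Suc m\<close>, exactly the time at which
    \<open>b\<close> is known to be nonnegative at \<open>z m\<close>.\<close>
  define N :: "nat \<Rightarrow> nat" where "N m = Suc m * 2 ^ m" for m
  define avg where "avg h m = (\<Sum>i<N m. h (y m i)) / real (N m)" for h :: "'a \<Rightarrow> real" and m
  have yS: "y m i \<in> S" for m i unfolding y_def by (intro maps z)
  have Npos: "N m > 0" for m unfolding N_def by (simp del: of_nat_Suc mult_Suc)
  obtain r \<nu> where r: "strict_mono r" and \<nu>: "prob_space \<nu>" "sets \<nu> = sets (restrict_space borel S)"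
    and lim: "\<And>h. continuous_on S h \<Longrightarrow> (\<lambda>n. avg h (r n)) \<longlonglongrightarrow> integral\<^sup>L \<nu> h"
    by (rule empirical_measures_subseq_limit[where S=S and N=N and z=y, OF compact Npos yS, folded avg_def])
      (rule that)
  have rn: "n \<le> r n" for n using seq_suble[OF r] .
  have dyadic: "(\<integral>z. h (\<psi> (real p / 2 ^ q) z) \<partial>\<nu>) = integral\<^sup>L \<nu> h"
    if h: "continuous_on S h" for h :: "'a \<Rightarrow> real" and p q :: nat
  proof -
    obtain B where B: "\<And>z. z \<in> S \<Longrightarrow> \<bar>h z\<bar> \<le> B"
      using compact_imp_bounded[OF compact_continuous_image[OF h compact]] by (auto simp: bounded_iff)
    have B0: "0 \<le> B" using B[OF yS[of 0 0]] by linarith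
    let ?s = "real p / 2 ^ q"
    have "continuous_on S (\<lambda>z. h (\<psi> ?s z))"
      by (rule continuous_on_compose2[OF h cont_time]) (use maps in auto)
    note lim[OF this]
    moreover have "(\<lambda>n. avg (\<lambda>z. h (\<psi> ?s z)) (r n) - avg h (r n)) \<longlonglongrightarrow> 0"
    proof (rule Lim_null_comparison)
      show "\<forall>\<^sub>F n in sequentially. norm (avg (\<lambda>z. h (\<psi> ?s z)) (r n) - avg h (r n)) \<le> 2 * ?s * B / real (Suc n)"
        using eventually_ge_at_top[of q]
      proof eventually_elim
        fix n assume "q \<le> n"
        define m where "m = r n"
        have m: "q \<le> m" "n \<le> m" using \<open>q \<le> n\<close> rn[of n] by (auto simp: m_def)
        \<comment> \<open>Once \<open>q \<le> m\<close>, the dyadic time is a whole number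
          \<open>j\<close> of grid steps, and translation by it only brings in boundary terms,
          \<open>j\<close> at each end; the proportion \<open>j / N m\<close> equals
          \<open>?s / Suc m\<close>.\<close>
        define j where "j = p * 2 ^ (m - q)"
        have js: "real j / 2 ^ m = ?s"
          using m(1) by (simp add: j_def field_simps power_add[symmetric])
        have "\<psi> ?s (y m i) = y m (i + j)" for i
          unfolding y_def flow_add[OF z(1), symmetric] using js by (simp add: add_divide_distrib add.commute)
        then have "(\<Sum>i<N m. h (\<psi> ?s (y m i))) - (\<Sum>i<N m. h (y m i))
            = (\<Sum>i<j. h (y m (i + N m)) - h (y m i))"
          using sum_shift_diff[of "\<lambda>i. h (y m i)" j "N m"] by (simp add: sum_subtractf)
        moreover have "\<bar>\<Sum>i<j. h (y m (i + N m)) - h (y m i)\<bar> \<le> (\<Sum>i<j. 2 * B)"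
        proof (intro order_trans[OF sum_abs] sum_mono)
          fix i show "\<bar>h (y m (i + N m)) - h (y m i)\<bar> \<le> 2 * B"
            using B[OF yS[of m i]] B[OF yS[of m "i + N m"]] by linarith
        qed
        ultimately have "norm (avg (\<lambda>z. h (\<psi> ?s z)) m - avg h m) \<le> real j * (2 * B) / real (N m)"
          by (simp add: avg_def diff_divide_distrib[symmetric] abs_divide divide_right_mono)
        also have "\<dots> = 2 * (real j / 2 ^ m) * B / real (Suc m)" by (simp add: N_def field_simps)
        also have "\<dots> \<le> 2 * ?s * B / real (Suc n)"
          unfolding js using m(2) B0 by (intro divide_left_mono mult_nonneg_nonneg) auto
        finally show "norm (avg (\<lambda>z. h (\<psi> ?s z)) (r n) - avg h (r n)) \<le> 2 * ?s * B / real (Suc n)"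
          by (simp add: m_def)
      qed
      show "(\<lambda>n. 2 * ?s * B / real (Suc n)) \<longlonglongrightarrow> 0" by (rule LIMSEQ_Suc[OF lim_const_over_n])
    qed
    ultimately have "(\<lambda>n. avg h (r n)) \<longlonglongrightarrow> (\<integral>z. h (\<psi> ?s z) \<partial>\<nu>)"
      by (rule Lim_transform2)
    then show ?thesis by (rule LIMSEQ_unique[OF _ lim[OF h]])
  qed
  obtain C where C: "C > 0" "\<And>s z. 0 \<le> s \<Longrightarrow> s \<le> 1 \<Longrightarrow> z \<in> S \<Longrightarrow> \<bar>b s z\<bar> \<le> C"
    using cocycle_bounded[OF b] by blast
  \<comment> \<open>The grid is split by residues \<open>j\<close> modulo \<open>2 ^ m\<close>.
    Along each class the time-one values add up to \<open>b (Suc m)\<close> started at time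
    \<open>j / 2 ^ m\<close>, and moving the start back to \<open>z m\<close> costs two values of
    \<open>b\<close> at a time in \<open>[0,1]\<close>, hence \<open>2 * C\<close>. There are
    \<open>2 ^ m\<close> classes among \<open>N m\<close> samples.\<close>
  have avg_ge: "- (2 * C) / real (Suc m) \<le> avg (b 1) m" for m
  proof -
    have "(\<Sum>i<N m. b 1 (y m i)) = (\<Sum>k<Suc m. \<Sum>j<2^m. b 1 (y m (k * 2^m + j)))"
    proof -
      have "(\<Sum>i<N m. b 1 (y m i)) = (\<Sum>k<Suc m. sum (\<lambda>i. b 1 (y m i)) {k * 2^m..<k * 2^m + 2^m})"
        unfolding N_def by (rule sum.nat_group[symmetric])
      also have "\<dots> = (\<Sum>k<Suc m. \<Sum>j<2^m. b 1 (y m (k * 2^m + j)))"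
      proof (rule sum.cong[OF refl])
        fix k
        show "sum (\<lambda>i. b 1 (y m i)) {k * 2^m..<k * 2^m + 2^m} = (\<Sum>j<2^m. b 1 (y m (k * 2^m + j)))"
          using sum.shift_bounds_nat_ivl[of "\<lambda>i. b 1 (y m i)" 0 "k * 2^m" "2^m"]
          by (simp add: add.commute atLeast0LessThan)
      qed
      finally show ?thesis .
    qed
    also have "\<dots> = (\<Sum>j<2^m. \<Sum>k<Suc m. b 1 (y m (k * 2^m + j)))" by (rule sum.swap)
    also have "\<dots> \<ge> (\<Sum>j<(2::nat)^m. - (2 * C))"
    proof (rule sum_mono)
      fix j :: nat assume j: "j \<in> {..<2^m}"
      define s where "s = real j / 2 ^ m"
      have s: "0 \<le> s" "s \<le> 1" using j by (auto simp: s_def divide_simps of_nat_less_iff[symmetric] simp del: of_nat_less_iff)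
      have "y m (k * 2^m + j) = \<psi> (real k * 1) (\<psi> s (z m))" for k
        unfolding y_def flow_add[OF z(1), symmetric] by (simp add: s_def add_divide_distrib)
      then have "(\<Sum>k<Suc m. b 1 (y m (k * 2^m + j))) = b (real (Suc m) * 1) (\<psi> s (z m))"
        using cocycle_multiple[OF b maps[OF z(1)], of "Suc m" 1 s m] by simp
      also have "\<dots> = b s (\<psi> (real (Suc m)) (z m)) + b (real (Suc m)) (z m) - b s (z m)"
        using cocycle_add[OF b z(1), of "real (Suc m)" s m] cocycle_add[OF b z(1), of s "real (Suc m)" m]
        by (simp add: add.commute)
      also have "\<dots> \<ge> - (2 * C)"
        using C(2)[OF s z(1)[of m]] C(2)[OF s maps[OF z(1)[of m], of "real (Suc m)"]] z(2)[of m] by linarith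
      finally show "- (2 * C) \<le> (\<Sum>k<Suc m. b 1 (y m (k * 2^m + j)))" .
    qed
    finally have "- (2 * C) * 2 ^ m \<le> (\<Sum>i<N m. b 1 (y m i))" by (simp add: mult.commute)
    then have "(- (2 * C) * 2 ^ m) / real (N m) \<le> (\<Sum>i<N m. b 1 (y m i)) / real (N m)"
      by (rule divide_right_mono) simp
    moreover have "(- (2 * C) * 2 ^ m) / real (N m) = - (2 * C) / real (Suc m)"
      unfolding N_def of_nat_mult of_nat_power by simp
    ultimately show ?thesis by (simp add: avg_def)
  qed
  have "integral\<^sup>L \<nu> (b 1) \<ge> 0"
  proof (rule LIMSEQ_le)
    show "(\<lambda>n. - (2 * C) / real (Suc n)) \<longlonglongrightarrow> 0" by (rule LIMSEQ_Suc[OF lim_const_over_n])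
    show "(\<lambda>n. avg (b 1) (r n)) \<longlonglongrightarrow> integral\<^sup>L \<nu> (b 1)"
      by (rule lim[OF cocycle_cont[OF b]])
    have "- (2 * C) / real (Suc n) \<le> - (2 * C) / real (Suc (r n))" for n
      using rn[of n] C(1) by (simp add: divide_left_mono)
    then show "\<exists>N0. \<forall>n\<ge>N0. - (2 * C) / real (Suc n) \<le> avg (b 1) (r n)"
      using avg_ge order_trans by blast
  qed
  then show ?thesis using that flow_invariantI[OF \<nu> dyadic] by blast
qed

text \<open>Time is split into its integer part \<open>k t\<close> and a remainder of length below
  1, on which the cocycle is bounded, and \<open>k t / t\<close> tends to 1.\<close>

lemma cocycle_average_continuous_time:
  assumes a: "cocycle a" and z: "z \<in> S" and lim: "(\<lambda>n. a (real n) z / real n) \<longlonglongrightarrow> l"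
  shows "((\<lambda>t. a t z / t) \<longlongrightarrow> l) at_top"
proof -
  obtain C where C: "C > 0" "\<And>s z. 0 \<le> s \<Longrightarrow> s \<le> 1 \<Longrightarrow> z \<in> S \<Longrightarrow> \<bar>a s z\<bar> \<le> C"
    using cocycle_bounded[OF a] by blast
  define k where "k t = nat \<lfloor>t\<rfloor>" for t :: real
  have k: "real (k t) \<le> t" "t < real (k t) + 1" if "t \<ge> 0" for t using that by (auto simp: k_def)
  have kinf: "filterlim k sequentially at_top"
    unfolding k_def[abs_def]
    by (rule filterlim_compose[OF filterlim_nat_sequentially filterlim_floor_sequentially])
  have inv: "((\<lambda>t::real. c / t) \<longlongrightarrow> 0) at_top" for c :: real
    by (intro tendsto_divide_0[OF tendsto_const] filterlim_at_top_imp_at_infinity filterlim_ident)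
  have 1: "((\<lambda>t. a (real (k t)) z / real (k t)) \<longlongrightarrow> l) at_top"
    by (rule filterlim_compose[OF lim kinf])
  have 2: "((\<lambda>t. real (k t) / t) \<longlongrightarrow> 1) at_top"
  proof (rule tendsto_sandwich)
    show "\<forall>\<^sub>F t in at_top. 1 - 1 / t \<le> real (k t) / t"
      using eventually_gt_at_top[of 0]
    proof eventually_elim
      fix t :: real assume t: "t > 0"
      then have "1 - 1 / t = (t - 1) / t" by (simp add: field_simps)
      also have "\<dots> \<le> real (k t) / t" using k(2)[of t] t by (intro divide_right_mono) auto
      finally show "1 - 1 / t \<le> real (k t) / t" .
    qed
    show "\<forall>\<^sub>F t in at_top. real (k t) / t \<le> 1"
      using eventually_gt_at_top[of 0]
    proof eventually_elim
      fix t :: real assume "t > 0" then show "real (k t) / t \<le> 1"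
        using k(1)[of t] by (simp add: field_simps)
    qed
    show "((\<lambda>t::real. 1 - 1 / t) \<longlongrightarrow> 1) at_top" using tendsto_diff[OF tendsto_const inv, of 1 1] by simp
  qed simp
  have 3: "((\<lambda>t. a (t - real (k t)) (\<psi> (real (k t)) z) / t) \<longlongrightarrow> 0) at_top"
  proof (rule Lim_null_comparison[OF _ inv])
    show "\<forall>\<^sub>F t in at_top. norm (a (t - real (k t)) (\<psi> (real (k t)) z) / t) \<le> C / t"
      using eventually_gt_at_top[of 0]
    proof eventually_elim
      fix t :: real assume t: "t > 0"
      have "\<bar>a (t - real (k t)) (\<psi> (real (k t)) z)\<bar> \<le> C"
        by (rule C(2)) (use t k[of t] maps z in auto)
      then show "norm (a (t - real (k t)) (\<psi> (real (k t)) z) / t) \<le> C / t"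
        using t by (simp add: abs_divide divide_right_mono)
    qed
  qed
  have "((\<lambda>t. a (t - real (k t)) (\<psi> (real (k t)) z) / t + a (real (k t)) z / real (k t) * (real (k t) / t))
     \<longlongrightarrow> 0 + l * 1) at_top"
    by (intro tendsto_add tendsto_mult 1 2 3)
  \<comment> \<open>Beyond time 1 the integer part is positive, so the division by
    \<open>real (k t)\<close> is a genuine one.\<close>
  moreover have "\<forall>\<^sub>F t in at_top. a (t - real (k t)) (\<psi> (real (k t)) z) / t
      + a (real (k t)) z / real (k t) * (real (k t) / t) = a t z / t"
    using eventually_gt_at_top[of 1]
  proof eventually_elim
    fix t :: real assume t: "t > 1"
    then have "k t > 0" using k(2)[of t] by (cases "k t") auto
    then show "a (t - real (k t)) (\<psi> (real (k t)) z) / t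
      + a (real (k t)) z / real (k t) * (real (k t) / t) = a t z / t"
      using cocycle_add[OF a z, of "t - real (k t)" "real (k t)"] t by (simp add: field_simps)
  qed
  ultimately show ?thesis by (simp add: tendsto_cong)
qed

text \<open>If \<open>a - b\<close> is negative on all of \<open>S\<close> at one positive integer
  time, it decays linearly. Otherwise some invariant measure gives \<open>a 1\<close> a mean at
  least that of \<open>b 1\<close>; the Birkhoff limits \<open>F\<close> and \<open>G\<close> exist
  for the two cocycles separately and keep these means, so \<open>F < G\<close> almost everywhere is
  impossible. The negated \<open>AE\<close> expresses positive probability without asserting that
  the set is measurable.\<close>

theorem cocycle_decay_or_invariant_measure:
  assumes a: "cocycle a" and b: "cocycle b"
  shows "(\<exists>K. \<exists>\<delta>>0. \<forall>z\<in>S. \<forall>t\<ge>0. a t z - b t z \<le> K - \<delta> * t) \<or>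
    (\<exists>\<nu>. flow_invariant \<nu> \<and>
      \<not> (AE z in \<nu>. \<not> ordered_averages a b z))"
proof (cases "\<exists>n::nat. n > 0 \<and> (\<forall>z\<in>S. a (real n) z - b (real n) z < 0)")
  case True
  then show ?thesis using cocycle_linear_decay[OF cocycle_diff[OF a b]] by blast
next
  case False
  then have "\<And>n::nat. n > 0 \<Longrightarrow> \<exists>z\<in>S. a (real n) z - b (real n) z \<ge> 0" by (meson not_le)
  then obtain \<nu> where \<nu>: "flow_invariant \<nu>" and pos: "(\<integral>z. a 1 z - b 1 z \<partial>\<nu>) \<ge> 0"
    using invariant_measure_nonneg_integral[OF cocycle_diff[OF a b]] by blast
  have sets: "sets \<nu> = sets (restrict_space borel S)" using \<nu> by (simp add: flow_invariant_def)
  have sp: "space \<nu> = S" using sets_eq_imp_space_eq[OF sets] by (simp add: space_restrict_space)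
  interpret measure_preserving \<nu> "\<psi> 1"
    using \<nu> by (auto simp: flow_invariant_def measure_preserving_def measure_preserving_axioms_def)
  have erg: "\<exists>F. integrable \<nu> F \<and> integral\<^sup>L \<nu> F = integral\<^sup>L \<nu> (c 1) \<and> integrable \<nu> (c 1) \<and>
      (AE z in \<nu>. ((\<lambda>t. c t z / t) \<longlongrightarrow> F z) at_top)" if c: "cocycle c" for c
  proof -
    have m: "c 1 \<in> borel_measurable \<nu>"
      using borel_measurable_continuous_on_restrict[OF cocycle_cont[OF c, of 1]]
        measurable_cong_sets[OF sets refl] by auto
    obtain C where C: "\<And>z. z \<in> S \<Longrightarrow> \<bar>c 1 z\<bar> \<le> C"
      using cocycle_bounded[OF c, of 1] by (metis order_refl zero_le_one)
    then have C': "\<And>z. z \<in> space \<nu> \<Longrightarrow> \<bar>c 1 z\<bar> \<le> C" by (simp add: sp)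
    obtain F where F: "AE z in \<nu>. (\<lambda>n. birkhoff_sum (\<psi> 1) (c 1) n z / real n) \<longlonglongrightarrow> F z"
      "integrable \<nu> F" "integral\<^sup>L \<nu> F = integral\<^sup>L \<nu> (c 1)"
      using birkhoff_ergodic[OF m C'] by blast
    have "AE z in \<nu>. ((\<lambda>t. c t z / t) \<longlongrightarrow> F z) at_top"
      using F(1) AE_space
    proof eventually_elim
      fix z assume *: "(\<lambda>n. birkhoff_sum (\<psi> 1) (c 1) n z / real n) \<longlonglongrightarrow> F z" and "z \<in> space \<nu>"
      then have z: "z \<in> S" by (simp add: sp)
      have "birkhoff_sum (\<psi> 1) (c 1) n z = c (real n) z" for n
        using cocycle_multiple[OF c z, of n 1] by (simp add: birkhoff_sum_def flow_pow[OF z])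
      then show "((\<lambda>t. c t z / t) \<longlongrightarrow> F z) at_top"
        using * by (intro cocycle_average_continuous_time[OF c z]) simp
    qed
    moreover have "integrable \<nu> (c 1)"
      by (rule integrable_const_bound[where B=C]) (use C' m in auto)
    ultimately show ?thesis using F by blast
  qed
  obtain F where F: "integrable \<nu> F" "integral\<^sup>L \<nu> F = integral\<^sup>L \<nu> (a 1)" "integrable \<nu> (a 1)"
      "AE z in \<nu>. ((\<lambda>t. a t z / t) \<longlongrightarrow> F z) at_top" using erg[OF a] by blast
  obtain G where G: "integrable \<nu> G" "integral\<^sup>L \<nu> G = integral\<^sup>L \<nu> (b 1)" "integrable \<nu> (b 1)"
      "AE z in \<nu>. ((\<lambda>t. b t z / t) \<longlongrightarrow> G z) at_top" using erg[OF b] by blast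
  have "\<not> (AE z in \<nu>. \<not> ordered_averages a b z)"
  proof
    assume "AE z in \<nu>. \<not> ordered_averages a b z"
    then have "AE z in \<nu>. F z < G z"
      using F(4) G(4) by eventually_elim (meson not_le)
    then have "integral\<^sup>L \<nu> F < integral\<^sup>L \<nu> G"
      by (intro integral_less_AE_space F G) (simp_all add: emeasure_space_1)
    then show False using pos F G by (simp add: Bochner_Integration.integral_diff)
  qed
  then show ?thesis using \<nu> by blast
qed

end

section \<open>The flow in charts\<close>

lemma integral_curve_shift:
  assumes \<gamma>: "integral_curve A X \<gamma> I" and J: "(+) c ` J \<subseteq> I"
  shows "integral_curve A X (\<lambda>s. \<gamma> (c + s)) J"
  unfolding integral_curve_def
proof (intro conjI ballI)
  show "continuous_on J (\<lambda>s. \<gamma> (c + s))"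
    by (rule continuous_on_compose2[of I \<gamma>])
       (use \<gamma> J in \<open>auto simp: integral_curve_def intro!: continuous_intros\<close>)
  fix t assume t: "t \<in> J"
  let ?f = "\<lambda>s. snd (chart_at A (\<gamma> (c + t))) (\<gamma> s)"
  have "(?f has_vector_derivative X (\<gamma> (c + t))) (at (c + t) within (+) c ` J)"
    using \<gamma> J t unfolding integral_curve_def
    by (meson has_vector_derivative_within_subset image_eqI subsetD)
  moreover have "((+) c has_vector_derivative 1) (at t within J)"
    by (auto intro!: derivative_eq_intros)
  ultimately show "((\<lambda>s. ?f (c + s)) has_vector_derivative X (\<gamma> (c + t))) (at t within J)"
    using vector_diff_chain_within[of "(+) c" 1 t J ?f "X (\<gamma> (c + t))"] by (simp add: o_def)
qed

section \<open>Orbits, charts and the boundary\<close>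

locale manifold_flow =
  fixes A :: "('m::{t2_space,second_countable_topology}, 'e::euclidean_space) atlas"
    and g :: "'m \<Rightarrow> 'e \<Rightarrow> 'e \<Rightarrow> real"
    and X :: "'m \<Rightarrow> 'e"
    and \<phi> :: "real \<Rightarrow> 'm \<Rightarrow> 'm"
    and \<Lambda> :: "'m set"
  assumes atlas: "smooth_atlas A" and metric: "riemannian_metric A g"
    and inward: "inwardly_transverse A X" and flow: "flow_of A X \<phi>"
    and compact_\<Lambda>: "compact \<Lambda>" and inv: "invariant_set A X \<phi> \<Lambda>"
begin

abbreviation D where "D \<equiv> interior_flow_domain A X \<phi>"

lemma flow_curve: "integral_curve A X \<gamma> (closed_segment 0 t) \<Longrightarrow> \<phi> t (\<gamma> 0) = \<gamma> t"
  using flow by (simp add: flow_of_def)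

text \<open>Restarting \<open>\<gamma>\<close> at time \<open>a\<close> gives an integral curve on
  the segment from 0 to \<open>b - a\<close>, on which it must agree with the flow; \<open>b\<close>
  may precede \<open>a\<close>.\<close>

lemma flow_along_curve:
  assumes \<gamma>: "integral_curve A X \<gamma> (closed_segment 0 T)"
    and a: "a \<in> closed_segment 0 T" and b: "b \<in> closed_segment 0 T"
  shows "\<phi> (b - a) (\<gamma> a) = \<gamma> b"
proof -
  have "(+) a ` closed_segment 0 (b - a) \<subseteq> closed_segment 0 T"
    using a b by (auto simp: closed_segment_eq_real_ivl split: if_splits)
  from flow_curve[OF integral_curve_shift[OF \<gamma> this]] show ?thesis by simp
qed

text \<open>No curves are glued: depending on the signs and sizes of \<open>s\<close> and
  \<open>t\<close>, one of the three given integral curves already passes through all three points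
  \<open>y\<close>, \<open>\<phi> t y\<close> and \<open>\<phi> (s + t) y\<close>.\<close>

lemma flow_comp:
  assumes t: "(t, y) \<in> flow_domain A X" and s: "(s, \<phi> t y) \<in> flow_domain A X"
    and st: "(s + t, y) \<in> flow_domain A X"
  shows "\<phi> s (\<phi> t y) = \<phi> (s + t) y"
proof -
  obtain \<gamma> where \<gamma>: "integral_curve A X \<gamma> (closed_segment 0 t)" "\<gamma> 0 = y"
    using t by (auto simp: flow_domain_def)
  obtain \<delta> where \<delta>: "integral_curve A X \<delta> (closed_segment 0 s)" "\<delta> 0 = \<phi> t y"
    using s by (auto simp: flow_domain_def)
  obtain \<epsilon> where \<epsilon>: "integral_curve A X \<epsilon> (closed_segment 0 (s + t))" "\<epsilon> 0 = y"
    using st by (auto simp: flow_domain_def)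
  have "t \<in> closed_segment 0 (s + t) \<or> s + t \<in> closed_segment 0 t \<or> - t \<in> closed_segment 0 s"
    by (auto simp: closed_segment_eq_real_ivl)
  then consider "t \<in> closed_segment 0 (s + t)" | "s + t \<in> closed_segment 0 t" | "- t \<in> closed_segment 0 s"
    by blast
  then show ?thesis
  proof cases
    case 1
    have "\<phi> t y = \<epsilon> t" using flow_along_curve[OF \<epsilon>(1) _ 1, of 0] \<epsilon>(2) by simp
    then show ?thesis
      using flow_along_curve[OF \<epsilon>(1) 1, of "s + t"] flow_curve[OF \<epsilon>(1)] \<epsilon>(2) by simp
  next
    case 2
    have "\<phi> t y = \<gamma> t" using flow_curve[OF \<gamma>(1)] \<gamma>(2) by simp
    moreover have "\<phi> (s + t) y = \<gamma> (s + t)" using flow_along_curve[OF \<gamma>(1) _ 2, of 0] \<gamma>(2) by simp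
    ultimately show ?thesis using flow_along_curve[OF \<gamma>(1) _ 2, of t] by simp
  next
    case 3
    have "\<phi> (- t) (\<phi> t y) = y"
      using flow_curve[OF \<gamma>(1)] flow_along_curve[OF \<gamma>(1), of t 0] \<gamma>(2) by simp
    moreover have "\<phi> (- t) (\<phi> t y) = \<delta> (- t)" using flow_along_curve[OF \<delta>(1) _ 3, of 0] \<delta>(2) by simp
    ultimately have "\<delta> (- t) = y" by simp
    then show ?thesis
      using flow_along_curve[OF \<delta>(1) 3, of s] flow_curve[OF \<delta>(1)] \<delta>(2) by simp
  qed
qed

lemma flow_zero [simp]: "\<phi> 0 y = y"
proof -
  \<comment> \<open>Within a single point every bounded linear map is a derivative, so the constant
    curve qualifies even where \<open>X y\<close> is nonzero.\<close>
  have "integral_curve A X (\<lambda>_. y) (closed_segment 0 0)"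
    by (simp add: integral_curve_def has_vector_derivative_def has_derivative_within_singleton_iff
        bounded_linear_scaleR_left)
  from flow_curve[OF this] show ?thesis by simp
qed

lemma in_flow_domain: "x \<in> \<Lambda> \<Longrightarrow> (t, x) \<in> flow_domain A X"
  using inv by (simp add: invariant_set_def)

lemma flow_in: "x \<in> \<Lambda> \<Longrightarrow> \<phi> t x \<in> \<Lambda>"
  using inv by (auto simp: invariant_set_def)

lemma flow_add: "x \<in> \<Lambda> \<Longrightarrow> \<phi> (s + t) x = \<phi> s (\<phi> t x)"
  by (rule flow_comp[symmetric]) (auto intro: in_flow_domain flow_in)

lemma chart_at_in [simp]: "chart_at A x \<in> A" and in_chart_at [simp]: "x \<in> fst (chart_at A x)"
proof -
  have "x \<in> (\<Union>c\<in>A. fst c)" using atlas by (simp add: smooth_atlas_def)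
  then have "\<exists>c. c \<in> A \<and> x \<in> fst c" by blast
  from someI_ex[OF this] show "chart_at A x \<in> A" "x \<in> fst (chart_at A x)"
    by (simp_all add: chart_at_def)
qed

lemma chart_open: "c \<in> A \<Longrightarrow> open (fst c)"
  and chart_image_openin: "c \<in> A \<Longrightarrow> openin (top_of_set half_space) (chart_image c)"
  and chart_homeo: "c \<in> A \<Longrightarrow> homeomorphism (fst c) (chart_image c) (snd c) (chart_inv c)"
  using atlas by (simp_all add: smooth_atlas_def)

lemma chart_inv_chart: "c \<in> A \<Longrightarrow> x \<in> fst c \<Longrightarrow> chart_inv c (snd c x) = x"
  and chart_chart_inv: "c \<in> A \<Longrightarrow> y \<in> chart_image c \<Longrightarrow> snd c (chart_inv c y) = y"
  and chart_inv_in: "c \<in> A \<Longrightarrow> y \<in> chart_image c \<Longrightarrow> chart_inv c y \<in> fst c"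
  and chart_cont: "c \<in> A \<Longrightarrow> continuous_on (fst c) (snd c)"
  and chart_inv_cont: "c \<in> A \<Longrightarrow> continuous_on (chart_image c) (chart_inv c)"
  using chart_homeo[of c] by (auto simp: homeomorphism_def)

lemma chart_in_image: "x \<in> fst c \<Longrightarrow> snd c x \<in> chart_image c"
  by (simp add: chart_image_def)

lemma chart_in_half_space: "c \<in> A \<Longrightarrow> x \<in> fst c \<Longrightarrow> 0 \<le> snd c x \<bullet> inward_normal"
  using openin_imp_subset[OF chart_image_openin, of c] chart_in_image[of x c]
  unfolding half_space_def by blast

text \<open>The vector field points inwards at the boundary, so the backward orbit of a boundary point
  would leave the half-space.\<close>

lemma not_boundary:
  assumes x: "x \<in> \<Lambda>"
  shows "x \<notin> mboundary A"
proof
  assume bd: "x \<in> mboundary A"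
  obtain \<gamma> where \<gamma>: "integral_curve A X \<gamma> (closed_segment 0 (- 1))" "\<gamma> 0 = x"
    using in_flow_domain[OF x, of "- 1"] by (auto simp: flow_domain_def)
  have seg: "closed_segment 0 (- 1) = {- 1..0::real}" by (simp add: closed_segment_eq_real_ivl)
  let ?c = "chart_at A x"
  define f where "f s = snd ?c (\<gamma> s) \<bullet> inward_normal" for s
  have "((\<lambda>s. snd ?c (\<gamma> s)) has_vector_derivative X x) (at 0 within {- 1..0})"
    using \<gamma> by (auto simp: integral_curve_def seg dest: bspec[of _ _ 0])
  from bounded_linear.has_vector_derivative[OF bounded_linear_inner_left this]
  have "(f has_real_derivative X x \<bullet> inward_normal) (at 0 within {- 1..0})"
    by (simp add: f_def[abs_def] has_real_derivative_iff_has_vector_derivative)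
  moreover have "X x \<bullet> inward_normal > 0" using inward bd by (simp add: inwardly_transverse_def)
  ultimately obtain d where d: "d > 0" "\<And>h. h > 0 \<Longrightarrow> 0 - h \<in> {- 1..0} \<Longrightarrow> h < d \<Longrightarrow> f (0 - h) < f 0"
    using has_real_derivative_pos_inc_left[of f "X x \<bullet> inward_normal" 0 "{- 1..0}"] by metis
  have f0: "f 0 = 0" using bd \<gamma>(2) by (simp add: f_def mboundary_def)
  have "continuous_on {- 1..0} \<gamma>" using \<gamma> by (simp add: integral_curve_def seg)
  then have "(\<gamma> \<longlongrightarrow> x) (at 0 within {- 1..0})" using \<gamma>(2) by (auto simp: continuous_on_def)
  from topological_tendstoD[OF this chart_open[OF chart_at_in] in_chart_at]
  obtain e where e: "e > 0" "\<And>s. s \<in> {- 1..0} \<Longrightarrow> s \<noteq> 0 \<Longrightarrow> dist s 0 < e \<Longrightarrow> \<gamma> s \<in> fst ?c"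
    by (auto simp: eventually_at)
  define h where "h = min 1 (min d e / 2)"
  have h: "h > 0" "h \<le> 1" "h < d" "h < e" using d e by (auto simp: h_def min_def)
  have "f (- h) < 0" using d(2)[of h] h f0 by simp
  moreover have "\<gamma> (- h) \<in> fst ?c" using e(2)[of "- h"] h by simp
  ultimately show False using chart_in_half_space[OF chart_at_in] by (force simp: f_def)
qed

lemma in_D: "x \<in> \<Lambda> \<Longrightarrow> (t, x) \<in> D"
  by (simp add: interior_flow_domain_def in_flow_domain not_boundary flow_in)

lemma D_flow_domain: "(t, x) \<in> D \<Longrightarrow> (t, x) \<in> flow_domain A X"
  by (simp add: interior_flow_domain_def)

text \<open>Invariance of domain makes being an interior point independent of the chart.\<close>

lemma chart_interior:
  assumes x: "x \<notin> mboundary A" and c: "c \<in> A" "x \<in> fst c"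
  shows "snd c x \<in> interior (chart_image c)"
proof -
  let ?p = "chart_at A x"
  define W where "W = snd ?p ` (fst ?p \<inter> fst c)"
  have "openin (top_of_set (fst ?p)) (fst ?p \<inter> fst c)"
    using chart_open[OF c(1)] by (simp add: openin_open_Int)
  then have "openin (top_of_set (chart_image ?p)) W"
    unfolding W_def using homeomorphism_imp_open_map[OF chart_homeo[OF chart_at_in]] by blast
  then have "openin (top_of_set half_space) W"
    using chart_image_openin[OF chart_at_in] openin_trans by blast
  then obtain V where V: "open V" "W = half_space \<inter> V" by (auto simp: openin_open)
  \<comment> \<open>Removing the bounding hyperplane makes the neighbourhood open in the whole
    space, as invariance of domain requires; \<open>snd ?p x\<close> survives because
    \<open>x\<close> is not a boundary point.\<close>
  define U where "U = V \<inter> {y. 0 < y \<bullet> inward_normal}"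
  have UW: "U \<subseteq> W" using V by (auto simp: U_def half_space_def)
  have Wp: "W \<subseteq> chart_image ?p" by (auto simp: W_def chart_image_def)
  have inv_W: "chart_inv ?p y \<in> fst ?p \<inter> fst c" if "y \<in> W" for y
    using that by (auto simp: W_def chart_inv_chart)
  let ?T = "\<lambda>y. snd c (chart_inv ?p y)"
  have "open (?T ` U)"
  proof (rule invariance_of_domain)
    show "open U" unfolding U_def by (intro open_Int V open_Collect_less continuous_intros)
    show "continuous_on U ?T"
      by (rule continuous_on_compose2[OF chart_cont[OF c(1)] continuous_on_subset[OF chart_inv_cont[OF chart_at_in]]])
         (use UW Wp inv_W in blast)+
    show "inj_on ?T U"
    proof (rule inj_onI)
      fix y z assume y: "y \<in> U" and z: "z \<in> U" and eq: "?T y = ?T z"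
      have "chart_inv ?p y = chart_inv ?p z"
        using eq inv_W UW y z chart_inv_chart[OF c(1)] by (metis IntD2 subsetD)
      then show "y = z" using y z UW Wp chart_chart_inv[OF chart_at_in] by (metis subsetD)
    qed
  qed
  moreover have "?T ` U \<subseteq> chart_image c" using UW inv_W by (auto simp: chart_image_def)
  moreover have "snd c x \<in> ?T ` U"
  proof (rule image_eqI)
    show "snd c x = ?T (snd ?p x)" by (simp add: chart_inv_chart)
    have "snd ?p x \<in> W" using c by (auto simp: W_def)
    moreover have "0 < snd ?p x \<bullet> inward_normal"
      using x chart_in_half_space[OF chart_at_in in_chart_at, of x] by (auto simp: mboundary_def less_le)
    ultimately show "snd ?p x \<in> U" using V by (auto simp: U_def)
  qed
  ultimately show ?thesis by (meson interiorI)
qed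

lemma chart_inv_tendsto:
  assumes "x \<notin> mboundary A" "c \<in> A" "x \<in> fst c"
  shows "(chart_inv c \<longlongrightarrow> x) (nhds (snd c x))"
proof -
  have "isCont (chart_inv c) (snd c x)"
    using chart_interior[OF assms] continuous_on_interior[OF chart_inv_cont[OF assms(2)]] by blast
  then show ?thesis using chart_inv_chart[OF assms(2,3)] by (metis continuous_at tendsto_nhds_iff)
qed

lemma chart_tendsto:
  assumes "(xx \<longlongrightarrow> x) F" "c \<in> A" "x \<in> fst c"
  shows "((\<lambda>i. snd c (xx i)) \<longlongrightarrow> snd c x) F"
  by (rule isCont_tendsto_compose[OF _ assms(1)])
     (use assms chart_cont[of c] chart_open[of c] in \<open>simp add: continuous_on_eq_continuous_at\<close>)

lemma eventually_in_chart:
  assumes "(xx \<longlongrightarrow> x) F" "c \<in> A" "x \<in> fst c"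
  shows "\<forall>\<^sub>F i in F. xx i \<in> fst c"
  using topological_tendstoD[OF assms(1) chart_open[OF assms(2)] assms(3)] .

lemma open_D: "open D"
  using flow by (simp add: flow_of_def)

lemma flow_tendsto:
  assumes "(tt \<longlongrightarrow> t) F" "(xx \<longlongrightarrow> x) F" "(t, x) \<in> D"
  shows "((\<lambda>i. \<phi> (tt i) (xx i)) \<longlongrightarrow> \<phi> t x) F"
proof -
  have "isCont (\<lambda>(t, x). \<phi> t x) (t, x)"
    using flow assms(3) open_D by (simp add: flow_of_def continuous_on_eq_continuous_at)
  from isCont_tendsto_compose[OF this tendsto_Pair[OF assms(1,2)]] show ?thesis by simp
qed

section \<open>The flow and its derivative in a pair of charts\<close>

definition local_domain :: "('m, 'e) chart \<Rightarrow> ('m, 'e) chart \<Rightarrow> (real \<times> 'e) set" where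
  "local_domain c d = {(t, y). y \<in> chart_image c \<and> (t, chart_inv c y) \<in> D \<and> \<phi> t (chart_inv c y) \<in> fst d}"

definition local_flow :: "('m, 'e) chart \<Rightarrow> ('m, 'e) chart \<Rightarrow> real \<Rightarrow> 'e \<Rightarrow> 'e" where
  "local_flow c d t y = snd d (\<phi> t (chart_inv c y))"

text \<open>One object covers the derivative of the flow and, at time 0, the change of coordinates
  from \<open>c\<close> to \<open>d\<close>, so that both obey the same chain rule and the same
  continuity statement.\<close>

definition Dflow :: "('m, 'e) chart \<Rightarrow> ('m, 'e) chart \<Rightarrow> real \<Rightarrow> 'm \<Rightarrow> 'e \<Rightarrow> 'e" where
  "Dflow c d t x = frechet_derivative (local_flow c d t) (at (snd c x))"

text \<open>The conditions defining the local domain are open near an interior point, because the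
  flow is continuous on the open set \<open>D\<close>. Derivatives within the local domain thereby
  become full derivatives.\<close>

lemma local_domain_nhds:
  assumes tx: "(t, x) \<in> D" and c: "c \<in> A" "x \<in> fst c" and d: "d \<in> A" "\<phi> t x \<in> fst d"
  shows "(t, snd c x) \<in> interior (local_domain c d)"
proof -
  have xb: "x \<notin> mboundary A" using tx by (simp add: interior_flow_domain_def)
  define W where "W = D \<inter> (\<lambda>(t, x). \<phi> t x) -` fst d"
  have W: "open W" unfolding W_def
    by (rule continuous_open_preimage[OF _ open_D chart_open[OF d(1)]])
       (use flow in \<open>simp add: flow_of_def\<close>)
  define V where "V = (UNIV \<times> interior (chart_image c)) \<inter> (\<lambda>(t, y). (t, chart_inv c y)) -` W"
  have "continuous_on (UNIV \<times> interior (chart_image c)) (\<lambda>z. chart_inv c (snd z))"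
    by (rule continuous_on_compose2[OF chart_inv_cont[OF c(1)]])
       (use interior_subset in \<open>auto intro!: continuous_intros\<close>)
  then have "open V" unfolding V_def
    by (intro continuous_open_preimage[OF _ _ W])
       (auto simp: case_prod_beta intro!: continuous_intros open_Times)
  moreover have "V \<subseteq> local_domain c d"
    using interior_subset by (auto simp: V_def W_def local_domain_def)
  moreover have "(t, snd c x) \<in> V"
    using chart_interior[OF xb c] tx d c by (auto simp: V_def W_def chart_inv_chart)
  ultimately show ?thesis by (meson interiorI)
qed

definition is_local_derivative where
  "is_local_derivative c d f' \<longleftrightarrow> (\<forall>z\<in>local_domain c d.
      ((\<lambda>(t, y). local_flow c d t y) has_derivative f' z) (at z within local_domain c d)) \<and>
    (\<forall>v. continuous_on (local_domain c d) (\<lambda>z. f' z v))"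

lemma local_flow_C1:
  assumes "c \<in> A" "d \<in> A"
  shows "\<exists>f'. is_local_derivative c d f'"
proof -
  have "Ck_on (Suc 0) (\<lambda>(t, y). local_flow c d t y) (local_domain c d)"
    using flow assms by (simp add: flow_of_def local_flow_def[abs_def] local_domain_def)
  then show ?thesis by (simp add: Ck_on.simps is_local_derivative_def)
qed

text \<open>Restricting the joint derivative in time and space to the directions
  \<open>(0, u)\<close> gives the derivative in space, which is how \<open>Dflow\<close> inherits
  the joint regularity of the flow.\<close>

lemma Dflow_eq:
  assumes "(t, x) \<in> D" "c \<in> A" "x \<in> fst c" "d \<in> A" "\<phi> t x \<in> fst d"
    and f': "((\<lambda>(t, y). local_flow c d t y) has_derivative f') (at (t, snd c x) within local_domain c d)"
  shows "(local_flow c d t has_derivative Dflow c d t x) (at (snd c x))"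
    and "Dflow c d t x u = f' (0, u)"
proof -
  have 1: "((\<lambda>(t, y). local_flow c d t y) has_derivative f') (at (t, snd c x))"
    using f' at_within_interior[OF local_domain_nhds[OF assms(1-5)]] by simp
  have "((\<lambda>y. (t, y)) has_derivative (\<lambda>u. (0, u))) (at (snd c x))"
    by (auto intro!: derivative_eq_intros)
  from diff_chain_at[OF this 1]
  have 2: "(local_flow c d t has_derivative (\<lambda>u. f' (0, u))) (at (snd c x))" by (simp add: o_def)
  have 3: "Dflow c d t x = (\<lambda>u. f' (0, u))"
    unfolding Dflow_def using frechet_derivative_at[OF 2] by simp
  show "(local_flow c d t has_derivative Dflow c d t x) (at (snd c x))" using 2 3 by simp
  show "Dflow c d t x u = f' (0, u)" using 3 by simp
qed

lemma Dflow_has_derivative: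
  assumes "(t, x) \<in> D" "c \<in> A" "x \<in> fst c" "d \<in> A" "\<phi> t x \<in> fst d"
  shows "(local_flow c d t has_derivative Dflow c d t x) (at (snd c x))"
proof -
  obtain f' where f': "is_local_derivative c d f'"
    using local_flow_C1[OF assms(2,4)] ..
  note f' = f'[unfolded is_local_derivative_def]
  have "(t, snd c x) \<in> local_domain c d" using local_domain_nhds[OF assms] interior_subset by blast
  from Dflow_eq(1)[OF assms bspec[OF conjunct1[OF f'] this]] show ?thesis .
qed

lemma Dflow_linear:
  assumes "(t, x) \<in> D" "c \<in> A" "x \<in> fst c" "d \<in> A" "\<phi> t x \<in> fst d"
  shows "linear (Dflow c d t x)"
  using Dflow_has_derivative[OF assms] has_derivative_bounded_linear bounded_linear.linear by blast

lemma linear_tendsto_componentwise: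
  fixes L :: "'i \<Rightarrow> 'e \<Rightarrow> 'e"
  assumes "\<And>b. ((\<lambda>i. L i b) \<longlongrightarrow> L0 b) F" "\<forall>\<^sub>F i in F. linear (L i)" "linear L0" "(u \<longlongrightarrow> u0) F"
  shows "((\<lambda>i. L i (u i)) \<longlongrightarrow> L0 u0) F"
proof -
  have exp: "L (\<Sum>b\<in>Basis. (w \<bullet> b) *\<^sub>R b) = (\<Sum>b\<in>Basis. (w \<bullet> b) *\<^sub>R L b)" if "linear L"
    for L :: "'e \<Rightarrow> 'e" and w
    using that by (simp add: linear_sum linear_scale)
  have "((\<lambda>i. \<Sum>b\<in>Basis. (u i \<bullet> b) *\<^sub>R L i b) \<longlongrightarrow> (\<Sum>b\<in>Basis. (u0 \<bullet> b) *\<^sub>R L0 b)) F"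
    by (intro tendsto_intros assms)
  moreover have "\<forall>\<^sub>F i in F. (\<Sum>b\<in>Basis. (u i \<bullet> b) *\<^sub>R L i b) = L i (u i)"
    using assms(2) by eventually_elim (use exp in \<open>simp add: euclidean_representation\<close>)
  moreover have "(\<Sum>b\<in>Basis. (u0 \<bullet> b) *\<^sub>R L0 b) = L0 u0"
    using exp[OF assms(3), of u0] by (simp add: euclidean_representation)
  ultimately show ?thesis by (simp add: tendsto_cong)
qed

text \<open>\<open>Ck_on\<close> gives continuity of the derivative for each fixed direction only;
  linearity and finite dimension upgrade it to joint continuity in time, point and vector.\<close>

lemma Dflow_tendsto:
  assumes tx: "(t, x) \<in> D" "c \<in> A" "x \<in> fst c" "d \<in> A" "\<phi> t x \<in> fst d"
    and tt: "(tt \<longlongrightarrow> t) F" and xx: "(xx \<longlongrightarrow> x) F" and u: "(u \<longlongrightarrow> u0) F"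
  shows "((\<lambda>i. Dflow c d (tt i) (xx i) (u i)) \<longlongrightarrow> Dflow c d t x u0) F"
proof -
  obtain f' where f'': "is_local_derivative c d f'"
    using local_flow_C1[OF tx(2,4)] ..
  note f'' = f''[unfolded is_local_derivative_def]
  note f' = bspec[OF conjunct1[OF f'']] spec[OF conjunct2[OF f'']]
  have ev: "\<forall>\<^sub>F i in F. (tt i, xx i) \<in> D \<and> xx i \<in> fst c \<and> \<phi> (tt i) (xx i) \<in> fst d"
    by (intro eventually_conj topological_tendstoD[OF tendsto_Pair[OF tt xx] open_D tx(1)]
        eventually_in_chart[OF xx tx(2,3)] eventually_in_chart[OF flow_tendsto[OF tt xx tx(1)] tx(4,5)])
  have Df: "Dflow c d t x v = f' (t, snd c x) (0, v)"
    if "(t, x) \<in> D" "x \<in> fst c" "\<phi> t x \<in> fst d" for t x v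
  proof -
    have "(t, snd c x) \<in> local_domain c d"
      using local_domain_nhds[OF that(1) tx(2) that(2) tx(4) that(3)] interior_subset by blast
    from Dflow_eq(2)[OF that(1) tx(2) that(2) tx(4) that(3) f'(1)[OF this]] show ?thesis .
  qed
  show ?thesis
  proof (rule linear_tendsto_componentwise[OF _ _ _ u])
    fix b
    have "isCont (\<lambda>z. f' z (0, b)) (t, snd c x)"
      using continuous_on_interior[OF f'(2) local_domain_nhds[OF tx]] .
    from isCont_tendsto_compose[OF this tendsto_Pair[OF tt chart_tendsto[OF xx tx(2,3)]]]
    have "((\<lambda>i. f' (tt i, snd c (xx i)) (0, b)) \<longlongrightarrow> Dflow c d t x b) F" using Df tx by simp
    moreover have "\<forall>\<^sub>F i in F. f' (tt i, snd c (xx i)) (0, b) = Dflow c d (tt i) (xx i) b"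
      using ev by eventually_elim (simp add: Df)
    ultimately show "((\<lambda>i. Dflow c d (tt i) (xx i) b) \<longlongrightarrow> Dflow c d t x b) F" by (simp add: tendsto_cong)
  next
    show "\<forall>\<^sub>F i in F. linear (Dflow c d (tt i) (xx i))"
      using ev by eventually_elim (use Dflow_linear tx in blast)
  qed (rule Dflow_linear[OF tx])
qed

text \<open>The chain rule requires the composition law on a full neighbourhood of \<open>x\<close>
  in the manifold and not just on \<Lambda>; openness of \<open>D\<close> places the three relevant
  pairs in the flow domain there.\<close>

lemma Dflow_comp:
  assumes x: "x \<in> \<Lambda>" and c: "c \<in> A" "x \<in> fst c" and d: "d \<in> A" "\<phi> t x \<in> fst d"
    and e: "e \<in> A" "\<phi> (s + t) x \<in> fst e"
  shows "Dflow c e (s + t) x u = Dflow d e s (\<phi> t x) (Dflow c d t x u)"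
proof -
  let ?y0 = "snd c x"
  have e': "\<phi> s (\<phi> t x) \<in> fst e" using e flow_add[OF x] by simp
  have fx: "\<phi> t x \<in> \<Lambda>" by (rule flow_in[OF x])
  have 1: "(local_flow c d t has_derivative Dflow c d t x) (at ?y0)"
    by (rule Dflow_has_derivative[OF in_D[OF x] c d])
  have y1: "local_flow c d t ?y0 = snd d (\<phi> t x)" using c by (simp add: local_flow_def chart_inv_chart)
  have "(local_flow d e s has_derivative Dflow d e s (\<phi> t x)) (at (local_flow c d t ?y0))"
    unfolding y1 by (rule Dflow_has_derivative[OF in_D[OF fx] d e(1) e'])
  from diff_chain_at[OF 1 this]
  have 2: "((\<lambda>y. local_flow d e s (local_flow c d t y)) has_derivative
      (\<lambda>u. Dflow d e s (\<phi> t x) (Dflow c d t x u))) (at ?y0)" by (simp add: o_def)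
  have ci: "(chart_inv c \<longlongrightarrow> x) (nhds ?y0)" by (rule chart_inv_tendsto[OF not_boundary[OF x] c])
  have ft: "((\<lambda>y. \<phi> t (chart_inv c y)) \<longlongrightarrow> \<phi> t x) (nhds ?y0)"
    by (rule flow_tendsto[OF tendsto_const ci in_D[OF x]])
  have "\<forall>\<^sub>F y in nhds ?y0. (t, chart_inv c y) \<in> D \<and> (s + t, chart_inv c y) \<in> D \<and>
      (s, \<phi> t (chart_inv c y)) \<in> D \<and> \<phi> t (chart_inv c y) \<in> fst d"
    by (intro eventually_conj topological_tendstoD[OF tendsto_Pair[OF tendsto_const ci] open_D]
        topological_tendstoD[OF tendsto_Pair[OF tendsto_const ft] open_D] eventually_in_chart[OF ft d]
        in_D x fx)
  then have ev: "\<forall>\<^sub>F y in nhds ?y0. local_flow d e s (local_flow c d t y) = local_flow c e (s + t) y"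
  proof eventually_elim
    fix y assume "(t, chart_inv c y) \<in> D \<and> (s + t, chart_inv c y) \<in> D \<and>
      (s, \<phi> t (chart_inv c y)) \<in> D \<and> \<phi> t (chart_inv c y) \<in> fst d"
    then show "local_flow d e s (local_flow c d t y) = local_flow c e (s + t) y"
      using flow_comp[of t "chart_inv c y" s] D_flow_domain d by (simp add: local_flow_def chart_inv_chart)
  qed
  have "(local_flow c e (s + t) has_derivative (\<lambda>u. Dflow d e s (\<phi> t x) (Dflow c d t x u))) (at ?y0)"
  proof (rule has_derivative_transform_eventually[OF 2])
    show "\<forall>\<^sub>F y in at ?y0. local_flow d e s (local_flow c d t y) = local_flow c e (s + t) y"
      using ev by (simp add: eventually_at_filter eventually_mono)
    show "local_flow d e s (local_flow c d t ?y0) = local_flow c e (s + t) ?y0"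
      by (rule eventually_nhds_x_imp_x[OF ev])
  qed simp
  from fun_cong[OF has_derivative_unique[OF this Dflow_has_derivative[OF in_D[OF x] c e]], of u]
  show ?thesis by simp
qed

lemma Dflow_id:
  assumes x: "x \<in> \<Lambda>" and c: "c \<in> A" "x \<in> fst c"
  shows "Dflow c c 0 x u = u"
proof -
  have "snd c x \<in> interior (chart_image c)" by (rule chart_interior[OF not_boundary[OF x] c])
  moreover have "local_flow c c 0 y = y" if "y \<in> interior (chart_image c)" for y
    using that interior_subset[of "chart_image c"] chart_chart_inv[OF c(1)] by (auto simp: local_flow_def)
  ultimately have "(local_flow c c 0 has_derivative (\<lambda>u. u)) (at (snd c x))"
    by (intro has_derivative_transform_within_open[OF has_derivative_ident open_interior]) auto
  from fun_cong[OF has_derivative_unique[OF this Dflow_has_derivative[OF in_D[OF x] c c(1)]], of u] c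
  show ?thesis by simp
qed

text \<open>At an interior point the derivative within the overlap is a full derivative; the slice
  of the local domain at time 0 provides the neighbourhood inside the overlap.\<close>

lemma coord_change_eq:
  assumes x: "x \<in> \<Lambda>" and c: "c \<in> A" "x \<in> fst c" and d: "d \<in> A" "x \<in> fst d"
  shows "coord_change c d x = Dflow c d 0 x"
proof -
  have "(0, snd c x) \<in> interior (local_domain c d)"
    using local_domain_nhds[OF in_D[OF x] c d(1), of 0] d(2) by simp
  then have 1: "snd c x \<in> (\<lambda>y. (0::real, y)) -` interior (local_domain c d)" by simp
  have 2: "open ((\<lambda>y. (0::real, y)) -` interior (local_domain c d))"
    by (intro open_vimage open_interior continuous_intros)
  have 3: "(\<lambda>y. (0::real, y)) -` interior (local_domain c d) \<subseteq> snd c ` (fst c \<inter> fst d)"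
  proof
    fix y assume "y \<in> (\<lambda>y. (0::real, y)) -` interior (local_domain c d)"
    then have "(0, y) \<in> local_domain c d" using subsetD[OF interior_subset] by simp
    then have "y \<in> chart_image c" "chart_inv c y \<in> fst d" by (simp_all add: local_domain_def)
    then show "y \<in> snd c ` (fst c \<inter> fst d)"
      using chart_chart_inv[OF c(1), of y] chart_inv_in[OF c(1), of y]
      by (intro image_eqI[of _ _ "chart_inv c y"]) simp_all
  qed
  from subsetD[OF interior_maximal[OF 3 2] 1] have "snd c x \<in> interior (snd c ` (fst c \<inter> fst d))" .
  moreover have "local_flow c d 0 = (\<lambda>y. snd d (chart_inv c y))" by (simp add: local_flow_def fun_eq_iff)
  ultimately show ?thesis by (simp only: coord_change_def Dflow_def at_within_interior)
qed

lemma mderiv_eq: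
  assumes x: "x \<in> \<Lambda>"
  shows "mderiv A (\<phi> t) x = Dflow (chart_at A x) (chart_at A (\<phi> t x)) t x"
proof -
  have "local_flow (chart_at A x) (chart_at A (\<phi> t x)) t
      = (\<lambda>y. snd (chart_at A (\<phi> t x)) (\<phi> t (chart_inv (chart_at A x) y)))"
    by (simp add: local_flow_def fun_eq_iff)
  then show ?thesis
    by (simp only: mderiv_def Dflow_def
        at_within_interior[OF chart_interior[OF not_boundary[OF x] chart_at_in in_chart_at]])
qed

end

section \<open>Convergence in the tangent bundle\<close>

lemma tendsto_fun_iff:
  fixes f :: "'i \<Rightarrow> 'a \<Rightarrow> 'b::topological_space"
  shows "(f \<longlongrightarrow> l) F \<longleftrightarrow> (\<forall>k. ((\<lambda>i. f i k) \<longlongrightarrow> l k) F)"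
proof -
  have "(f \<longlongrightarrow> l) F \<longleftrightarrow> limitin (product_topology (\<lambda>_. euclidean) UNIV) f l F"
    by (simp add: euclidean_product_topology limitin_canonical_iff)
  also have "\<dots> \<longleftrightarrow> (\<forall>k. ((\<lambda>i. f i k) \<longlongrightarrow> l k) F)"
    by (simp add: limitin_componentwise limitin_canonical_iff)
  finally show ?thesis .
qed

lemma compact_subseq:
  fixes f :: "nat \<Rightarrow> 'a::first_countable_topology"
  assumes "compact K" "\<And>n. f n \<in> K"
  shows "\<exists>l. l \<in> K \<and> (\<exists>r. strict_mono r \<and> (f \<circ> r) \<longlonglongrightarrow> l)"
  using compact_imp_seq_compact[OF assms(1)] assms(2) unfolding seq_compact_def by blast

text \<open>The coefficient vectors are rescaled to a compact set; linear independence of the limit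
  frame excludes blow-up.\<close>

lemma limit_in_span:
  fixes s :: "nat \<Rightarrow> nat \<Rightarrow> 'a::real_normed_vector" and a :: "nat \<Rightarrow> nat \<Rightarrow> real"
  assumes s: "\<And>i. i < k \<Longrightarrow> (\<lambda>n. s n i) \<longlonglongrightarrow> \<sigma> i"
    and w: "(\<lambda>n. \<Sum>i<k. a n i *\<^sub>R s n i) \<longlonglongrightarrow> w"
    and indep: "\<And>(b :: nat \<Rightarrow> real) j. (\<Sum>i<k. b i *\<^sub>R \<sigma> i) = 0 \<Longrightarrow> j < k \<Longrightarrow> b j = 0"
  shows "\<exists>b :: nat \<Rightarrow> real. w = (\<Sum>i<k. b i *\<^sub>R \<sigma> i)"
proof -
  define R where "R n = 1 + (\<Sum>i<k. \<bar>a n i\<bar>)" for n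
  have R: "R n \<ge> 1" for n by (simp add: R_def sum_nonneg)
  define \<alpha> where "\<alpha> n i = (if i < k then a n i / R n else 0)" for n i
  have sum\<alpha>: "(\<Sum>i<k. \<bar>\<alpha> n i\<bar>) = 1 - 1 / R n" for n
  proof -
    have "\<bar>\<alpha> n i\<bar> = \<bar>a n i\<bar> / R n" if "i < k" for i using R[of n] that by (simp add: \<alpha>_def abs_divide)
    then have "(\<Sum>i<k. \<bar>\<alpha> n i\<bar>) = (R n - 1) / R n" by (simp add: sum_divide_distrib[symmetric] R_def)
    then show ?thesis using R[of n] by (simp add: diff_divide_distrib)
  qed
  have \<alpha>le: "\<bar>\<alpha> n i\<bar> \<le> 1" for n i
  proof (cases "i < k")
    case True
    then have "\<bar>\<alpha> n i\<bar> \<le> 1 - 1 / R n"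
      unfolding sum\<alpha>[symmetric] using member_le_sum[of i "{..<k}" "\<lambda>i. \<bar>\<alpha> n i\<bar>"] by simp
    moreover have "0 \<le> 1 / R n" using R[of n] by simp
    ultimately show ?thesis by linarith
  qed (simp add: \<alpha>_def)
  have mem: "(\<alpha> n, 1 / R n) \<in> {b. \<forall>i. b i \<in> {-1..1}} \<times> {0..1}" for n
  proof -
    have "- 1 \<le> \<alpha> n i \<and> \<alpha> n i \<le> 1" for i using \<alpha>le[of n i] by linarith
    then show ?thesis using R[of n] by simp
  qed
  have "compact ({b::nat \<Rightarrow> real. \<forall>i. b i \<in> {-1..1}} \<times> {0..1::real})"
    by (intro compact_Times compact_sequences compact_Icc)
  from compact_subseq[of _ "\<lambda>n. (\<alpha> n, 1 / R n)", OF this mem]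
  obtain l r where r: "strict_mono (r::nat \<Rightarrow> nat)" "((\<lambda>n. (\<alpha> n, 1 / R n)) \<circ> r) \<longlonglongrightarrow> l"
    by blast
  define \<beta> \<rho> where "\<beta> = fst l" and "\<rho> = snd l"
  have "(\<lambda>n. \<alpha> (r n)) \<longlonglongrightarrow> \<beta>" and lim\<rho>: "(\<lambda>n. 1 / R (r n)) \<longlonglongrightarrow> \<rho>"
    using tendsto_fst[OF r(2)] tendsto_snd[OF r(2)] by (simp_all add: \<beta>_def \<rho>_def o_def)
  then have lim\<beta>: "(\<lambda>n. \<alpha> (r n) i) \<longlonglongrightarrow> \<beta> i" for i by (simp add: tendsto_fun_iff)
  have "(\<lambda>n. (1 / R (r n)) *\<^sub>R (\<Sum>i<k. a (r n) i *\<^sub>R s (r n) i)) \<longlonglongrightarrow> \<rho> *\<^sub>R w"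
    using LIMSEQ_subseq_LIMSEQ[OF w r(1)] by (intro tendsto_scaleR lim\<rho>) (simp add: o_def)
  moreover have "(1 / R (r n)) *\<^sub>R (\<Sum>i<k. a (r n) i *\<^sub>R s (r n) i) = (\<Sum>i<k. \<alpha> (r n) i *\<^sub>R s (r n) i)" for n
    unfolding scaleR_sum_right by (intro sum.cong) (simp_all add: \<alpha>_def)
  ultimately have "(\<lambda>n. \<Sum>i<k. \<alpha> (r n) i *\<^sub>R s (r n) i) \<longlonglongrightarrow> \<rho> *\<^sub>R w" by simp
  moreover have "(\<lambda>n. \<Sum>i<k. \<alpha> (r n) i *\<^sub>R s (r n) i) \<longlonglongrightarrow> (\<Sum>i<k. \<beta> i *\<^sub>R \<sigma> i)"
    using LIMSEQ_subseq_LIMSEQ[OF s r(1)] by (intro tendsto_sum tendsto_scaleR lim\<beta>) (simp add: o_def)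
  ultimately have key: "\<rho> *\<^sub>R w = (\<Sum>i<k. \<beta> i *\<^sub>R \<sigma> i)" by (rule LIMSEQ_unique)
  have "(\<lambda>n. \<Sum>i<k. \<bar>\<alpha> (r n) i\<bar>) \<longlonglongrightarrow> (\<Sum>i<k. \<bar>\<beta> i\<bar>)" by (intro tendsto_intros lim\<beta>)
  moreover have "(\<lambda>n. \<Sum>i<k. \<bar>\<alpha> (r n) i\<bar>) \<longlonglongrightarrow> 1 - \<rho>" unfolding sum\<alpha> by (intro tendsto_intros lim\<rho>)
  ultimately have sum\<beta>: "(\<Sum>i<k. \<bar>\<beta> i\<bar>) = 1 - \<rho>" by (rule LIMSEQ_unique)
  \<comment> \<open>If \<open>\<rho>\<close> were 0, the coefficients \<open>\<beta>\<close> would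
    have absolute sum 1 and yet combine the limit frame to 0.\<close>
  have "\<rho> \<noteq> 0" using indep[of \<beta>] key sum\<beta> by auto
  then have "w = (\<Sum>i<k. (\<beta> i / \<rho>) *\<^sub>R \<sigma> i)"
    using arg_cong[OF key, of "\<lambda>v. (1 / \<rho>) *\<^sub>R v"] by (simp add: scaleR_sum_right)
  then show ?thesis by (rule exI[of _ "\<lambda>i. \<beta> i / \<rho>"])
qed

section \<open>The tangent bundle over the invariant set\<close>

context manifold_flow
begin

abbreviation D\<phi> where "D\<phi> t \<equiv> mderiv A (\<phi> t)"

text \<open>The coordinates in \<open>c\<close> of a vector stored in the preferred chart. Writing
  the coordinate change as \<open>Dflow\<close> at time 0 makes its chain rule and continuity
  available.\<close>

definition tcoord :: "('m, 'e) chart \<Rightarrow> 'm \<Rightarrow> 'e \<Rightarrow> 'e" where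
  "tcoord c x = Dflow (chart_at A x) c 0 x"

lemma coord_change_tcoord: "x \<in> \<Lambda> \<Longrightarrow> c \<in> A \<Longrightarrow> x \<in> fst c \<Longrightarrow> coord_change (chart_at A x) c x = tcoord c x"
  by (simp add: coord_change_eq tcoord_def)

lemma Dflow_zero_linear:
  assumes "x \<in> \<Lambda>" "c \<in> A" "x \<in> fst c" "d \<in> A" "x \<in> fst d"
  shows "linear (Dflow c d 0 x)"
  using Dflow_linear[OF in_D[OF assms(1)], of c d 0] assms by simp

lemma tcoord_linear: "x \<in> \<Lambda> \<Longrightarrow> c \<in> A \<Longrightarrow> x \<in> fst c \<Longrightarrow> linear (tcoord c x)"
  unfolding tcoord_def by (rule Dflow_zero_linear) auto

lemma Dflow_tcoord:
  assumes "x \<in> \<Lambda>" "c \<in> A" "x \<in> fst c" "d \<in> A" "\<phi> t x \<in> fst d"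
  shows "Dflow c d t x (tcoord c x u) = Dflow (chart_at A x) d t x u"
  using Dflow_comp[OF assms(1) chart_at_in in_chart_at assms(2), of 0 d t u] assms
  by (simp add: tcoord_def)

lemma Dflow_zero_tcoord:
  assumes "x \<in> \<Lambda>" "c \<in> A" "x \<in> fst c" "d \<in> A" "x \<in> fst d"
  shows "Dflow c d 0 x (tcoord c x u) = tcoord d x u"
  using Dflow_tcoord[of x c d 0 u] assms by (simp add: tcoord_def)

lemma tcoord_inverse:
  assumes "x \<in> \<Lambda>" "c \<in> A" "x \<in> fst c"
  shows "Dflow c (chart_at A x) 0 x (tcoord c x u) = u"
    and "tcoord c x (Dflow c (chart_at A x) 0 x w) = w"
proof -
  show "Dflow c (chart_at A x) 0 x (tcoord c x u) = u"
    using Dflow_zero_tcoord[OF assms chart_at_in in_chart_at] Dflow_id[OF assms(1) chart_at_in in_chart_at]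
    by (simp add: tcoord_def)
  show "tcoord c x (Dflow c (chart_at A x) 0 x w) = w"
    using Dflow_comp[OF assms, of "chart_at A x" 0 c 0 w] Dflow_id[OF assms] assms
    by (simp add: tcoord_def)
qed

lemma mderiv_linear: "x \<in> \<Lambda> \<Longrightarrow> linear (D\<phi> t x)"
  unfolding mderiv_eq by (rule Dflow_linear[OF in_D]) auto

lemma mderiv_add:
  "x \<in> \<Lambda> \<Longrightarrow> D\<phi> (s + t) x u = D\<phi> s (\<phi> t x) (D\<phi> t x u)"
  by (simp add: mderiv_eq flow_in flow_add[symmetric] Dflow_comp)

lemma mderiv_zero [simp]: "x \<in> \<Lambda> \<Longrightarrow> D\<phi> 0 x u = u"
  by (simp add: mderiv_eq Dflow_id)

lemma mderiv_uminus:
  "x \<in> \<Lambda> \<Longrightarrow> D\<phi> (- t) (\<phi> t x) (D\<phi> t x u) = u"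
  using mderiv_add[of x "- t" t u] by simp

text \<open>The chain rule absorbs the preferred charts at both ends, so the derivative of the flow
  can be computed in any pair of charts around \<open>x\<close> and
  \<open>\<phi> t x\<close>.\<close>

lemma tcoord_mderiv:
  assumes x: "x \<in> \<Lambda>" "c \<in> A" "x \<in> fst c" and d: "d \<in> A" "\<phi> t x \<in> fst d"
  shows "tcoord d (\<phi> t x) (D\<phi> t x u) = Dflow c d t x (tcoord c x u)"
proof -
  have "Dflow (chart_at A x) d (0 + t) x u
      = Dflow (chart_at A (\<phi> t x)) d 0 (\<phi> t x) (Dflow (chart_at A x) (chart_at A (\<phi> t x)) t x u)"
    by (rule Dflow_comp) (use x d in auto)
  then show ?thesis using Dflow_tcoord[OF x d] by (simp add: tcoord_def mderiv_eq[OF x(1)])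
qed

lemma g_bilinear: "bilinear (g x)" and g_pos: "v \<noteq> 0 \<Longrightarrow> 0 < g x v v"
  using metric by (auto simp: riemannian_metric_def)

lemma tnorm_scale: "tnorm g x (r *\<^sub>R v) = \<bar>r\<bar> * tnorm g x v"
  by (simp add: tnorm_def bilinear_lmul[OF g_bilinear] bilinear_rmul[OF g_bilinear]
      real_sqrt_mult mult.assoc[symmetric])

lemma tnorm_pos: "v \<noteq> 0 \<Longrightarrow> 0 < tnorm g x v"
  by (simp add: tnorm_def g_pos)

text \<open>The entries of the metric in the chart \<open>c\<close> are continuous, and the squared
  norm is a finite sum of them weighted by products of coordinates.
  \<open>Dflow c (chart_at A x) 0 x\<close> returns a coordinate vector to the preferred chart,
  where \<open>g\<close> is evaluated.\<close>

lemma metric_tendsto: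
  assumes x: "x \<in> \<Lambda>" "c \<in> A" "x \<in> fst c" and xx: "(xx \<longlongrightarrow> x) F" "\<forall>\<^sub>F i in F. xx i \<in> \<Lambda>"
    and ww: "(ww \<longlongrightarrow> w) F"
  shows "((\<lambda>i. tnorm g (xx i) (Dflow c (chart_at A (xx i)) 0 (xx i) (ww i))) \<longlongrightarrow>
    tnorm g x (Dflow c (chart_at A x) 0 x w)) F"
proof -
  let ?T = "\<lambda>x. Dflow c (chart_at A x) 0 x"
  have ev: "\<forall>\<^sub>F i in F. xx i \<in> \<Lambda> \<and> xx i \<in> fst c"
    by (intro eventually_conj xx eventually_in_chart[OF xx(1) x(2,3)])
  have Tlin: "linear (?T x)" if "x \<in> \<Lambda>" "x \<in> fst c" for x
    by (rule Dflow_zero_linear) (use that x in auto)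
  have expand: "g x (?T x w) (?T x w) = (\<Sum>a\<in>Basis. \<Sum>b\<in>Basis. (w \<bullet> a) * (w \<bullet> b) * g x (?T x a) (?T x b))"
    if "x \<in> \<Lambda>" "x \<in> fst c" for x w
  proof -
    have "?T x w = (\<Sum>a\<in>Basis. (w \<bullet> a) *\<^sub>R ?T x a)"
      using Tlin[OF that] linear_sum[OF Tlin[OF that], of "\<lambda>a. (w \<bullet> a) *\<^sub>R a" Basis]
      by (simp add: euclidean_representation linear_scale)
    then show ?thesis
      by (simp add: bilinear_sum[OF g_bilinear] sum.cartesian_product[symmetric]
          bilinear_lmul[OF g_bilinear] bilinear_rmul[OF g_bilinear] ac_simps)
  qed
  have entry: "((\<lambda>i. g (xx i) (?T (xx i) a) (?T (xx i) b)) \<longlongrightarrow> g x (?T x a) (?T x b)) F" for a b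
  proof -
    define G where "G y = (let x = chart_inv c y; T = coord_change c (chart_at A x) x in g x (T a) (T b))" for y
    have "Ck_on 0 G (chart_image c)"
      using metric x(2) unfolding riemannian_metric_def smooth_on_def G_def[abs_def] by blast
    then have "continuous_on (chart_image c) G" by simp
    from continuous_on_interior[OF this chart_interior[OF not_boundary[OF x(1)] x(2,3)]]
    have "((\<lambda>i. G (snd c (xx i))) \<longlongrightarrow> G (snd c x)) F"
      by (rule isCont_tendsto_compose[OF _ chart_tendsto[OF xx(1) x(2,3)]])
    moreover have G: "G (snd c x) = g x (?T x a) (?T x b)" if "x \<in> \<Lambda>" "x \<in> fst c" for x
      using that x(2) by (simp add: G_def Let_def chart_inv_chart coord_change_eq)
    moreover have "\<forall>\<^sub>F i in F. G (snd c (xx i)) = g (xx i) (?T (xx i) a) (?T (xx i) b)"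
      using ev by eventually_elim (simp add: G)
    ultimately show ?thesis using x by (simp add: tendsto_cong)
  qed
  have "((\<lambda>i. \<Sum>a\<in>Basis. \<Sum>b\<in>Basis. (ww i \<bullet> a) * (ww i \<bullet> b) * g (xx i) (?T (xx i) a) (?T (xx i) b)) \<longlongrightarrow>
    (\<Sum>a\<in>Basis. \<Sum>b\<in>Basis. (w \<bullet> a) * (w \<bullet> b) * g x (?T x a) (?T x b))) F"
    by (intro tendsto_intros entry ww)
  moreover have "\<forall>\<^sub>F i in F. (\<Sum>a\<in>Basis. \<Sum>b\<in>Basis. (ww i \<bullet> a) * (ww i \<bullet> b) * g (xx i) (?T (xx i) a) (?T (xx i) b))
      = g (xx i) (?T (xx i) (ww i)) (?T (xx i) (ww i))"
    using ev by eventually_elim (simp add: expand)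
  ultimately have "((\<lambda>i. g (xx i) (?T (xx i) (ww i)) (?T (xx i) (ww i))) \<longlongrightarrow> g x (?T x w) (?T x w)) F"
    using expand[OF x(1,3), of w] by (simp add: tendsto_cong)
  then show ?thesis unfolding tnorm_def by (intro tendsto_intros)
qed

text \<open>Convergence in the tangent bundle over \<open>\<Lambda>\<close>. Tangent vectors are written in the preferred
  charts, which jump from point to point, so convergence has to be read off in a common chart.\<close>

definition tconv :: "('i \<Rightarrow> 'm) \<Rightarrow> ('i \<Rightarrow> 'e) \<Rightarrow> 'm \<Rightarrow> 'e \<Rightarrow> 'i filter \<Rightarrow> bool" where
  "tconv xx uu x u F \<longleftrightarrow> (\<forall>\<^sub>F i in F. xx i \<in> \<Lambda>) \<and> x \<in> \<Lambda> \<and> (xx \<longlongrightarrow> x) F \<and>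
     (\<forall>c\<in>A. x \<in> fst c \<longrightarrow> ((\<lambda>i. tcoord c (xx i) (uu i)) \<longlongrightarrow> tcoord c x u) F)"

text \<open>One chart around the limit suffices, since the change to any other chart is continuous
  jointly in point and vector.\<close>

lemma tconvI:
  assumes "\<forall>\<^sub>F i in F. xx i \<in> \<Lambda>" and x: "x \<in> \<Lambda>" and xx: "(xx \<longlongrightarrow> x) F" and c: "c \<in> A" "x \<in> fst c"
    and lim: "((\<lambda>i. tcoord c (xx i) (uu i)) \<longlongrightarrow> tcoord c x u) F"
  shows "tconv xx uu x u F"
  unfolding tconv_def
proof (intro conjI ballI impI assms)
  fix d assume d: "d \<in> A" "x \<in> fst d"
  have "((\<lambda>i. Dflow c d 0 (xx i) (tcoord c (xx i) (uu i))) \<longlongrightarrow> Dflow c d 0 x (tcoord c x u)) F"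
    by (rule Dflow_tendsto[OF in_D[OF x] c d(1) _ tendsto_const xx lim]) (simp add: d)
  moreover have "\<forall>\<^sub>F i in F. Dflow c d 0 (xx i) (tcoord c (xx i) (uu i)) = tcoord d (xx i) (uu i)"
    using assms(1) eventually_in_chart[OF xx c] eventually_in_chart[OF xx d]
    by eventually_elim (simp add: Dflow_zero_tcoord c d)
  ultimately show "((\<lambda>i. tcoord d (xx i) (uu i)) \<longlongrightarrow> tcoord d x u) F"
    using Dflow_zero_tcoord[OF x c d] by (simp add: tendsto_cong)
qed

lemma tconv_flow:
  assumes tt: "(tt \<longlongrightarrow> t) F" and conv: "tconv xx uu x u F"
  shows "tconv (\<lambda>i. \<phi> (tt i) (xx i)) (\<lambda>i. D\<phi> (tt i) (xx i) (uu i)) (\<phi> t x) (D\<phi> t x u) F"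
proof -
  have x: "x \<in> \<Lambda>" and xx: "(xx \<longlongrightarrow> x) F" and ev: "\<forall>\<^sub>F i in F. xx i \<in> \<Lambda>"
    using conv by (simp_all add: tconv_def)
  let ?c = "chart_at A x" and ?d = "chart_at A (\<phi> t x)"
  have lim: "((\<lambda>i. tcoord ?c (xx i) (uu i)) \<longlongrightarrow> tcoord ?c x u) F" using conv by (simp add: tconv_def)
  have \<phi>\<phi>: "((\<lambda>i. \<phi> (tt i) (xx i)) \<longlongrightarrow> \<phi> t x) F" by (rule flow_tendsto[OF tt xx in_D[OF x]])
  show ?thesis
  proof (rule tconvI[OF _ flow_in[OF x] \<phi>\<phi> chart_at_in in_chart_at])
    show "\<forall>\<^sub>F i in F. \<phi> (tt i) (xx i) \<in> \<Lambda>" using ev by eventually_elim (rule flow_in)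
    have "((\<lambda>i. Dflow ?c ?d (tt i) (xx i) (tcoord ?c (xx i) (uu i))) \<longlongrightarrow> Dflow ?c ?d t x (tcoord ?c x u)) F"
      by (rule Dflow_tendsto[OF in_D[OF x] chart_at_in in_chart_at chart_at_in in_chart_at tt xx lim])
    moreover have "\<forall>\<^sub>F i in F. Dflow ?c ?d (tt i) (xx i) (tcoord ?c (xx i) (uu i))
        = tcoord ?d (\<phi> (tt i) (xx i)) (D\<phi> (tt i) (xx i) (uu i))"
      using ev eventually_in_chart[OF xx chart_at_in in_chart_at]
        eventually_in_chart[OF \<phi>\<phi> chart_at_in in_chart_at]
      by eventually_elim (rule tcoord_mderiv[symmetric], simp_all)
    ultimately show "((\<lambda>i. tcoord ?d (\<phi> (tt i) (xx i)) (D\<phi> (tt i) (xx i) (uu i))) \<longlongrightarrow>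
        tcoord ?d (\<phi> t x) (D\<phi> t x u)) F"
      using tcoord_mderiv[OF x chart_at_in in_chart_at chart_at_in in_chart_at] by (simp add: tendsto_cong)
  qed
qed

lemma tconv_tnorm:
  assumes conv: "tconv xx uu x u F"
  shows "((\<lambda>i. tnorm g (xx i) (uu i)) \<longlongrightarrow> tnorm g x u) F"
proof -
  have x: "x \<in> \<Lambda>" and xx: "(xx \<longlongrightarrow> x) F" and ev: "\<forall>\<^sub>F i in F. xx i \<in> \<Lambda>"
    using conv by (simp_all add: tconv_def)
  let ?c = "chart_at A x"
  have lim: "((\<lambda>i. tcoord ?c (xx i) (uu i)) \<longlongrightarrow> tcoord ?c x u) F" using conv by (simp add: tconv_def)
  have "\<forall>\<^sub>F i in F. tnorm g (xx i) (Dflow ?c (chart_at A (xx i)) 0 (xx i) (tcoord ?c (xx i) (uu i)))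
      = tnorm g (xx i) (uu i)"
    using ev eventually_in_chart[OF xx chart_at_in in_chart_at]
    by eventually_elim (simp add: tcoord_inverse)
  then show ?thesis
    using metric_tendsto[OF x chart_at_in in_chart_at xx ev lim]
    by (simp add: tendsto_cong tcoord_inverse[OF x chart_at_in in_chart_at])
qed

lemma tconv_scale:
  assumes conv: "tconv xx uu x u F" and r: "(rr \<longlongrightarrow> r) F"
  shows "tconv xx (\<lambda>i. rr i *\<^sub>R uu i) x (r *\<^sub>R u) F"
proof -
  have x: "x \<in> \<Lambda>" and xx: "(xx \<longlongrightarrow> x) F" and ev: "\<forall>\<^sub>F i in F. xx i \<in> \<Lambda>"
    using conv by (simp_all add: tconv_def)
  let ?c = "chart_at A x"
  show ?thesis
  proof (rule tconvI[OF ev x xx chart_at_in in_chart_at])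
    have "((\<lambda>i. rr i *\<^sub>R tcoord ?c (xx i) (uu i)) \<longlongrightarrow> r *\<^sub>R tcoord ?c x u) F"
      using conv by (intro tendsto_intros r) (simp add: tconv_def)
    moreover have "\<forall>\<^sub>F i in F. rr i *\<^sub>R tcoord ?c (xx i) (uu i) = tcoord ?c (xx i) (rr i *\<^sub>R uu i)"
      using ev eventually_in_chart[OF xx chart_at_in in_chart_at]
      by eventually_elim (simp add: linear_scale[OF tcoord_linear])
    ultimately show "((\<lambda>i. tcoord ?c (xx i) (rr i *\<^sub>R uu i)) \<longlongrightarrow> tcoord ?c x (r *\<^sub>R u)) F"
      using linear_scale[OF tcoord_linear[OF x chart_at_in in_chart_at]] by (simp add: tendsto_cong)
  qed
qed

text \<open>Compactness of the unit sphere bundle, obtained without a uniform comparison of norms: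
  the coordinate vectors \<open>w n\<close> are compressed into the unit ball by
  \<open>s n = 1 / (1 + norm (w n))\<close>, and positivity of the metric at the limit keeps the
  limit of these factors positive.\<close>

lemma tconv_unit_subseq:
  assumes xx: "\<And>n::nat. xx n \<in> \<Lambda>" and unit: "\<And>n. tnorm g (xx n) (uu n) = 1"
  shows "\<exists>r x u. strict_mono r \<and> tconv (xx \<circ> r) (uu \<circ> r) x u sequentially"
proof -
  obtain x r1 where x: "x \<in> \<Lambda>" and r1: "strict_mono (r1::nat \<Rightarrow> nat)" "(xx \<circ> r1) \<longlonglongrightarrow> x"
    using compact_subseq[OF compact_\<Lambda>, of xx] xx by blast
  let ?c = "chart_at A x"
  note c = chart_at_in[of x] in_chart_at[of x]
  define w where "w n = tcoord ?c (xx (r1 n)) (uu (r1 n))" for n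
  define s where "s n = 1 / (1 + norm (w n))" for n
  define \<omega> where "\<omega> n = s n *\<^sub>R w n" for n
  have s: "0 < s n" "s n \<le> 1" for n by (auto simp: s_def divide_simps add_pos_nonneg)
  have n\<omega>: "norm (\<omega> n) = 1 - s n" for n
  proof -
    have "1 + norm (w n) > 0" by (simp add: add_pos_nonneg)
    then show ?thesis by (simp add: \<omega>_def s_def field_simps)
  qed
  have mem: "(\<omega> n, s n) \<in> cball 0 1 \<times> {0..1}" for n using s[of n] n\<omega>[of n] by auto
  have "compact (cball (0::'e) 1 \<times> {0..1::real})" by (intro compact_Times compact_cball compact_Icc)
  from compact_subseq[of _ "\<lambda>n. (\<omega> n, s n)", OF this mem] obtain l r2 where r2: "strict_mono (r2::nat \<Rightarrow> nat)" "((\<lambda>n. (\<omega> n, s n)) \<circ> r2) \<longlonglongrightarrow> l"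
    by blast
  define \<omega>0 s0 where "\<omega>0 = fst l" and "s0 = snd l"
  have lim\<omega>: "(\<lambda>n. \<omega> (r2 n)) \<longlonglongrightarrow> \<omega>0" and lims: "(\<lambda>n. s (r2 n)) \<longlonglongrightarrow> s0"
    using tendsto_fst[OF r2(2)] tendsto_snd[OF r2(2)] by (simp_all add: \<omega>0_def s0_def o_def)
  have xr: "(\<lambda>n. xx (r1 (r2 n))) \<longlonglongrightarrow> x" using LIMSEQ_subseq_LIMSEQ[OF r1(2) r2(1)] by (simp add: o_def)
  have ev\<Lambda>: "\<forall>\<^sub>F n in sequentially. xx (r1 (r2 n)) \<in> \<Lambda>" using xx by simp
  have "norm \<omega>0 = 1 - s0"
    using LIMSEQ_unique[OF tendsto_norm[OF lim\<omega>]] tendsto_diff[OF tendsto_const lims, of 1] by (simp add: n\<omega>)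
  have Ts: "tnorm g (xx (r1 n)) (Dflow ?c (chart_at A (xx (r1 n))) 0 (xx (r1 n)) (\<omega> n)) = s n"
    if "xx (r1 n) \<in> fst ?c" for n
    using unit[of "r1 n"] s[of n] linear_scale[OF Dflow_zero_linear[OF xx c(1) that chart_at_in in_chart_at]]
      tcoord_inverse(1)[OF xx c(1) that]
    by (simp add: \<omega>_def w_def tnorm_scale)
  have "(\<lambda>n. s (r2 n)) \<longlonglongrightarrow> tnorm g x (Dflow ?c ?c 0 x \<omega>0)"
  proof (rule Lim_transform_eventually[OF metric_tendsto[OF x c xr ev\<Lambda> lim\<omega>]])
    show "\<forall>\<^sub>F n in sequentially.
      tnorm g (xx (r1 (r2 n))) (Dflow ?c (chart_at A (xx (r1 (r2 n)))) 0 (xx (r1 (r2 n))) (\<omega> (r2 n))) = s (r2 n)"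
      using eventually_in_chart[OF xr c] by eventually_elim (rule Ts)
  qed
  then have "s0 = tnorm g x \<omega>0" using LIMSEQ_unique[OF lims] Dflow_id[OF x c] by simp
  \<comment> \<open>Since \<open>norm \<omega>0 = 1 - s0\<close>, a vanishing \<open>s0\<close>
    would make \<open>\<omega>0\<close> a nonzero vector of metric norm 0.\<close>
  then have s0: "s0 > 0" using tnorm_pos[of \<omega>0 x] \<open>norm \<omega>0 = 1 - s0\<close> by (cases "\<omega>0 = 0") auto
  have "(\<lambda>n. \<omega> (r2 n) /\<^sub>R s (r2 n)) \<longlonglongrightarrow> \<omega>0 /\<^sub>R s0"
    using s0 by (intro tendsto_intros lim\<omega> lims) auto
  moreover have "\<omega> n /\<^sub>R s n = w n" for n using s(1)[of n] by (simp add: \<omega>_def)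
  ultimately have "(\<lambda>n. tcoord ?c (xx (r1 (r2 n))) (uu (r1 (r2 n)))) \<longlonglongrightarrow> \<omega>0 /\<^sub>R s0" by (simp add: w_def)
  then have "tconv (xx \<circ> (r1 \<circ> r2)) (uu \<circ> (r1 \<circ> r2)) x (\<omega>0 /\<^sub>R s0) sequentially"
    using xr ev\<Lambda> by (intro tconvI[OF _ x _ c]) (simp_all add: o_def tcoord_def Dflow_id[OF x c])
  then show ?thesis using strict_mono_o[OF r1(1) r2(1)] by blast
qed

text \<open>Near \<open>x\<close> the vectors are expanded in a local frame, which converges in a
  common chart to a frame at \<open>x\<close>. By \<open>limit_in_span\<close> the limit vector lies
  in the limit span, although convergence of the coefficients is not assumed.\<close>

lemma subbundle_closed:
  assumes E: "continuous_subbundle A \<Lambda> E" and conv: "tconv xx uu x u sequentially"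
    and mem: "\<And>n::nat. uu n \<in> E (xx n)"
  shows "u \<in> E x"
proof -
  have x: "x \<in> \<Lambda>" and xx: "xx \<longlonglongrightarrow> x" and ev: "\<forall>\<^sub>F n in sequentially. xx n \<in> \<Lambda>"
    using conv by (simp_all add: tconv_def)
  have "\<exists>c\<in>A. \<exists>W k. \<exists>s :: nat \<Rightarrow> 'm \<Rightarrow> 'e. open W \<and> x \<in> W \<and> W \<subseteq> fst c \<and>
        (\<forall>i<k. continuous_on (W \<inter> \<Lambda>) (\<lambda>y. coord_change (chart_at A y) c y (s i y))) \<and>
        (\<forall>y\<in>W \<inter> \<Lambda>. inj_on (\<lambda>i. s i y) {..<k} \<and> independent ((\<lambda>i. s i y) ` {..<k}) \<and>
                   span ((\<lambda>i. s i y) ` {..<k}) = E y)"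
    using E x unfolding continuous_subbundle_def by (rule bspec)
  then obtain c W k and s :: "nat \<Rightarrow> 'm \<Rightarrow> 'e" where c: "c \<in> A" and W: "open W" "x \<in> W" "W \<subseteq> fst c"
    and cont: "\<forall>i<k. continuous_on (W \<inter> \<Lambda>) (\<lambda>y. coord_change (chart_at A y) c y (s i y))"
    and frame: "\<forall>y\<in>W \<inter> \<Lambda>. inj_on (\<lambda>i. s i y) {..<k} \<and> independent ((\<lambda>i. s i y) ` {..<k}) \<and>
                   span ((\<lambda>i. s i y) ` {..<k}) = E y"
    by (elim bexE exE conjE)
  have xc: "x \<in> fst c" using W by blast
  have evW: "\<forall>\<^sub>F n in sequentially. xx n \<in> W \<inter> \<Lambda>"
    using ev topological_tendstoD[OF xx W(1,2)] by eventually_elim simp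
  have lin: "linear (tcoord c y)" if "y \<in> W \<inter> \<Lambda>" for y using tcoord_linear[of y c] that c W by blast
  have tc_sum: "tcoord c y (\<Sum>i<k. b i *\<^sub>R s i y) = (\<Sum>i<k. b i *\<^sub>R tcoord c y (s i y))"
    if "y \<in> W \<inter> \<Lambda>" for y and b :: "nat \<Rightarrow> real"
    by (simp add: linear_sum[OF lin[OF that]] linear_scale[OF lin[OF that]])
  have "\<exists>a::nat \<Rightarrow> real. xx n \<in> W \<inter> \<Lambda> \<longrightarrow> uu n = (\<Sum>i<k. a i *\<^sub>R s i (xx n))" for n
  proof (cases "xx n \<in> W \<inter> \<Lambda>")
    case True
    note fr = bspec[OF frame True]
    have "uu n \<in> span ((\<lambda>i. s i (xx n)) ` {..<k})" using mem[of n] fr by simp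
    then obtain q where "uu n = (\<Sum>v\<in>(\<lambda>i. s i (xx n)) ` {..<k}. q v *\<^sub>R v)"
      by (auto simp: span_finite)
    then have "uu n = (\<Sum>i<k. q (s i (xx n)) *\<^sub>R s i (xx n))" using fr by (simp add: sum.reindex)
    then show ?thesis by (intro exI[of _ "\<lambda>i. q (s i (xx n))"]) simp
  qed blast
  then obtain a :: "nat \<Rightarrow> nat \<Rightarrow> real" where a: "\<And>n. xx n \<in> W \<inter> \<Lambda> \<longrightarrow> uu n = (\<Sum>i<k. a n i *\<^sub>R s i (xx n))"
    by metis
  have "\<exists>b::nat \<Rightarrow> real. tcoord c x u = (\<Sum>i<k. b i *\<^sub>R tcoord c x (s i x))"
  proof (rule limit_in_span)
    fix i assume i: "i < k"
    have "(\<lambda>n. coord_change (chart_at A (xx n)) c (xx n) (s i (xx n))) \<longlonglongrightarrow> coord_change (chart_at A x) c x (s i x)"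
      by (rule continuous_on_tendsto_compose[OF cont[rule_format, OF i] xx _ evW]) (use x W in auto)
    moreover have "\<forall>\<^sub>F n in sequentially. coord_change (chart_at A (xx n)) c (xx n) (s i (xx n))
        = tcoord c (xx n) (s i (xx n))"
      using evW by eventually_elim (use W c in \<open>auto simp: coord_change_tcoord\<close>)
    ultimately show "(\<lambda>n. tcoord c (xx n) (s i (xx n))) \<longlonglongrightarrow> tcoord c x (s i x)"
      using coord_change_tcoord[OF x c xc] by (simp add: tendsto_cong)
  next
    have "(\<lambda>n. tcoord c (xx n) (uu n)) \<longlonglongrightarrow> tcoord c x u" using conv c xc by (simp add: tconv_def)
    moreover have "\<forall>\<^sub>F n in sequentially. tcoord c (xx n) (uu n) = (\<Sum>i<k. a n i *\<^sub>R tcoord c (xx n) (s i (xx n)))"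
      using evW by eventually_elim (metis a tc_sum)
    ultimately show "(\<lambda>n. \<Sum>i<k. a n i *\<^sub>R tcoord c (xx n) (s i (xx n))) \<longlonglongrightarrow> tcoord c x u"
      by (simp add: tendsto_cong)
  next
    fix b :: "nat \<Rightarrow> real" and j assume b: "(\<Sum>i<k. b i *\<^sub>R tcoord c x (s i x)) = 0" and j: "j < k"
    have fr: "inj_on (\<lambda>i. s i x) {..<k}" "independent ((\<lambda>i. s i x) ` {..<k})"
      using frame x W by auto
    have "tcoord c x (\<Sum>i<k. b i *\<^sub>R s i x) = tcoord c x 0"
      using b tc_sum[of x b] linear_0[OF lin[of x]] x W by simp
    then have 0: "(\<Sum>i<k. b i *\<^sub>R s i x) = 0" by (metis tcoord_inverse(1)[OF x c xc])
    \<comment> \<open>\<open>independentD\<close> takes coefficients indexed by vectors, so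
      \<open>b\<close> is transported along the injective frame.\<close>
    define q where "q = (\<lambda>v. b (the_inv_into {..<k} (\<lambda>i. s i x) v))"
    have q: "q (s i x) = b i" if "i < k" for i
      unfolding q_def using the_inv_into_f_f[OF fr(1), of i] that by simp
    then have "(\<Sum>v\<in>(\<lambda>i. s i x) ` {..<k}. q v *\<^sub>R v) = 0" using 0 by (simp add: sum.reindex[OF fr(1)])
    then have "q (s j x) = 0" using independentD[OF fr(2) _ order_refl, of q "s j x"] j by simp
    then show "b j = 0" using q[OF j] by simp
  qed
  then obtain b :: "nat \<Rightarrow> real" where "tcoord c x u = tcoord c x (\<Sum>i<k. b i *\<^sub>R s i x)"
    using tc_sum[of x] x W by auto
  then have "u = (\<Sum>i<k. b i *\<^sub>R s i x)" by (metis tcoord_inverse(1)[OF x c xc])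
  also have "\<dots> \<in> span ((\<lambda>i. s i x) ` {..<k})" by (intro span_sum span_scale span_base) auto
  finally show ?thesis using frame x W by auto
qed

end

section \<open>The bundle of pairs of unit vectors\<close>

lemma tendsto_scaleR_cancel:
  fixes f :: "'i \<Rightarrow> 'a::real_normed_vector"
  assumes r: "(r \<longlongrightarrow> r0) G" "r0 \<noteq> 0" and f: "((\<lambda>j. r j *\<^sub>R f j) \<longlongrightarrow> r0 *\<^sub>R l) G"
  shows "(f \<longlongrightarrow> l) G"
proof -
  have "((\<lambda>j. inverse (r j) *\<^sub>R (r j *\<^sub>R f j)) \<longlongrightarrow> inverse r0 *\<^sub>R (r0 *\<^sub>R l)) G"
    by (intro tendsto_scaleR tendsto_inverse r f)
  moreover have "\<forall>\<^sub>F j in G. inverse (r j) *\<^sub>R (r j *\<^sub>R f j) = f j"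
    using tendsto_imp_eventually_ne[OF r] by eventually_elim simp
  ultimately show ?thesis using r(2) by (simp add: tendsto_cong)
qed

section \<open>Bump functions over finitely many charts\<close>

context manifold_flow
begin

text \<open>A tent function of the chart coordinate, supported in the preimage of a closed ball.
  That preimage is compact, hence closed in the Hausdorff space, which makes the extension by zero
  continuous across the edge of the chart.\<close>

lemma bump_function:
  assumes x: "x \<in> \<Lambda>"
  shows "\<exists>\<rho> K. continuous_on UNIV \<rho> \<and> 0 < (\<rho> x :: real) \<and> closed K \<and> K \<subseteq> fst (chart_at A x) \<and>
    (\<forall>y. y \<notin> K \<longrightarrow> \<rho> y = 0)"
proof -
  let ?c = "chart_at A x"
  obtain r where r: "r > 0" "cball (snd ?c x) r \<subseteq> chart_image ?c"
    using chart_interior[OF not_boundary[OF x] chart_at_in in_chart_at] mem_interior_cball by blast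
  define K where "K = chart_inv ?c ` cball (snd ?c x) r"
  have "compact K" unfolding K_def
    by (intro compact_continuous_image continuous_on_subset[OF chart_inv_cont[OF chart_at_in] r(2)] compact_cball)
  then have clK: "closed K" by (rule compact_imp_closed)
  have KC: "K \<subseteq> fst ?c" using r(2) chart_inv_in[OF chart_at_in] by (auto simp: K_def)
  define \<rho> where "\<rho> y = (if y \<in> K then r - dist (snd ?c y) (snd ?c x) else 0)" for y
  have \<rho>: "\<rho> y = max 0 (r - dist (snd ?c y) (snd ?c x))" if y: "y \<in> fst ?c" for y
  proof (cases "y \<in> K")
    case True
    then obtain z where z: "z \<in> cball (snd ?c x) r" "y = chart_inv ?c z" by (auto simp: K_def)
    then have "snd ?c y = z" using r(2) chart_chart_inv[OF chart_at_in] by blast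
    then show ?thesis using z True by (simp add: \<rho>_def dist_commute)
  next
    case False
    have "snd ?c y \<notin> cball (snd ?c x) r"
    proof
      assume "snd ?c y \<in> cball (snd ?c x) r"
      then have "chart_inv ?c (snd ?c y) \<in> K" unfolding K_def by (rule imageI)
      then show False using False chart_inv_chart[OF chart_at_in y] by simp
    qed
    then show ?thesis using False by (simp add: \<rho>_def dist_commute)
  qed
  have "continuous_on (fst ?c) (\<lambda>y. max 0 (r - dist (snd ?c y) (snd ?c x)))"
    by (intro continuous_intros chart_cont[OF chart_at_in])
  then have 1: "continuous_on (fst ?c) \<rho>" using \<rho> by (subst continuous_on_cong[OF refl \<rho>]) auto
  have 2: "continuous_on (- K) \<rho>"
    by (rule continuous_on_eq[OF continuous_on_const[of _ 0]]) (simp add: \<rho>_def)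
  have "continuous_on (fst ?c \<union> - K) \<rho>"
    by (rule continuous_on_open_Un[OF chart_open[OF chart_at_in] open_Compl[OF clK] 1 2])
  moreover have "fst ?c \<union> - K = UNIV" using KC by blast
  ultimately have "continuous_on UNIV \<rho>" by simp
  moreover have "0 < \<rho> x" using \<rho>[OF in_chart_at] r(1) by simp
  ultimately show ?thesis using clK KC by (intro exI[of _ \<rho>] exI[of _ K]) (simp add: \<rho>_def)
qed

text \<open>A finite subcover of \<Lambda> is padded to a sequence, so that the embedding lands in
  function spaces indexed by \<open>nat\<close>, which carry a metric.\<close>

lemma bump_cover:
  "\<exists>C \<rho> K. (\<forall>i::nat. C i \<in> A \<and> continuous_on UNIV (\<rho> i :: 'm \<Rightarrow> real) \<and> closed (K i) \<and> K i \<subseteq> fst (C i) \<and>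
     (\<forall>y. y \<notin> K i \<longrightarrow> \<rho> i y = 0)) \<and> (\<forall>x\<in>\<Lambda>. \<exists>i. \<rho> i x \<noteq> 0)"
proof -
  have "\<forall>x\<in>\<Lambda>. \<exists>q. continuous_on UNIV (fst q) \<and> 0 < (fst q x :: real) \<and> closed (snd q) \<and>
      snd q \<subseteq> fst (chart_at A x) \<and> (\<forall>y. y \<notin> snd q \<longrightarrow> fst q y = 0)"
    using bump_function by (metis fst_conv snd_conv)
  from bchoice[OF this] obtain q where q: "\<forall>x\<in>\<Lambda>. continuous_on UNIV (fst (q x)) \<and> 0 < (fst (q x) x :: real) \<and>
      closed (snd (q x)) \<and> snd (q x) \<subseteq> fst (chart_at A x) \<and> (\<forall>y. y \<notin> snd (q x) \<longrightarrow> fst (q x) y = 0)" ..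
  have op: "open {y. fst (q x) y > 0}" if "x \<in> \<Lambda>" for x
    by (intro open_Collect_less continuous_on_const) (use q that in blast)
  have cov: "\<Lambda> \<subseteq> (\<Union>x\<in>\<Lambda>. {y. fst (q x) y > 0})" using q by blast
  obtain P where P: "P \<subseteq> \<Lambda>" "finite P" "\<Lambda> \<subseteq> (\<Union>x\<in>P. {y. fst (q x) y > 0})"
    by (rule compactE_image[OF compact_\<Lambda> op cov])
  obtain p and n :: nat where p: "P = p ` {i. i < n}"
    using finite_imp_nat_seg_image_inj_on[OF P(2)] by metis
  define C where "C i = chart_at A (p i)" for i
  \<comment> \<open>Beyond \<open>n\<close> the weight is 0 and its support empty;
    \<open>C i\<close> is still a chart of the atlas but carries no information.\<close>
  define \<rho> where "\<rho> i = (if i < n then fst (q (p i)) else (\<lambda>_. 0))" for i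
  define K where "K i = (if i < n then snd (q (p i)) else {})" for i
  have pL: "p i \<in> \<Lambda>" if "i < n" for i using that p P(1) by blast
  have 1: "C i \<in> A \<and> continuous_on UNIV (\<rho> i) \<and> closed (K i) \<and> K i \<subseteq> fst (C i) \<and> (\<forall>y. y \<notin> K i \<longrightarrow> \<rho> i y = 0)" for i
    using bspec[OF q pL[of i]] by (simp add: C_def \<rho>_def K_def)
  have 2: "\<exists>i. \<rho> i x \<noteq> 0" if x: "x \<in> \<Lambda>" for x
  proof -
    obtain i where "i < n" "fst (q (p i)) x > 0" using P(3) x p by blast
    then show ?thesis by (intro exI[of _ i]) (simp add: \<rho>_def)
  qed
  show ?thesis by (intro exI[of _ C] exI[of _ \<rho>] exI[of _ K]) (use 1 2 in blast)
qed

lemma tconv_compose: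
  assumes "tconv xx uu x u F" "filterlim h F G"
  shows "tconv (xx \<circ> h) (uu \<circ> h) x u G"
  using assms unfolding tconv_def o_def
  by (auto intro: filterlim_compose elim: eventually_compose_filterlim)

end

text \<open>The bump functions \<open>\<rho>\<close> embed the bundle of pairs of tangent vectors over \<open>\<Lambda>\<close> into a
  product of Euclidean spaces.\<close>

locale split_flow = manifold_flow A g X \<phi> \<Lambda>
  for A :: "('m::{t2_space,second_countable_topology}, 'e::euclidean_space) atlas"
    and g X \<phi> \<Lambda> +
  fixes E F :: "'m \<Rightarrow> 'e set" and C :: "nat \<Rightarrow> ('m, 'e) chart" and \<rho> :: "nat \<Rightarrow> 'm \<Rightarrow> real" and K :: "nat \<Rightarrow> 'm set"
  assumes splitting: "continuous_invariant_splitting A \<phi> \<Lambda> E F"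
    and C_chart: "C i \<in> A" and \<rho>_cont: "continuous_on UNIV (\<rho> i)" and K_closed: "closed (K i)"
    and K_chart: "K i \<subseteq> fst (C i)" and \<rho>_support: "y \<notin> K i \<Longrightarrow> \<rho> i y = 0"
    and \<rho>_cover: "x \<in> \<Lambda> \<Longrightarrow> \<exists>i. \<rho> i x \<noteq> 0"
begin

lemma subspace_E: "x \<in> \<Lambda> \<Longrightarrow> subspace (E x)" and subspace_F: "x \<in> \<Lambda> \<Longrightarrow> subspace (F x)"
  and E_ne: "x \<in> \<Lambda> \<Longrightarrow> E x \<noteq> {0}" and F_ne: "x \<in> \<Lambda> \<Longrightarrow> F x \<noteq> {0}"
  and E_inv: "x \<in> \<Lambda> \<Longrightarrow> D\<phi> t x ` E x = E (\<phi> t x)"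
  and F_inv: "x \<in> \<Lambda> \<Longrightarrow> D\<phi> t x ` F x = F (\<phi> t x)"
  and E_bundle: "continuous_subbundle A \<Lambda> E" and F_bundle: "continuous_subbundle A \<Lambda> F"
  using splitting by (simp_all add: continuous_invariant_splitting_def)

text \<open>The weight is recorded next to the weighted coordinate, so that the coordinate can be
  recovered by division wherever the weight is nonzero.\<close>

definition base_emb :: "'m \<Rightarrow> nat \<Rightarrow> real \<times> 'e" where
  "base_emb x i = (\<rho> i x, \<rho> i x *\<^sub>R snd (C i) x)"

definition vec_emb :: "'m \<Rightarrow> 'e \<Rightarrow> nat \<Rightarrow> 'e" where
  "vec_emb x u i = \<rho> i x *\<^sub>R tcoord (C i) x u"

lemma \<rho>_tendsto: "(xx \<longlongrightarrow> x) G \<Longrightarrow> ((\<lambda>j. \<rho> i (xx j)) \<longlongrightarrow> \<rho> i x) G"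
  by (rule continuous_on_tendsto_compose[OF \<rho>_cont]) auto

text \<open>Around a point outside the closed set \<open>K i\<close> the weight vanishes, whatever
  \<open>f\<close> does; a point of \<open>K i\<close> lies in the chart, where \<open>f\<close>
  converges.\<close>

lemma \<rho>_scaled_tendsto:
  fixes f :: "'i \<Rightarrow> 'b::real_normed_vector"
  assumes xx: "(xx \<longlongrightarrow> x) G" and lim: "x \<in> fst (C i) \<Longrightarrow> (f \<longlongrightarrow> l) G"
  shows "((\<lambda>j. \<rho> i (xx j) *\<^sub>R f j) \<longlongrightarrow> \<rho> i x *\<^sub>R l) G"
proof (cases "x \<in> K i")
  case True
  then have xC: "x \<in> fst (C i)" using K_chart by blast
  show ?thesis by (intro tendsto_scaleR \<rho>_tendsto xx lim[OF xC])
next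
  case False
  then have "\<forall>\<^sub>F j in G. xx j \<in> - K i"
    using K_closed by (intro topological_tendstoD[OF xx]) auto
  then have "\<forall>\<^sub>F j in G. \<rho> i (xx j) *\<^sub>R f j = 0" by eventually_elim (simp add: \<rho>_support)
  then show ?thesis using False by (simp add: \<rho>_support tendsto_eventually)
qed

lemma base_emb_tendsto:
  assumes xx: "(xx \<longlongrightarrow> x) G"
  shows "((\<lambda>j. base_emb (xx j)) \<longlongrightarrow> base_emb x) G"
  unfolding tendsto_fun_iff base_emb_def
  by (intro allI tendsto_Pair \<rho>_tendsto \<rho>_scaled_tendsto xx chart_tendsto[OF xx C_chart])

lemma vec_emb_tendsto:
  assumes conv: "tconv xx uu x u G"
  shows "((\<lambda>j. vec_emb (xx j) (uu j)) \<longlongrightarrow> vec_emb x u) G"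
  unfolding tendsto_fun_iff vec_emb_def
proof (intro allI \<rho>_scaled_tendsto)
  show "(xx \<longlongrightarrow> x) G" using conv by (simp add: tconv_def)
  fix i assume "x \<in> fst (C i)"
  then show "((\<lambda>j. tcoord (C i) (xx j) (uu j)) \<longlongrightarrow> tcoord (C i) x u) G"
    using conv C_chart by (simp add: tconv_def)
qed

text \<open>At an index whose weight does not vanish at \<open>x\<close>, division recovers the
  chart coordinates of base points and vectors. Hence the embedding loses no convergence.\<close>

lemma tconv_of_emb:
  assumes ev: "\<forall>\<^sub>F j in G. xx j \<in> \<Lambda>" and x: "x \<in> \<Lambda>"
    and b: "((\<lambda>j. base_emb (xx j)) \<longlongrightarrow> base_emb x) G"
    and v: "((\<lambda>j. vec_emb (xx j) (uu j)) \<longlongrightarrow> vec_emb x u) G"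
  shows "tconv xx uu x u G"
proof -
  obtain i where i: "\<rho> i x \<noteq> 0" using \<rho>_cover[OF x] by blast
  then have xK: "x \<in> fst (C i)" using \<rho>_support K_chart by blast
  have b': "((\<lambda>j. (\<rho> i (xx j), \<rho> i (xx j) *\<^sub>R snd (C i) (xx j))) \<longlongrightarrow> (\<rho> i x, \<rho> i x *\<^sub>R snd (C i) x)) G"
    using b unfolding tendsto_fun_iff base_emb_def by blast
  have \<rho>: "((\<lambda>j. \<rho> i (xx j)) \<longlongrightarrow> \<rho> i x) G" using tendsto_fst[OF b'] by simp
  have ne: "\<forall>\<^sub>F j in G. \<rho> i (xx j) \<noteq> 0" using tendsto_imp_eventually_ne[OF \<rho> i] .
  have inC: "\<forall>\<^sub>F j in G. xx j \<in> fst (C i)"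
    using ne by eventually_elim (use \<rho>_support K_chart in blast)
  have "((\<lambda>j. snd (C i) (xx j)) \<longlongrightarrow> snd (C i) x) G"
    by (rule tendsto_scaleR_cancel[OF \<rho> i]) (use tendsto_snd[OF b'] in simp)
  from filterlim_compose[OF chart_inv_tendsto[OF not_boundary[OF x] C_chart xK] this]
  have "((\<lambda>j. chart_inv (C i) (snd (C i) (xx j))) \<longlongrightarrow> x) G" .
  moreover have "\<forall>\<^sub>F j in G. chart_inv (C i) (snd (C i) (xx j)) = xx j"
    using inC by eventually_elim (rule chart_inv_chart[OF C_chart])
  ultimately have xx: "(xx \<longlongrightarrow> x) G" by (simp add: tendsto_cong)
  have v': "((\<lambda>j. \<rho> i (xx j) *\<^sub>R tcoord (C i) (xx j) (uu j)) \<longlongrightarrow> \<rho> i x *\<^sub>R tcoord (C i) x u) G"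
    using v unfolding tendsto_fun_iff vec_emb_def by blast
  have "((\<lambda>j. tcoord (C i) (xx j) (uu j)) \<longlongrightarrow> tcoord (C i) x u) G"
    by (rule tendsto_scaleR_cancel[OF \<rho> i v'])
  then show ?thesis by (rule tconvI[OF ev x xx C_chart xK])
qed

definition emb :: "'m \<times> 'e \<times> 'e \<Rightarrow> (nat \<Rightarrow> real \<times> 'e) \<times> (nat \<Rightarrow> 'e) \<times> (nat \<Rightarrow> 'e)" where
  "emb = (\<lambda>(x, u, v). (base_emb x, vec_emb x u, vec_emb x v))"

definition Z :: "('m \<times> 'e \<times> 'e) set" where
  "Z = {(x, u, v). x \<in> \<Lambda> \<and> u \<in> E x \<and> tnorm g x u = 1 \<and> v \<in> F x \<and> tnorm g x v = 1}"

definition dec where "dec = inv_into Z emb"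

text \<open>If two points have the same image, the constant sequence at one of them converges to the
  other, and limits in the tangent bundle are unique.\<close>

lemma emb_inj: "inj_on emb Z"
proof (rule inj_onI)
  fix z w assume z: "z \<in> Z" and w: "w \<in> Z" and eq: "emb z = emb w"
  obtain x u v where zz: "z = (x, u, v)" by (cases z)
  obtain x' u' v' where ww: "w = (x', u', v')" by (cases w)
  have x: "x \<in> \<Lambda>" "x' \<in> \<Lambda>" using z w by (auto simp: Z_def zz ww)
  have eqs: "base_emb x = base_emb x'" "vec_emb x u = vec_emb x' u'" "vec_emb x v = vec_emb x' v'"
    using eq by (simp_all add: emb_def zz ww)
  have conv: "tconv (\<lambda>_::nat. x) (\<lambda>_. u) x' u' sequentially" "tconv (\<lambda>_::nat. x) (\<lambda>_. v) x' v' sequentially"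
    by (rule tconv_of_emb; use x eqs in simp)+
  then have xx': "x = x'" by (simp add: tconv_def LIMSEQ_const_iff)
  have "tcoord (chart_at A x) x u = tcoord (chart_at A x) x u'" "tcoord (chart_at A x) x v = tcoord (chart_at A x) x v'"
    using conv by (simp_all add: tconv_def LIMSEQ_const_iff xx')
  then have "u = u'" "v = v'"
    using Dflow_id[OF x(1) chart_at_in in_chart_at] by (simp_all add: tcoord_def)
  then show "z = w" using xx' by (simp add: zz ww)
qed

lemma dec_emb: "z \<in> Z \<Longrightarrow> dec (emb z) = z"
  by (simp add: dec_def inv_into_f_f[OF emb_inj])

lemma dec_in: "y \<in> emb ` Z \<Longrightarrow> dec y \<in> Z" and emb_dec: "y \<in> emb ` Z \<Longrightarrow> emb (dec y) = y"
  by (auto simp: dec_emb)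

text \<open>Subsequences are extracted for \<open>u\<close> and then for \<open>v\<close>. The two
  limits share their base point because the space is Hausdorff, and closedness of the subbundles and
  continuity of the norm keep the limit in \<open>Z\<close>.\<close>

lemma compact_bundle: "compact (emb ` Z)"
  unfolding compact_eq_seq_compact_metric
proof (rule seq_compactI)
  fix f assume f: "\<forall>n::nat. f n \<in> emb ` Z"
  define xx uu vv where "xx n = fst (dec (f n))" and "uu n = fst (snd (dec (f n)))"
    and "vv n = snd (snd (dec (f n)))" for n
  have dz: "(xx n, uu n, vv n) \<in> Z" for n using dec_in f by (simp add: xx_def uu_def vv_def)
  have fe: "f n = emb (xx n, uu n, vv n)" for n using emb_dec f by (simp add: xx_def uu_def vv_def)
  have mem: "xx n \<in> \<Lambda>" "uu n \<in> E (xx n)" "tnorm g (xx n) (uu n) = 1" "vv n \<in> F (xx n)" "tnorm g (xx n) (vv n) = 1" for n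
    using dz[of n] by (simp_all add: Z_def)
  obtain r1 x u where r1: "strict_mono r1" "tconv (xx \<circ> r1) (uu \<circ> r1) x u sequentially"
    using tconv_unit_subseq[of xx uu, OF mem(1,3)] by blast
  have "\<exists>r x' v. strict_mono r \<and> tconv ((xx \<circ> r1) \<circ> r) ((vv \<circ> r1) \<circ> r) x' v sequentially"
    by (rule tconv_unit_subseq) (simp_all add: mem)
  then obtain r2 x' v where r2: "strict_mono r2" "tconv ((xx \<circ> r1) \<circ> r2) ((vv \<circ> r1) \<circ> r2) x' v sequentially"
    by blast
  have u2: "tconv ((xx \<circ> r1) \<circ> r2) ((uu \<circ> r1) \<circ> r2) x u sequentially"
    by (rule tconv_compose[OF r1(2) filterlim_subseq[OF r2(1)]])
  have "x' = x" using u2 r2(2) LIMSEQ_unique by (auto simp: tconv_def)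
  then have v2: "tconv ((xx \<circ> r1) \<circ> r2) ((vv \<circ> r1) \<circ> r2) x v sequentially" using r2 by simp
  have "u \<in> E x" by (rule subbundle_closed[OF E_bundle u2]) (simp add: mem)
  moreover have "v \<in> F x" by (rule subbundle_closed[OF F_bundle v2]) (simp add: mem)
  moreover have "tnorm g x u = 1" "tnorm g x v = 1"
    using tconv_tnorm[OF u2] tconv_tnorm[OF v2] by (simp_all add: mem LIMSEQ_const_iff)
  moreover have "x \<in> \<Lambda>" using u2 by (simp add: tconv_def)
  ultimately have "(x, u, v) \<in> Z" by (simp add: Z_def)
  moreover have "(f \<circ> (r1 \<circ> r2)) \<longlonglongrightarrow> emb (x, u, v)"
  proof -
    have "(xx \<circ> r1 \<circ> r2) \<longlonglongrightarrow> x" using u2 unfolding tconv_def by blast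
    from tendsto_Pair[OF base_emb_tendsto[OF this] tendsto_Pair[OF vec_emb_tendsto[OF u2] vec_emb_tendsto[OF v2]]]
    show ?thesis by (simp add: emb_def fe o_def)
  qed
  ultimately show "\<exists>l\<in>emb ` Z. \<exists>r. strict_mono r \<and> (f \<circ> r) \<longlonglongrightarrow> l"
    using strict_mono_o[OF r1(1) r2(1)] by blast
qed

text \<open>Continuity on the embedded bundle is reduced to convergence in the tangent bundle along
  filters. A hypothesis cannot be polymorphic, so the filter type is fixed to that of the
  neighbourhood filters met in the proof.\<close>

lemma continuous_on_bundle:
  fixes h :: "real \<Rightarrow> 'm \<times> 'e \<times> 'e \<Rightarrow> 'b::topological_space"
  assumes h: "\<And>(G :: (real \<times> (nat \<Rightarrow> real \<times> 'e) \<times> (nat \<Rightarrow> 'e) \<times> (nat \<Rightarrow> 'e)) filter) tt xx uu vv t x u v.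
    (tt \<longlongrightarrow> t) G \<Longrightarrow> tconv xx uu x u G \<Longrightarrow> tconv xx vv x v G \<Longrightarrow> (x, u, v) \<in> Z \<Longrightarrow>
    ((\<lambda>j. h (tt j) (xx j, uu j, vv j)) \<longlongrightarrow> h t (x, u, v)) G"
  shows "continuous_on (UNIV \<times> emb ` Z) (\<lambda>(t, y). h t (dec y))"
  unfolding continuous_on_def
proof
  fix p assume p: "p \<in> (UNIV::real set) \<times> emb ` Z"
  let ?G = "at p within UNIV \<times> emb ` Z"
  obtain x u v where xuv: "dec (snd p) = (x, u, v)" by (cases "dec (snd p)")
  have pz: "(x, u, v) \<in> Z" "snd p = emb (x, u, v)"
    using dec_in[of "snd p"] emb_dec[of "snd p"] p xuv by auto
  define xx uu vv where "xx q = fst (dec (snd q))" and "uu q = fst (snd (dec (snd q)))"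
    and "vv q = snd (snd (dec (snd q)))" for q :: "real \<times> (nat \<Rightarrow> real \<times> 'e) \<times> (nat \<Rightarrow> 'e) \<times> (nat \<Rightarrow> 'e)"
  have ev: "\<forall>\<^sub>F q in ?G. snd q \<in> emb ` Z" 
    unfolding eventually_at_filter by (rule always_eventually) auto
  then have ev\<Lambda>: "\<forall>\<^sub>F q in ?G. xx q \<in> \<Lambda>"
    by eventually_elim (use dec_in in \<open>force simp: xx_def Z_def\<close>)
  have id: "((\<lambda>q. q) \<longlongrightarrow> p) ?G" by (rule tendsto_ident_at)
  have "(snd \<longlongrightarrow> emb (x, u, v)) ?G" using tendsto_snd[OF id] pz by simp
  moreover have "\<forall>\<^sub>F q in ?G. snd q = emb (xx q, uu q, vv q)"
    using ev by eventually_elim (simp add: xx_def uu_def vv_def emb_dec)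
  ultimately have e: "((\<lambda>q. emb (xx q, uu q, vv q)) \<longlongrightarrow> emb (x, u, v)) ?G"
    by (simp add: tendsto_cong)
  have x: "x \<in> \<Lambda>" using pz by (simp add: Z_def)
  have "((\<lambda>q. base_emb (xx q)) \<longlongrightarrow> base_emb x) ?G"
    "((\<lambda>q. vec_emb (xx q) (uu q)) \<longlongrightarrow> vec_emb x u) ?G"
    "((\<lambda>q. vec_emb (xx q) (vv q)) \<longlongrightarrow> vec_emb x v) ?G"
    using tendsto_fst[OF e] tendsto_fst[OF tendsto_snd[OF e]] tendsto_snd[OF tendsto_snd[OF e]]
    unfolding emb_def by simp_all
  then have "tconv xx uu x u ?G" "tconv xx vv x v ?G" by (simp_all only: tconv_of_emb[OF ev\<Lambda> x])
  from h[OF tendsto_fst[OF id] this pz(1)]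
  have "((\<lambda>q. h (fst q) (dec (snd q))) \<longlongrightarrow> h (fst p) (dec (snd p))) ?G"
    by (simp add: xx_def uu_def vv_def xuv)
  then show "((\<lambda>(t, y). h t (dec y)) \<longlongrightarrow> (case p of (t, y) \<Rightarrow> h t (dec y))) ?G"
    by (simp only: case_prod_unfold)
qed

section \<open>The normalised derivative flow\<close>

definition growth :: "real \<Rightarrow> 'm \<Rightarrow> 'e \<Rightarrow> real" where
  "growth t x u = tnorm g (\<phi> t x) (D\<phi> t x u)"

definition unit :: "'m \<Rightarrow> 'e \<Rightarrow> 'e" where
  "unit x u = u /\<^sub>R tnorm g x u"

lemma tnorm_unit: "u \<noteq> 0 \<Longrightarrow> tnorm g x (unit x u) = 1"
  using tnorm_pos[of u x] by (simp add: unit_def tnorm_scale)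

lemma tnorm_zero [simp]: "tnorm g x 0 = 0"
  using tnorm_scale[of x 0 0] by simp

lemma mderiv_nonzero:
  assumes "x \<in> \<Lambda>" "u \<noteq> 0"
  shows "D\<phi> t x u \<noteq> 0"
proof
  assume "D\<phi> t x u = 0"
  then have "D\<phi> (- t) (\<phi> t x) 0 = u" using mderiv_uminus[OF assms(1), of t u] by simp
  then show False using linear_0[OF mderiv_linear[OF flow_in[OF assms(1)]]] assms(2) by simp
qed

lemma growth_pos: "x \<in> \<Lambda> \<Longrightarrow> u \<noteq> 0 \<Longrightarrow> growth t x u > 0"
  unfolding growth_def by (intro tnorm_pos mderiv_nonzero)

lemma growth_0: "x \<in> \<Lambda> \<Longrightarrow> growth 0 x u = tnorm g x u"
  by (simp add: growth_def)

text \<open>Once the intermediate vector is normalised, growth is multiplicative in time; this is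
  the additive cocycle law for its logarithm.\<close>

lemma growth_add:
  assumes x: "x \<in> \<Lambda>" and u: "u \<noteq> 0"
  shows "growth (s + t) x u = growth s (\<phi> t x) (unit (\<phi> t x) (D\<phi> t x u)) * growth t x u"
  using growth_pos[OF x u, of t] linear_scale[OF mderiv_linear[OF flow_in[OF x, of t], of s]]
  by (simp add: growth_def unit_def tnorm_scale mderiv_add[OF x] flow_add[OF x])

lemma growth_unit:
  assumes x: "x \<in> \<Lambda>" and u: "u \<noteq> 0"
  shows "growth t x (unit x u) = growth t x u / tnorm g x u"
  using linear_scale[OF mderiv_linear[OF x]] tnorm_pos[OF u, of x]
  by (simp add: growth_def unit_def tnorm_scale divide_inverse mult.commute)

lemma unit_mderiv_add:
  assumes x: "x \<in> \<Lambda>" and u: "u \<noteq> 0"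
  shows "unit (\<phi> (s + t) x) (D\<phi> (s + t) x u)
    = unit (\<phi> s (\<phi> t x)) (D\<phi> s (\<phi> t x) (unit (\<phi> t x) (D\<phi> t x u)))"
proof -
  define r where "r = tnorm g (\<phi> t x) (D\<phi> t x u)"
  have "r > 0" unfolding r_def by (intro tnorm_pos mderiv_nonzero x u)
  then show ?thesis
    using linear_scale[OF mderiv_linear[OF flow_in[OF x, of t], of s]]
    by (simp add: unit_def tnorm_scale mderiv_add[OF x] flow_add[OF x] r_def[symmetric])
qed

lemma flow_inverse: "x \<in> \<Lambda> \<Longrightarrow> \<phi> (- t) (\<phi> t x) = x" "x \<in> \<Lambda> \<Longrightarrow> \<phi> t (\<phi> (- t) x) = x"
  using flow_add[of x "- t" t] flow_add[of x t "- t"] by simp_all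

lemma G_subspace: "G \<in> {E, F} \<Longrightarrow> x \<in> \<Lambda> \<Longrightarrow> subspace (G x)"
  and G_invariant: "G \<in> {E, F} \<Longrightarrow> x \<in> \<Lambda> \<Longrightarrow> u \<in> G x \<Longrightarrow> D\<phi> t x u \<in> G (\<phi> t x)"
  using subspace_E subspace_F E_inv F_inv by blast+

lemma unit_in_G:
  assumes "G \<in> {E, F}" "x \<in> \<Lambda>" "u \<in> G x" "tnorm g x u = 1"
  shows "unit (\<phi> t x) (D\<phi> t x u) \<in> G (\<phi> t x)"
    and "tnorm g (\<phi> t x) (unit (\<phi> t x) (D\<phi> t x u)) = 1"
proof -
  show "unit (\<phi> t x) (D\<phi> t x u) \<in> G (\<phi> t x)"
    unfolding unit_def
    by (intro subspace_scale G_subspace G_invariant flow_in assms)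
  have "u \<noteq> 0" using assms by auto
  then show "tnorm g (\<phi> t x) (unit (\<phi> t x) (D\<phi> t x u)) = 1"
    by (intro tnorm_unit mderiv_nonzero assms)
qed

lemma unit_exists:
  assumes "G \<in> {E, F}" "x \<in> \<Lambda>"
  obtains u where "u \<in> G x" "tnorm g x u = 1"
proof -
  have "0 \<in> G x" using G_subspace[OF assms] by (rule subspace_0)
  moreover have "G x \<noteq> {0}" using assms E_ne F_ne by blast
  ultimately obtain u where u: "u \<in> G x" "u \<noteq> 0" by blast
  have "unit x u \<in> G x" unfolding unit_def by (intro subspace_scale G_subspace assms u)
  then show ?thesis using that tnorm_unit[OF u(2)] by blast
qed

definition push :: "real \<Rightarrow> 'm \<times> 'e \<times> 'e \<Rightarrow> 'm \<times> 'e \<times> 'e" where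
  "push t = (\<lambda>(x, u, v). (\<phi> t x, unit (\<phi> t x) (D\<phi> t x u), unit (\<phi> t x) (D\<phi> t x v)))"

lemma push_in: "z \<in> Z \<Longrightarrow> push t z \<in> Z"
  using unit_in_G[of E] unit_in_G[of F] flow_in by (auto simp: Z_def push_def)

lemma Z_nonzero: "(x, u, v) \<in> Z \<Longrightarrow> u \<noteq> 0" "(x, u, v) \<in> Z \<Longrightarrow> v \<noteq> 0"
  by (auto simp: Z_def)

lemma push_add:
  assumes z: "z \<in> Z"
  shows "push (s + t) z = push s (push t z)"
proof -
  obtain x u v where zz: "z = (x, u, v)" by (cases z)
  have "x \<in> \<Lambda>" "u \<noteq> 0" "v \<noteq> 0" using z Z_nonzero by (auto simp: zz Z_def)
  then show ?thesis
    using flow_add[of x s t] unit_mderiv_add[of x u s t] unit_mderiv_add[of x v s t]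
    by (simp add: zz push_def)
qed

lemma push_0: "z \<in> Z \<Longrightarrow> push 0 z = z"
  by (auto simp: Z_def push_def unit_def)

lemma tconv_unit_push:
  assumes tt: "(tt \<longlongrightarrow> t) G" and conv: "tconv xx uu x u G" and u: "u \<noteq> 0"
  shows "tconv (\<lambda>j. \<phi> (tt j) (xx j)) (\<lambda>j. unit (\<phi> (tt j) (xx j)) (D\<phi> (tt j) (xx j) (uu j)))
    (\<phi> t x) (unit (\<phi> t x) (D\<phi> t x u)) G"
proof -
  have x: "x \<in> \<Lambda>" using conv by (simp add: tconv_def)
  have "tnorm g (\<phi> t x) (D\<phi> t x u) \<noteq> 0" using growth_pos[OF x u, of t] by (simp add: growth_def)
  then show ?thesis unfolding unit_def
    by (intro tconv_scale tendsto_inverse tconv_tnorm tconv_flow tt conv)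
qed

abbreviation bundle_flow where "bundle_flow t y \<equiv> emb (push t (dec y))"

sublocale compact_flow "emb ` Z" bundle_flow
proof
  show "compact (emb ` Z)" by (rule compact_bundle)
  show "continuous_on (UNIV \<times> emb ` Z) (\<lambda>(t, y). emb (push t (dec y)))"
  proof (rule continuous_on_bundle[where h="\<lambda>t z. emb (push t z)"])
    fix G :: "(real \<times> (nat \<Rightarrow> real \<times> 'e) \<times> (nat \<Rightarrow> 'e) \<times> (nat \<Rightarrow> 'e)) filter" 
      and tt :: "real \<times> (nat \<Rightarrow> real \<times> 'e) \<times> (nat \<Rightarrow> 'e) \<times> (nat \<Rightarrow> 'e) \<Rightarrow> real"
      and xx uu vv t x u v
    assume *: "(tt \<longlongrightarrow> t) G" "tconv xx uu x u G" "tconv xx vv x v G" "(x, u, v) \<in> Z"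
    note c = tconv_unit_push[OF *(1,2) Z_nonzero(1)[OF *(4)]] tconv_unit_push[OF *(1,3) Z_nonzero(2)[OF *(4)]]
    have "((\<lambda>j. \<phi> (tt j) (xx j)) \<longlongrightarrow> \<phi> t x) G" using c(1) by (simp add: tconv_def)
    then show "((\<lambda>j. emb (push (tt j) (xx j, uu j, vv j))) \<longlongrightarrow> emb (push t (x, u, v))) G"
      unfolding emb_def push_def prod.case
      by (intro tendsto_Pair base_emb_tendsto vec_emb_tendsto c)
  qed
  fix z s t assume z: "z \<in> emb ` Z"
  note dz = dec_in[OF z]
  show "bundle_flow t z \<in> emb ` Z" using push_in[OF dz] by (rule imageI)
  show "bundle_flow 0 z = z" using push_0[OF dz] emb_dec[OF z] by simp
  show "bundle_flow (s + t) z = bundle_flow s (bundle_flow t z)"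
    using push_add[OF dz] dec_emb[OF push_in[OF dz]] by simp
qed

section \<open>Logarithmic growth and projected measures\<close>

definition logE :: "real \<Rightarrow> _ \<Rightarrow> real" where
  "logE t y = ln (growth t (fst (dec y)) (fst (snd (dec y))))"

definition logF :: "real \<Rightarrow> _ \<Rightarrow> real" where
  "logF t y = ln (growth t (fst (dec y)) (snd (snd (dec y))))"

lemma ln_growth_tendsto:
  assumes "(tt \<longlongrightarrow> t) G" "tconv xx uu x u G" "u \<noteq> 0"
  shows "((\<lambda>j. ln (growth (tt j) (xx j) (uu j))) \<longlongrightarrow> ln (growth t x u)) G"
proof (rule tendsto_ln)
  have "x \<in> \<Lambda>" using assms(2) by (simp add: tconv_def)
  then show "growth t x u \<noteq> 0" using growth_pos[of x u t] assms(3) by simp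
  show "((\<lambda>j. growth (tt j) (xx j) (uu j)) \<longlongrightarrow> growth t x u) G"
    unfolding growth_def by (intro tconv_tnorm tconv_flow assms)
qed

text \<open>\<open>sel\<close> chooses the component \<open>u\<close> or \<open>v\<close>, so one
  argument serves both bundles.\<close>

lemma cocycle_ln_growth:
  fixes sel :: "'e \<times> 'e \<Rightarrow> 'e"
  assumes sel: "sel = fst \<or> sel = snd"
  shows "cocycle (\<lambda>t y. ln (growth t (fst (dec y)) (sel (snd (dec y)))))"
  unfolding cocycle_def
proof (intro conjI ballI allI)
  show "continuous_on (UNIV \<times> emb ` Z) (\<lambda>(t, y). ln (growth t (fst (dec y)) (sel (snd (dec y)))))"
    by (rule continuous_on_bundle[where h="\<lambda>t z. ln (growth t (fst z) (sel (snd z)))"])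
       (use sel in \<open>auto intro!: ln_growth_tendsto dest: Z_nonzero\<close>)
  fix y s t assume y: "y \<in> emb ` Z"
  obtain x u v where d: "dec y = (x, u, v)" by (cases "dec y")
  have xuv: "(x, u, v) \<in> Z" using dec_in[OF y] d by simp
  have x: "x \<in> \<Lambda>" using xuv by (simp add: Z_def)
  define w where "w = sel (u, v)"
  have w: "w \<noteq> 0" using sel Z_nonzero[OF xuv] by (auto simp: w_def)
  have push: "sel (snd (push t (x, u, v))) = unit (\<phi> t x) (D\<phi> t x w)"
    using sel by (auto simp: push_def w_def)
  have "growth (s + t) x w > 0" "growth t x w > 0" using growth_pos[OF x w] by auto
  then have "ln (growth (s + t) x w) = ln (growth s (\<phi> t x) (unit (\<phi> t x) (D\<phi> t x w))) + ln (growth t x w)"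
    using growth_add[OF x w, of s t] by (simp add: ln_mult zero_less_mult_iff)
  moreover have "fst (push t (x, u, v)) = \<phi> t x" by (simp add: push_def)
  ultimately show "ln (growth (s + t) (fst (dec y)) (sel (snd (dec y)))) =
      ln (growth s (fst (dec (bundle_flow t y))) (sel (snd (dec (bundle_flow t y))))) +
      ln (growth t (fst (dec y)) (sel (snd (dec y))))"
    using dec_emb[OF push_in[OF xuv]] push by (simp add: d w_def)
qed

lemma cocycle_logE: "cocycle logE" and cocycle_logF: "cocycle logF"
  using cocycle_ln_growth[of fst] cocycle_ln_growth[of snd]
  by (simp_all add: logE_def[abs_def] logF_def[abs_def])

lemma logE_emb: "(x, u, v) \<in> Z \<Longrightarrow> logE t (emb (x, u, v)) = ln (growth t x u)"
  and logF_emb: "(x, u, v) \<in> Z \<Longrightarrow> logF t (emb (x, u, v)) = ln (growth t x v)"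
  by (simp_all add: logE_def logF_def dec_emb)

lemma cont_flow: "continuous_on \<Lambda> (\<phi> t)"
  unfolding continuous_on_def
  by (intro ballI flow_tendsto tendsto_const tendsto_ident_at in_D)

text \<open>The projection to the base point is continuous and intertwines the bundle flow with
  \<open>\<phi>\<close>, so it carries invariant measures to invariant measures.\<close>

lemma projected_measure_invariant:
  assumes \<nu>: "flow_invariant \<nu>"
  shows "(\<lambda>y. fst (dec y)) \<in> \<nu> \<rightarrow>\<^sub>M restrict_space borel \<Lambda>"
    and "invariant_prob \<phi> \<Lambda> (distr \<nu> (restrict_space borel \<Lambda>) (\<lambda>y. fst (dec y)))"
proof -
  let ?\<pi> = "\<lambda>y. fst (dec y)" and ?B = "restrict_space borel \<Lambda>"
  have sets: "sets \<nu> = sets (restrict_space borel (emb ` Z))" and "prob_space \<nu>"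
    and inv: "\<And>t. bundle_flow t \<in> \<nu> \<rightarrow>\<^sub>M \<nu>" "\<And>t. distr \<nu> \<nu> (bundle_flow t) = \<nu>"
    using \<nu> by (auto simp: flow_invariant_def)
  interpret prob_space \<nu> by fact
  have sp: "space \<nu> = emb ` Z" using sets_eq_imp_space_eq[OF sets] by (simp add: space_restrict_space)
  have \<pi>_in: "?\<pi> y \<in> \<Lambda>" if "y \<in> emb ` Z" for y using dec_in[OF that] by (auto simp: Z_def)
  \<comment> \<open>\<open>continuous_on_bundle\<close> concerns time-dependent functions; the
    projection is treated as one that does not vary with time and is evaluated at time 0.\<close>
  have "continuous_on (UNIV \<times> emb ` Z) (\<lambda>(t::real, y). fst (dec y))"
    by (rule continuous_on_bundle[where h="\<lambda>t z. fst z"]) (simp add: tconv_def)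
  moreover have "continuous_on (emb ` Z) (\<lambda>y. (0::real, y))" by (intro continuous_intros)
  ultimately have "continuous_on (emb ` Z) (\<lambda>y. case (0::real, y) of (t, y) \<Rightarrow> fst (dec y))"
    by (rule continuous_on_compose2) auto
  then have "continuous_on (emb ` Z) ?\<pi>" by simp
  then have "?\<pi> \<in> restrict_space borel (emb ` Z) \<rightarrow>\<^sub>M ?B"
    by (intro measurable_restrict_space2 borel_measurable_continuous_on_restrict)
       (use \<pi>_in in \<open>auto simp: space_restrict_space\<close>)
  then show meas: "?\<pi> \<in> \<nu> \<rightarrow>\<^sub>M ?B" using measurable_cong_sets[OF sets refl] by blast
  have \<phi>_meas: "\<phi> t \<in> ?B \<rightarrow>\<^sub>M ?B" for t
    by (intro measurable_restrict_space2 borel_measurable_continuous_on_restrict cont_flow)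
       (use flow_in in \<open>auto simp: space_restrict_space\<close>)
  show "invariant_prob \<phi> \<Lambda> (distr \<nu> ?B ?\<pi>)"
    unfolding invariant_prob_def
  proof (intro conjI allI ballI)
    show "prob_space (distr \<nu> ?B ?\<pi>)" by (rule prob_space_distr[OF meas])
    show "space (distr \<nu> ?B ?\<pi>) = \<Lambda>" by (simp add: space_restrict_space)
    show "sets (distr \<nu> ?B ?\<pi>) = sets ?B" by simp
    fix t U assume "U \<in> sets (distr \<nu> ?B ?\<pi>)"
    then have U: "U \<in> sets ?B" by simp
    have U': "\<phi> t -` U \<inter> \<Lambda> \<in> sets ?B"
      using measurable_sets[OF \<phi>_meas U] by (simp add: space_restrict_space)
    have \<pi>U: "?\<pi> -` U \<inter> space \<nu> \<in> sets \<nu>" by (rule measurable_sets[OF meas U])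
    have "?\<pi> -` (\<phi> t -` U \<inter> \<Lambda>) \<inter> space \<nu> = bundle_flow t -` (?\<pi> -` U \<inter> space \<nu>) \<inter> space \<nu>"
    proof -
      have \<pi>\<phi>: "?\<pi> (bundle_flow t y) = \<phi> t (?\<pi> y)" if "y \<in> emb ` Z" for y
        using dec_emb[OF push_in[OF dec_in[OF that]]] by (simp add: push_def case_prod_beta)
      show ?thesis
      proof (rule set_eqI)
        fix y
        show "y \<in> ?\<pi> -` (\<phi> t -` U \<inter> \<Lambda>) \<inter> space \<nu> \<longleftrightarrow>
            y \<in> bundle_flow t -` (?\<pi> -` U \<inter> space \<nu>) \<inter> space \<nu>"
        proof (cases "y \<in> emb ` Z")
          case True
          show ?thesis
            unfolding Int_iff vimage_eq sp \<pi>\<phi>[OF True] using True \<pi>_in[OF True] maps[OF True] by blast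
        qed (simp add: sp)
      qed
    qed
    then have "emeasure \<nu> (?\<pi> -` (\<phi> t -` U \<inter> \<Lambda>) \<inter> space \<nu>) = emeasure (distr \<nu> \<nu> (bundle_flow t)) (?\<pi> -` U \<inter> space \<nu>)"
      by (simp add: emeasure_distr[OF inv(1) \<pi>U])
    then show "emeasure (distr \<nu> ?B ?\<pi>) (\<phi> t -` U \<inter> \<Lambda>) = emeasure (distr \<nu> ?B ?\<pi>) U"
      by (simp add: emeasure_distr[OF meas U] emeasure_distr[OF meas U'] inv(2))
  qed
qed

text \<open>The measure offered by the second alternative of the dichotomy projects to an invariant
  probability on \<Lambda>, so almost all of its points lie over \<open>Y\<close>, where averages in
  the forbidden order are excluded.\<close>

lemma decay_of_total_probability:
  assumes a: "cocycle a" and b: "cocycle b" and Y: "total_probability \<phi> \<Lambda> Y"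
    and no: "\<And>z l m. z \<in> Z \<Longrightarrow> fst z \<in> Y \<Longrightarrow> ((\<lambda>t. a t (emb z) / t) \<longlongrightarrow> l) at_top \<Longrightarrow>
      ((\<lambda>t. b t (emb z) / t) \<longlongrightarrow> m) at_top \<Longrightarrow> m \<le> l \<Longrightarrow> False"
  shows "\<exists>K. \<exists>\<delta>>0. \<forall>z\<in>Z. \<forall>t\<ge>0. a t (emb z) - b t (emb z) \<le> K - \<delta> * t"
proof (rule ccontr)
  assume "\<not> ?thesis"
  then have "\<not> (\<exists>K. \<exists>\<delta>>0. \<forall>z\<in>emb ` Z. \<forall>t\<ge>0. a t z - b t z \<le> K - \<delta> * t)" by blast
  then obtain \<nu> where \<nu>: "flow_invariant \<nu>" and pos: "\<not> (AE z in \<nu>. \<not> ordered_averages a b z)"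
    using cocycle_decay_or_invariant_measure[OF a b] by blast
  let ?\<pi> = "\<lambda>y. fst (dec y)" and ?B = "restrict_space borel \<Lambda>"
  note meas = projected_measure_invariant(1)[OF \<nu>]
  have sets: "sets \<nu> = sets (restrict_space borel (emb ` Z))" and "prob_space \<nu>"
    using \<nu> by (auto simp: flow_invariant_def)
  interpret prob_space \<nu> by fact
  have sp: "space \<nu> = emb ` Z" using sets_eq_imp_space_eq[OF sets] by (simp add: space_restrict_space)
  have 1: "emeasure (distr \<nu> ?B ?\<pi>) Y = 1"
    using Y projected_measure_invariant(2)[OF \<nu>] by (simp add: total_probability_def)
  \<comment> \<open>A set of \<open>emeasure\<close> 1 is measurable, as nonmeasurable sets have
    \<open>emeasure\<close> 0.\<close>
  then have YB: "Y \<in> sets ?B" using emeasure_notin_sets[of Y "distr \<nu> ?B ?\<pi>"] by fastforce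
  have "emeasure \<nu> (?\<pi> -` Y \<inter> space \<nu>) = 1" using 1 emeasure_distr[OF meas YB] by simp
  then have "prob (?\<pi> -` Y \<inter> space \<nu>) = 1" by (simp add: emeasure_eq_measure)
  then have "AE y in \<nu>. y \<in> ?\<pi> -` Y \<inter> space \<nu>"
    using measurable_sets[OF meas YB] by (subst prob_eq_1[symmetric]) auto
  then have "AE z in \<nu>. \<not> ordered_averages a b z"
  proof eventually_elim
    fix y assume y: "y \<in> ?\<pi> -` Y \<inter> space \<nu>"
    then have yZ: "y \<in> emb ` Z" using sp by simp
    show "\<not> ordered_averages a b y"
      using no[OF dec_in[OF yZ]] y emb_dec[OF yZ] by auto
  qed
  then show False using pos by blast
qed

lemma E_mem: "E \<in> {E, F}" and F_mem: "F \<in> {E, F}"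
  by simp_all

text \<open>Both bundles being nonzero at \<open>x\<close>, a unit vector of one is completed by a
  unit vector of the other to a point of \<open>Z\<close>.\<close>

lemma ln_growth_le:
  assumes G: "G \<in> {E, F}" and x: "x \<in> \<Lambda>" and u: "u \<in> G x" "tnorm g x u = 1"
    and le: "\<And>y. y \<in> emb ` Z \<Longrightarrow> \<bar>logE t y\<bar> \<le> B \<and> \<bar>logF t y\<bar> \<le> B"
  shows "\<bar>ln (growth t x u)\<bar> \<le> B"
proof (cases "G = E")
  case True
  obtain v where "v \<in> F x" "tnorm g x v = 1" using unit_exists[OF F_mem x] by blast
  then have z: "(x, u, v) \<in> Z" using x u True by (simp add: Z_def)
  then show ?thesis using le[OF imageI[OF z]] by (simp add: logE_emb)
next
  case False
  obtain v where "v \<in> E x" "tnorm g x v = 1" using unit_exists[OF E_mem x] by blast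
  then have z: "(x, v, u) \<in> Z" using x u False G by (simp add: Z_def)
  then show ?thesis using le[OF imageI[OF z]] by (simp add: logF_emb)
qed

lemma ln_growth_bounded:
  assumes G: "G \<in> {E, F}"
  shows "\<exists>B. \<forall>x\<in>\<Lambda>. \<forall>u\<in>G x. tnorm g x u = 1 \<longrightarrow> \<bar>ln (growth t x u)\<bar> \<le> B"
proof -
  have bd: "\<exists>B. \<forall>y\<in>emb ` Z. \<bar>a t y\<bar> \<le> B" if "cocycle a" for a
    using compact_imp_bounded[OF compact_continuous_image[OF cocycle_cont[OF that, of t] compact_bundle]]
    by (auto simp: bounded_iff)
  obtain B1 B2 where B: "\<And>y. y \<in> emb ` Z \<Longrightarrow> \<bar>logE t y\<bar> \<le> B1" "\<And>y. y \<in> emb ` Z \<Longrightarrow> \<bar>logF t y\<bar> \<le> B2"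
    using bd[OF cocycle_logE] bd[OF cocycle_logF] by blast
  have le: "\<bar>logE t y\<bar> \<le> max B1 B2 \<and> \<bar>logF t y\<bar> \<le> max B1 B2" if "y \<in> emb ` Z" for y
    using B[OF that] by linarith
  show ?thesis by (intro exI[of _ "max B1 B2"] ballI impI ln_growth_le[OF G _ _ _ le])
qed

text \<open>Time splits into unit steps, each contributing at most \<open>C\<close>, and a
  remainder. This keeps the exponential rates of growth bounded uniformly in the vector.\<close>

lemma cocycle_linear_bound:
  assumes a: "cocycle a"
  shows "\<exists>C>0. \<forall>y\<in>emb ` Z. \<forall>t\<ge>0. \<bar>a t y\<bar> \<le> C + C * t"
proof -
  obtain C where C: "C > 0" "\<And>s y. 0 \<le> s \<Longrightarrow> s \<le> 1 \<Longrightarrow> y \<in> emb ` Z \<Longrightarrow> \<bar>a s y\<bar> \<le> C"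
    using cocycle_bounded[OF a] by blast
  have "\<bar>a t y\<bar> \<le> C + C * t" if y: "y \<in> emb ` Z" and t: "t \<ge> 0" for y t
  proof -
    define k where "k = nat \<lfloor>t\<rfloor>"
    have k: "real k \<le> t" "t < real k + 1" using t by (auto simp: k_def)
    have "a t y = a (t - real k) (bundle_flow (real k) y) + a (real k * 1) y"
      using cocycle_add[OF a y, of "t - real k" "real k"] by simp
    moreover have "\<bar>a (t - real k) (bundle_flow (real k) y)\<bar> \<le> C" by (rule C(2)) (use k maps[OF y] in auto)
    moreover have "\<bar>a (real k * 1) y\<bar> \<le> (\<Sum>j<k. C)"
      unfolding cocycle_multiple[OF a y]
      by (intro order_trans[OF sum_abs] sum_mono C(2) maps[OF y]) auto
    moreover have "real k * C \<le> t * C" using k C by (intro mult_right_mono) auto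
    ultimately show ?thesis by (simp add: algebra_simps)
  qed
  then show ?thesis using C(1) by blast
qed

lemma ln_growth_linear_bound:
  assumes G: "G \<in> {E, F}"
  obtains B where "B > 0"
    "\<And>x u t. x \<in> \<Lambda> \<Longrightarrow> u \<in> G x \<Longrightarrow> tnorm g x u = 1 \<Longrightarrow> t \<ge> 0 \<Longrightarrow> \<bar>ln (growth t x u)\<bar> \<le> B + B * t"
proof -
  obtain C1 where C1: "C1 > 0" "\<forall>y\<in>emb ` Z. \<forall>t\<ge>0. \<bar>logE t y\<bar> \<le> C1 + C1 * t"
    using cocycle_linear_bound[OF cocycle_logE] by blast
  obtain C2 where C2: "C2 > 0" "\<forall>y\<in>emb ` Z. \<forall>t\<ge>0. \<bar>logF t y\<bar> \<le> C2 + C2 * t"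
    using cocycle_linear_bound[OF cocycle_logF] by blast
  define B where "B = max C1 C2"
  have le: "\<bar>logE t y\<bar> \<le> B + B * t \<and> \<bar>logF t y\<bar> \<le> B + B * t" if y: "y \<in> emb ` Z" and t: "t \<ge> 0" for y t
  proof -
    have "C1 * t \<le> B * t" "C2 * t \<le> B * t" using t by (auto simp: B_def intro!: mult_right_mono)
    moreover have "C1 \<le> B" "C2 \<le> B" by (simp_all add: B_def)
    moreover have "\<bar>logE t y\<bar> \<le> C1 + C1 * t" "\<bar>logF t y\<bar> \<le> C2 + C2 * t" using C1(2) C2(2) y t by blast+
    ultimately show ?thesis by linarith
  qed
  show ?thesis
  proof (rule that)
    show "B > 0" using C1(1) by (simp add: B_def)
    show "\<bar>ln (growth t x u)\<bar> \<le> B + B * t" if "x \<in> \<Lambda>" "u \<in> G x" "tnorm g x u = 1" "t \<ge> 0" for x u t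
      by (rule ln_growth_le[OF G that(1-3)]) (use le that(4) in blast)
  qed
qed

lemma unit_growth_pos: "x \<in> \<Lambda> \<Longrightarrow> tnorm g x u = 1 \<Longrightarrow> growth t x u > 0"
  by (rule growth_pos) auto

section \<open>Norms and co-norms on the two subbundles\<close>

abbreviation fnorm where "fnorm \<equiv> flow_norm A g \<phi>"
abbreviation conorm where "conorm \<equiv> flow_conorm A g \<phi>"
abbreviation exponents where "exponents \<equiv> lyapunov_exponents A g \<phi>"

lemma flow_norm_eq: "fnorm G t x = (SUP u\<in>{u \<in> G x. tnorm g x u = 1}. growth t x u)"
  and flow_conorm_eq: "conorm G t x = (INF u\<in>{u \<in> G x. tnorm g x u = 1}. growth t x u)"
  by (simp_all add: flow_norm_def flow_conorm_def growth_def)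

text \<open>A real supremum is an upper bound only for a bounded set; compactness of the bundle
  bounds the growth at the fixed time \<open>t\<close>.\<close>

lemma growth_le_flow_norm:
  assumes G: "G \<in> {E, F}" and x: "x \<in> \<Lambda>" and u: "u \<in> G x" "tnorm g x u = 1"
  shows "growth t x u \<le> fnorm G t x"
proof -
  obtain B where B: "\<forall>x\<in>\<Lambda>. \<forall>u\<in>G x. tnorm g x u = 1 \<longrightarrow> \<bar>ln (growth t x u)\<bar> \<le> B"
    using ln_growth_bounded[OF G] by blast
  have "growth t x u \<le> exp B" if "u \<in> G x" "tnorm g x u = 1" for u
  proof -
    have "ln (growth t x u) \<le> B" using B x that by (meson abs_le_D1)
    then show ?thesis using unit_growth_pos[OF x that(2), of t] by (metis exp_le_cancel_iff exp_ln)
  qed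
  then have "bdd_above (growth t x ` {u \<in> G x. tnorm g x u = 1})" by (intro bdd_aboveI2) auto
  then show ?thesis unfolding flow_norm_eq using u by (intro cSUP_upper) auto
qed

lemma flow_norm_le:
  assumes G: "G \<in> {E, F}" and x: "x \<in> \<Lambda>"
    and B: "\<And>u. u \<in> G x \<Longrightarrow> tnorm g x u = 1 \<Longrightarrow> growth t x u \<le> B"
  shows "fnorm G t x \<le> B"
proof -
  obtain u where "u \<in> G x" "tnorm g x u = 1" using unit_exists[OF G x] .
  then show ?thesis unfolding flow_norm_eq using B by (intro cSUP_least) auto
qed

lemma flow_norm_pos:
  assumes G: "G \<in> {E, F}" and x: "x \<in> \<Lambda>"
  shows "fnorm G t x > 0"
proof -
  obtain u where u: "u \<in> G x" "tnorm g x u = 1" using unit_exists[OF G x] .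
  then show ?thesis using growth_le_flow_norm[OF G x u, of t] unit_growth_pos[OF x u(2), of t] by linarith
qed

lemma flow_conorm_le_growth:
  assumes x: "x \<in> \<Lambda>" and u: "u \<in> G x" "tnorm g x u = 1"
  shows "conorm G t x \<le> growth t x u"
proof -
  have "0 \<le> growth t x v" if "tnorm g x v = 1" for v using unit_growth_pos[OF x that, of t] by simp
  then have "bdd_below (growth t x ` {u \<in> G x. tnorm g x u = 1})" by (intro bdd_belowI2[of _ 0]) auto
  then show ?thesis unfolding flow_conorm_eq using u by (intro cINF_lower) auto
qed

lemma flow_conorm_ge:
  assumes G: "G \<in> {E, F}" and x: "x \<in> \<Lambda>"
    and B: "\<And>u. u \<in> G x \<Longrightarrow> tnorm g x u = 1 \<Longrightarrow> B \<le> growth t x u"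
  shows "B \<le> conorm G t x"
proof -
  obtain u where "u \<in> G x" "tnorm g x u = 1" using unit_exists[OF G x] .
  then show ?thesis unfolding flow_conorm_eq using B by (intro cINF_greatest) auto
qed

text \<open>An infimum of positive growths could vanish; the linear bound on their logarithms,
  uniform in the vector, keeps the co-norm positive and its rate bounded.\<close>

lemma flow_conorm_exp_bounds:
  assumes x: "x \<in> \<Lambda>"
  obtains B where "B > 0"
    "\<And>t. t > 0 \<Longrightarrow> exp (- (B + B * t)) \<le> conorm F t x \<and> conorm F t x \<le> exp (B + B * t)"
proof -
  obtain B where B: "B > 0"
    "\<And>x u t. x \<in> \<Lambda> \<Longrightarrow> u \<in> F x \<Longrightarrow> tnorm g x u = 1 \<Longrightarrow> t \<ge> 0 \<Longrightarrow> \<bar>ln (growth t x u)\<bar> \<le> B + B * t"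
    by (rule ln_growth_linear_bound[OF F_mem]) (rule that)
  have le: "exp (- (B + B * t)) \<le> growth t x v \<and> growth t x v \<le> exp (B + B * t)"
    if v: "v \<in> F x" "tnorm g x v = 1" and t: "t > 0" for v t
  proof -
    have "- (B + B * t) \<le> ln (growth t x v)" "ln (growth t x v) \<le> B + B * t"
      using B(2)[OF x v, of t] t by linarith+
    then show ?thesis using unit_growth_pos[OF x v(2), of t] by (metis exp_le_cancel_iff exp_ln)
  qed
  obtain v where v: "v \<in> F x" "tnorm g x v = 1" using unit_exists[OF F_mem x] by blast
  show ?thesis
  proof (rule that[OF B(1)])
    fix t :: real assume t: "t > 0"
    have "exp (- (B + B * t)) \<le> conorm F t x"
      by (rule flow_conorm_ge[OF F_mem x]) (use le t in blast)
    moreover have "conorm F t x \<le> exp (B + B * t)"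
      using le[OF v t] flow_conorm_le_growth[of x v F t, OF x v] by linarith
    ultimately show "exp (- (B + B * t)) \<le> conorm F t x \<and> conorm F t x \<le> exp (B + B * t)" ..
  qed
qed

lemma flow_conorm_pos:
  assumes x: "x \<in> \<Lambda>" and t: "t > 0"
  shows "conorm F t x > 0"
proof -
  obtain C where "\<And>t. t > 0 \<Longrightarrow> exp (- (C + C * t)) \<le> conorm F t x \<and> conorm F t x \<le> exp (C + C * t)"
    by (rule flow_conorm_exp_bounds[OF x]) (rule that)
  from this[OF t] show ?thesis using exp_gt_zero[of "- (C + C * t)"] by linarith
qed

text \<open>For a linear isomorphism the norm of the inverse is the reciprocal of the co-norm; this
  is that fact for a single vector \<open>w\<close> and its normalised preimage.\<close>

lemma growth_backward:
  assumes G: "G \<in> {E, F}" and x: "x \<in> \<Lambda>" and w: "w \<in> G (\<phi> t x)" "tnorm g (\<phi> t x) w = 1"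
  obtains v where "v \<in> G x" "tnorm g x v = 1" "growth t x v * growth (- t) (\<phi> t x) w = 1"
proof -
  have fx: "\<phi> t x \<in> \<Lambda>" by (rule flow_in[OF x])
  define v where "v = unit x (D\<phi> (- t) (\<phi> t x) w)"
  have v: "v \<in> G x" "tnorm g x v = 1"
    using unit_in_G[OF G fx w, of "- t"] by (simp_all add: flow_inverse[OF x] v_def)
  have "w \<noteq> 0" using w by auto
  from growth_add[OF fx this, of t "- t"]
  have "growth t x v * growth (- t) (\<phi> t x) w = 1" using w growth_0[OF fx] by (simp add: flow_inverse[OF x] v_def)
  with v that show ?thesis by blast
qed

text \<open>The backward growth of the normalised image of \<open>v\<close> is reciprocal to the
  forward growth of \<open>v\<close> and is bounded by the backward norm. Over all \<open>v\<close>
  this bounds the co-norm from below by the reciprocal of the backward norm.\<close>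

lemma growth_forward:
  assumes G: "G \<in> {E, F}" and x: "x \<in> \<Lambda>" and v: "v \<in> G x" "tnorm g x v = 1"
  shows "1 \<le> growth t x v * fnorm G (- t) (\<phi> t x)"
proof -
  define w where "w = unit (\<phi> t x) (D\<phi> t x v)"
  have w: "w \<in> G (\<phi> t x)" "tnorm g (\<phi> t x) w = 1"
    using unit_in_G[OF G x v, of t] by (simp_all add: w_def)
  have "v \<noteq> 0" using v by auto
  from growth_add[OF x this, of "- t" t]
  have "growth (- t) (\<phi> t x) w * growth t x v = 1" using v growth_0[OF x] by (simp add: w_def)
  moreover have "growth (- t) (\<phi> t x) w \<le> fnorm G (- t) (\<phi> t x)"
    by (rule growth_le_flow_norm[OF G flow_in[OF x] w])
  ultimately show ?thesis
    using unit_growth_pos[OF x v(2), of t] by (metis mult.commute mult_le_cancel_right_pos)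
qed

section \<open>Exponents and growth rates against uniform estimates\<close>

lemma lyapunov_exponents_eq:
  "exponents G x = {l. \<exists>v\<in>G x - {0}. ((\<lambda>t. ln (growth t x v) / t) \<longlongrightarrow> l) at_top}"
  by (simp add: lyapunov_exponents_def growth_def)

text \<open>The norm on \<open>E\<close> dominates the growth along \<open>u\<close>, and the growth
  along \<open>v\<close> dominates the co-norm on \<open>F\<close>. So the liminf is at least
  \<open>l\<close>, the limsup at most \<open>m\<close>, and their difference is
  nonnegative.\<close>

lemma not_negative_growth_gap:
  assumes z: "(x, u, v) \<in> Z" and l: "((\<lambda>t. ln (growth t x u) / t) \<longlongrightarrow> l) at_top"
    and m: "((\<lambda>t. ln (growth t x v) / t) \<longlongrightarrow> m) at_top" and ml: "m \<le> l"
  shows "\<not> negative_growth_gap A g \<phi> E F x"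
proof -
  have x: "x \<in> \<Lambda>" and u: "u \<in> E x" "tnorm g x u = 1" and v: "v \<in> F x" "tnorm g x v = 1"
    using z by (simp_all add: Z_def)
  have "ereal l = Liminf at_top (\<lambda>t. ereal (ln (growth t x u) / t))"
    using l by (intro lim_imp_Liminf[symmetric]) auto
  also have "\<dots> \<le> Liminf at_top (\<lambda>t. ereal (1 / t * ln (fnorm E t x)))"
  proof (rule Liminf_mono)
    show "\<forall>\<^sub>F t in at_top. ereal (ln (growth t x u) / t) \<le> ereal (1 / t * ln (fnorm E t x))"
      using eventually_gt_at_top[of 0]
    proof eventually_elim
      fix t :: real assume "t > 0"
      then show "ereal (ln (growth t x u) / t) \<le> ereal (1 / t * ln (fnorm E t x))"
        using growth_le_flow_norm[of E x u t, OF E_mem x u] unit_growth_pos[OF x u(2), of t]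
        by (simp add: divide_right_mono)
    qed
  qed
  finally have 1: "ereal l \<le> Liminf at_top (\<lambda>t. ereal (1 / t * ln (fnorm E t x)))" .
  have "Limsup at_top (\<lambda>t. ereal (1 / t * ln (conorm F t x))) \<le>
      Limsup at_top (\<lambda>t. ereal (ln (growth t x v) / t))"
  proof (rule Limsup_mono)
    show "\<forall>\<^sub>F t in at_top. ereal (1 / t * ln (conorm F t x)) \<le> ereal (ln (growth t x v) / t)"
      using eventually_gt_at_top[of 0]
    proof eventually_elim
      fix t :: real assume t: "t > 0"
      show "ereal (1 / t * ln (conorm F t x)) \<le> ereal (ln (growth t x v) / t)"
        using flow_conorm_le_growth[of x v F t, OF x v] flow_conorm_pos[OF x t] t by (simp add: divide_right_mono)
    qed
  qed
  also have "\<dots> = ereal m" using m by (intro lim_imp_Limsup) auto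
  finally have 2: "Limsup at_top (\<lambda>t. ereal (1 / t * ln (conorm F t x))) \<le> ereal m" .
  have "0 \<le> ereal l - ereal m" using ml by simp
  also have "\<dots> \<le> Liminf at_top (\<lambda>t. ereal (1 / t * ln (fnorm E t x)))
      - Limsup at_top (\<lambda>t. ereal (1 / t * ln (conorm F t x)))"
    by (rule ereal_minus_mono[OF 1 2])
  finally show ?thesis by (simp add: negative_growth_gap_def not_less)
qed

text \<open>The decay bound holds for \<open>u\<close> and \<open>v\<close> chosen independently in
  one fibre. The supremum over \<open>u\<close> and then, through reciprocals, over backward vectors
  of \<open>F\<close> yields the product of the two norms.\<close>

lemma dominated_of_gap:
  assumes Y: "total_probability \<phi> \<Lambda> Y" and gap: "\<And>x. x \<in> Y \<Longrightarrow> negative_growth_gap A g \<phi> E F x"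
  shows "dominated_splitting A g \<phi> \<Lambda> E F"
proof -
  have "\<exists>K. \<exists>\<delta>>0. \<forall>z\<in>Z. \<forall>t\<ge>0. logE t (emb z) - logF t (emb z) \<le> K - \<delta> * t"
  proof (rule decay_of_total_probability[OF cocycle_logE cocycle_logF Y])
    fix z l m
    assume *: "z \<in> Z" "fst z \<in> Y" "((\<lambda>t. logE t (emb z) / t) \<longlongrightarrow> l) at_top"
      "((\<lambda>t. logF t (emb z) / t) \<longlongrightarrow> m) at_top" "m \<le> l"
    obtain x u v where z: "z = (x, u, v)" by (cases z)
    show False
      using not_negative_growth_gap[of x u v l m] gap[of x] * by (simp add: z logE_emb logF_emb)
  qed
  then obtain K \<delta> where \<delta>: "\<delta> > 0" and K: "\<And>z t. z \<in> Z \<Longrightarrow> t \<ge> 0 \<Longrightarrow> logE t (emb z) - logF t (emb z) \<le> K - \<delta> * t"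
    by blast
  \<comment> \<open>The summand 1 makes the inequality strict, as in the definition of
    domination.\<close>
  have "fnorm E t x * fnorm F (- t) (\<phi> t x) < (exp K + 1) * exp (- \<delta> * t)"
    if x: "x \<in> \<Lambda>" and t: "t > 0" for x t
  proof -
    define N where "N = fnorm E t x"
    have N: "N > 0" unfolding N_def by (rule flow_norm_pos[OF _ x]) simp
    have le: "N \<le> exp (K - \<delta> * t) * growth t x v" if v: "v \<in> F x" "tnorm g x v = 1" for v
      unfolding N_def
    proof (rule flow_norm_le[OF _ x])
      fix u assume u: "u \<in> E x" "tnorm g x u = 1"
      have z: "(x, u, v) \<in> Z" using x u v by (simp add: Z_def)
      have "ln (growth t x u) \<le> (K - \<delta> * t) + ln (growth t x v)"
        using K[OF z, of t] t by (simp add: logE_emb[OF z] logF_emb[OF z])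
      then have "exp (ln (growth t x u)) \<le> exp ((K - \<delta> * t) + ln (growth t x v))" by simp
      then show "growth t x u \<le> exp (K - \<delta> * t) * growth t x v"
        using unit_growth_pos[OF x u(2), of t] unit_growth_pos[OF x v(2), of t] by (simp add: exp_add)
    qed simp
    have "fnorm F (- t) (\<phi> t x) \<le> exp (K - \<delta> * t) / N"
    proof (rule flow_norm_le[OF _ flow_in[OF x]])
      fix w assume w: "w \<in> F (\<phi> t x)" "tnorm g (\<phi> t x) w = 1"
      obtain v where v: "v \<in> F x" "tnorm g x v = 1" "growth t x v * growth (- t) (\<phi> t x) w = 1"
        by (rule growth_backward[of F x w t, OF F_mem x w]) auto
      have "N * growth (- t) (\<phi> t x) w \<le> exp (K - \<delta> * t) * growth t x v * growth (- t) (\<phi> t x) w"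
        using le[OF v(1,2)] unit_growth_pos[OF flow_in[OF x] w(2)] by (intro mult_right_mono) (auto simp: less_imp_le)
      then have "N * growth (- t) (\<phi> t x) w \<le> exp (K - \<delta> * t)" using v(3) by (simp add: mult.assoc)
      then show "growth (- t) (\<phi> t x) w \<le> exp (K - \<delta> * t) / N" using N by (simp add: field_simps)
    qed simp
    then have "N * fnorm F (- t) (\<phi> t x) \<le> exp (K - \<delta> * t)" using N by (simp add: field_simps)
    also have "\<dots> = exp K * exp (- \<delta> * t)" by (simp add: exp_diff exp_minus divide_inverse)
    also have "\<dots> < (exp K + 1) * exp (- \<delta> * t)" by simp
    finally show ?thesis by (simp add: N_def)
  qed
  moreover have "exp K + 1 > 0" using exp_gt_zero[of K] by linarith
  ultimately show ?thesis unfolding dominated_splitting_def using splitting \<delta> by blast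
qed

text \<open>The co-norm on \<open>F\<close> is at least the reciprocal of the backward norm, so
  domination gives \<open>a t \<le> b t + (ln K / t - \<alpha>)\<close> for the rates. The bounds on
  \<open>b\<close> make its limsup a real number, and the extended subtraction behaves as
  usual.\<close>

lemma gap_of_dominated:
  assumes dom: "dominated_splitting A g \<phi> \<Lambda> E F" and x: "x \<in> \<Lambda>"
  shows "negative_growth_gap A g \<phi> E F x"
proof -
  obtain K \<alpha> where K: "K > 0" and \<alpha>: "\<alpha> > 0"
    and d: "\<forall>x\<in>\<Lambda>. \<forall>t>0. fnorm E t x * fnorm F (- t) (\<phi> t x) < K * exp (- \<alpha> * t)"
    using dom unfolding dominated_splitting_def by blast
  obtain C where C: "C > 0" and bounds:
    "\<And>t. t > 0 \<Longrightarrow> exp (- (C + C * t)) \<le> conorm F t x \<and> conorm F t x \<le> exp (C + C * t)"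
    by (rule flow_conorm_exp_bounds[OF x]) (rule that)
  note pos = flow_conorm_pos[OF x]
  define a where "a t = 1 / t * ln (fnorm E t x)" for t
  define b where "b t = 1 / t * ln (conorm F t x)" for t
  have b_bd: "\<bar>b t\<bar> \<le> 2 * C" if t: "t \<ge> 1" for t
  proof -
    have "ln (conorm F t x) \<le> ln (exp (C + C * t))"
      using bounds[of t] pos[of t] t by (subst ln_le_cancel_iff) auto
    then have "ln (conorm F t x) \<le> C + C * t" by simp
    moreover have "- (C + C * t) \<le> ln (conorm F t x)"
      using bounds[of t] pos[of t] t by (simp add: ln_ge_iff)
    moreover have "C * 1 \<le> C * t" using C t by (intro mult_left_mono) auto
    ultimately have "\<bar>ln (conorm F t x)\<bar> \<le> 2 * C * t" by linarith
    then show ?thesis using t by (simp add: b_def abs_mult field_simps)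
  qed
  have ab: "a t \<le> b t + (ln K / t - \<alpha>)" if t: "t > 0" for t
  proof -
    define M where "M = fnorm F (- t) (\<phi> t x)"
    define N where "N = fnorm E t x"
    have M: "M > 0" unfolding M_def by (rule flow_norm_pos[OF _ flow_in[OF x]]) simp
    have N: "N > 0" unfolding N_def by (rule flow_norm_pos[OF _ x]) simp
    have NM: "N * M < K * exp (- \<alpha> * t)" using d x t by (simp add: N_def M_def)
    have "1 / M \<le> conorm F t x"
    proof (rule flow_conorm_ge[OF _ x])
      fix v assume v: "v \<in> F x" "tnorm g x v = 1"
      show "1 / M \<le> growth t x v"
        using growth_forward[of F x v t, OF F_mem x v] M by (simp add: M_def field_simps)
    qed simp
    then have "N \<le> (N * M) * conorm F t x" using N M by (simp add: field_simps)
    also have "\<dots> \<le> K * exp (- \<alpha> * t) * conorm F t x"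
      using NM pos[OF t] by (intro mult_right_mono) auto
    finally have "ln N \<le> ln (K * exp (- \<alpha> * t) * conorm F t x)" using N by simp
    also have "\<dots> = ln K - \<alpha> * t + ln (conorm F t x)"
      using K pos[OF t] by (simp add: ln_mult)
    finally have "ln N / t \<le> (ln K - \<alpha> * t + ln (conorm F t x)) / t"
      using t by (intro divide_right_mono) auto
    then show ?thesis using t by (simp add: a_def b_def N_def add_divide_distrib diff_divide_distrib)
  qed
  define L where "L = Limsup at_top (\<lambda>t. ereal (b t))"
  have "L \<le> ereal (2 * C)" unfolding L_def
    by (rule Limsup_bounded, rule eventually_mono[OF eventually_ge_at_top[of 1]]) (use b_bd in \<open>force simp: abs_le_iff\<close>)
  moreover have "ereal (- (2 * C)) \<le> L" unfolding L_def
  proof (rule order_trans[OF _ Liminf_le_Limsup])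
    show "ereal (- (2 * C)) \<le> Liminf at_top (\<lambda>t. ereal (b t))"
      by (rule Liminf_bounded, rule eventually_mono[OF eventually_ge_at_top[of 1]]) (use b_bd in \<open>force simp: abs_le_iff\<close>)
  qed simp
  ultimately obtain r where r: "L = ereal r" by (cases L) auto
  \<comment> \<open>Two errors of \<open>\<alpha> / 4\<close>, one from the limsup of
    \<open>b\<close> and one from \<open>ln K / t\<close>, leave half of the gap
    \<open>\<alpha>\<close>.\<close>
  have "\<forall>\<^sub>F t in at_top. ereal (b t) < ereal (r + \<alpha> / 4)"
    using \<alpha> r by (intro Limsup_lessD) (simp add: L_def)
  moreover have "((\<lambda>t::real. ln K / t) \<longlongrightarrow> 0) at_top"
    by (intro tendsto_divide_0[OF tendsto_const] filterlim_at_top_imp_at_infinity filterlim_ident)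
  then have "\<forall>\<^sub>F t in at_top. ln K / t < \<alpha> / 4" using \<alpha> by (intro order_tendstoD) auto
  ultimately have "\<forall>\<^sub>F t in at_top. ereal (a t) \<le> ereal (r - \<alpha> / 2)"
    using eventually_gt_at_top[of 0]
  proof eventually_elim
    fix t :: real assume *: "ereal (b t) < ereal (r + \<alpha> / 4)" "ln K / t < \<alpha> / 4" "0 < t"
    have "b t < r + \<alpha> / 4" using *(1) by simp
    then have "a t \<le> r - \<alpha> / 2" using *(2) ab[OF *(3)] by linarith
    then show "ereal (a t) \<le> ereal (r - \<alpha> / 2)" by simp
  qed
  then have "Limsup at_top (\<lambda>t. ereal (a t)) \<le> ereal (r - \<alpha> / 2)" by (rule Limsup_bounded)
  then have "Liminf at_top (\<lambda>t. ereal (a t)) \<le> ereal (r - \<alpha> / 2)"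
    using Liminf_le_Limsup[of at_top "\<lambda>t. ereal (a t)"] by (meson order_trans trivial_limit_at_top_linorder)
  then have "Liminf at_top (\<lambda>t. ereal (a t)) - L \<le> ereal (r - \<alpha> / 2) - L"
    by (rule ereal_minus_mono) simp
  also have "\<dots> < 0" using \<alpha> r by simp
  finally show ?thesis by (simp add: negative_growth_gap_def a_def b_def L_def)
qed

text \<open>The comparison cocycle is 0, so averages in the forbidden order amount to an exponent
  along \<open>u\<close> that is at least 0.\<close>

lemma contracted_of_exponents:
  assumes Y: "total_probability \<phi> \<Lambda> Y"
    and neg: "\<And>x l. x \<in> Y \<Longrightarrow> l \<in> exponents E x \<Longrightarrow> l < 0"
  shows "uniformly_contracted A g \<phi> \<Lambda> E"
proof -
  have "\<exists>K. \<exists>\<delta>>0. \<forall>z\<in>Z. \<forall>t\<ge>0. logE t (emb z) - 0 \<le> K - \<delta> * t"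
  proof (rule decay_of_total_probability[OF cocycle_logE cocycle_zero Y])
    fix z l m
    assume *: "z \<in> Z" "fst z \<in> Y" "((\<lambda>t. logE t (emb z) / t) \<longlongrightarrow> l) at_top"
      "((\<lambda>t::real. 0 / t) \<longlongrightarrow> m) at_top" "m \<le> l"
    obtain x u v where z: "z = (x, u, v)" by (cases z)
    have "m = 0" using *(4) by (simp add: tendsto_const_iff)
    have "u \<in> E x - {0}" using *(1) Z_nonzero(1)[of x u v] by (auto simp: z Z_def)
    then have "l \<in> exponents E x" using * by (auto simp: lyapunov_exponents_eq z logE_emb)
    then show False using neg[of x l] * \<open>m = 0\<close> by (simp add: z)
  qed
  then obtain K \<delta> where \<delta>: "\<delta> > 0" and K: "\<And>z t. z \<in> Z \<Longrightarrow> t \<ge> 0 \<Longrightarrow> logE t (emb z) \<le> K - \<delta> * t"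
    by auto
  have "fnorm E t x \<le> exp K * exp (- \<delta> * t)" if x: "x \<in> \<Lambda>" and t: "t > 0" for x t
  proof (rule flow_norm_le[OF _ x])
    fix u assume u: "u \<in> E x" "tnorm g x u = 1"
    obtain v where "v \<in> F x" "tnorm g x v = 1" using unit_exists[OF F_mem x] by blast
    then have z: "(x, u, v) \<in> Z" using x u by (simp add: Z_def)
    have "exp (ln (growth t x u)) \<le> exp (K - \<delta> * t)" using K[OF z, of t] t by (simp add: logE_emb[OF z])
    then show "growth t x u \<le> exp K * exp (- \<delta> * t)"
      using unit_growth_pos[OF x u(2), of t] by (simp add: exp_diff exp_minus divide_inverse)
  qed simp
  then show ?thesis unfolding uniformly_contracted_def using \<delta> exp_gt_zero[of K] by blast
qed

text \<open>The uniform bound passes from unit vectors to \<open>v\<close> at the cost of the factor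
  \<open>r\<close>, whose logarithm disappears after division by \<open>t\<close>; every exponent is
  at most \<open>- \<alpha>\<close>.\<close>

lemma exponents_of_contracted:
  assumes c: "uniformly_contracted A g \<phi> \<Lambda> E" and x: "x \<in> \<Lambda>" and l: "l \<in> exponents E x"
  shows "l < 0"
proof -
  obtain K \<alpha> where K: "K > 0" and \<alpha>: "\<alpha> > 0"
    and d: "\<forall>x\<in>\<Lambda>. \<forall>t>0. fnorm E t x \<le> K * exp (- \<alpha> * t)"
    using c unfolding uniformly_contracted_def by blast
  obtain v where v: "v \<in> E x" "v \<noteq> 0" and lim: "((\<lambda>t. ln (growth t x v) / t) \<longlongrightarrow> l) at_top"
    using l by (auto simp: lyapunov_exponents_eq)
  define r where "r = tnorm g x v"
  have r: "r > 0" unfolding r_def by (rule tnorm_pos[OF v(2)])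
  have "l \<le> 0 - \<alpha>"
  proof (rule tendsto_le[OF _ _ lim])
    show "((\<lambda>t::real. ln (K * r) / t - \<alpha>) \<longlongrightarrow> 0 - \<alpha>) at_top"
      by (intro tendsto_diff tendsto_const tendsto_divide_0[OF tendsto_const]
          filterlim_at_top_imp_at_infinity filterlim_ident)
    show "\<forall>\<^sub>F t in at_top. ln (growth t x v) / t \<le> ln (K * r) / t - \<alpha>"
      using eventually_gt_at_top[of 0]
    proof eventually_elim
      fix t :: real assume t: "t > 0"
      have "unit x v \<in> E x" unfolding unit_def by (intro subspace_scale subspace_E x v)
      from growth_le_flow_norm[of E x "unit x v" t, OF E_mem x this tnorm_unit[OF v(2)]] d x t
      have "growth t x (unit x v) \<le> K * exp (- \<alpha> * t)" by (auto intro: order_trans)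
      moreover have "growth t x (unit x v) = growth t x v / r"
        by (simp add: growth_unit[OF x v(2)] r_def)
      ultimately have "growth t x v \<le> K * exp (- \<alpha> * t) * r" using r by (simp add: field_simps)
      then have "ln (growth t x v) \<le> ln (K * r * exp (- \<alpha> * t))"
        using growth_pos[OF x v(2), of t] by (simp add: mult_ac)
      also have "\<dots> = ln (K * r) - \<alpha> * t" using K r by (subst ln_mult) auto
      finally have "ln (growth t x v) / t \<le> (ln (K * r) - \<alpha> * t) / t" using t by (intro divide_right_mono) auto
      then show "ln (growth t x v) / t \<le> ln (K * r) / t - \<alpha>" using t by (simp add: diff_divide_distrib)
    qed
  qed simp
  then show ?thesis using \<alpha> by simp
qed

text \<open>With 0 as the first cocycle, averages in the forbidden order amount to an exponent along
  \<open>v\<close> that is at most 0. The resulting lower bound on forward growth becomes backward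
  contraction through \<open>growth_backward\<close>.\<close>

lemma expanded_of_exponents:
  assumes Y: "total_probability \<phi> \<Lambda> Y"
    and pos: "\<And>x l. x \<in> Y \<Longrightarrow> l \<in> exponents F x \<Longrightarrow> 0 < l"
  shows "uniformly_expanded A g \<phi> \<Lambda> F"
proof -
  have "\<exists>K. \<exists>\<delta>>0. \<forall>z\<in>Z. \<forall>t\<ge>0. 0 - logF t (emb z) \<le> K - \<delta> * t"
  proof (rule decay_of_total_probability[OF cocycle_zero cocycle_logF Y])
    fix z l m
    assume *: "z \<in> Z" "fst z \<in> Y" "((\<lambda>t::real. 0 / t) \<longlongrightarrow> l) at_top"
      "((\<lambda>t. logF t (emb z) / t) \<longlongrightarrow> m) at_top" "m \<le> l"
    obtain x u v where z: "z = (x, u, v)" by (cases z)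
    have "l = 0" using *(3) by (simp add: tendsto_const_iff)
    have "v \<in> F x - {0}" using *(1) Z_nonzero(2)[of x u v] by (auto simp: z Z_def)
    then have "m \<in> exponents F x" using * by (auto simp: lyapunov_exponents_eq z logF_emb)
    then show False using pos[of x m] * \<open>l = 0\<close> by (simp add: z)
  qed
  then obtain K \<delta> where \<delta>: "\<delta> > 0" and K: "\<And>z t. z \<in> Z \<Longrightarrow> t \<ge> 0 \<Longrightarrow> - logF t (emb z) \<le> K - \<delta> * t"
    by auto
  have "fnorm F (- t) y \<le> exp K * exp (- \<delta> * t)" if y: "y \<in> \<Lambda>" and t: "t > 0" for y t
  proof (rule flow_norm_le[OF _ y])
    fix w assume w: "w \<in> F y" "tnorm g y w = 1"
    \<comment> \<open>The backward estimate at \<open>y\<close> is the forward estimate at the point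
      from which the orbit reaches \<open>y\<close> after time \<open>t\<close>.\<close>
    define x where "x = \<phi> (- t) y"
    have x: "x \<in> \<Lambda>" "\<phi> t x = y" unfolding x_def by (rule flow_in[OF y], rule flow_inverse[OF y])
    obtain v where v: "v \<in> F x" "tnorm g x v = 1" "growth t x v * growth (- t) y w = 1"
      by (rule growth_backward[of F x w t, OF F_mem x(1)]) (use w x in auto)
    obtain u where "u \<in> E x" "tnorm g x u = 1" using unit_exists[OF E_mem x(1)] by blast
    then have z: "(x, u, v) \<in> Z" using x v by (simp add: Z_def)
    have p: "growth t x v > 0" by (rule unit_growth_pos[OF x(1) v(2)])
    have "exp (- ln (growth t x v)) \<le> exp (K - \<delta> * t)" using K[OF z, of t] t by (simp add: logF_emb[OF z])
    moreover have "growth (- t) y w = exp (- ln (growth t x v))"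
      using v(3) p by (simp add: exp_minus field_simps)
    ultimately show "growth (- t) y w \<le> exp K * exp (- \<delta> * t)"
      by (simp add: exp_diff exp_minus divide_inverse)
  qed simp
  then show ?thesis unfolding uniformly_expanded_def uniformly_contracted_def flow_norm_def
    using \<delta> exp_gt_zero[of K] by blast
qed

text \<open>Backward contraction bounds the forward growth from below by
  \<open>r / K * exp (\<alpha> * t)\<close>, so every exponent is at least
  \<open>\<alpha>\<close>.\<close>

lemma exponents_of_expanded:
  assumes c: "uniformly_expanded A g \<phi> \<Lambda> F" and x: "x \<in> \<Lambda>" and l: "l \<in> exponents F x"
  shows "0 < l"
proof -
  obtain K \<alpha> where K: "K > 0" and \<alpha>: "\<alpha> > 0"
    and d: "\<forall>x\<in>\<Lambda>. \<forall>t>0. fnorm F (- t) x \<le> K * exp (- \<alpha> * t)"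
    using c unfolding uniformly_expanded_def uniformly_contracted_def flow_norm_def by blast
  obtain v where v: "v \<in> F x" "v \<noteq> 0" and lim: "((\<lambda>t. ln (growth t x v) / t) \<longlongrightarrow> l) at_top"
    using l by (auto simp: lyapunov_exponents_eq)
  define r where "r = tnorm g x v"
  have r: "r > 0" unfolding r_def by (rule tnorm_pos[OF v(2)])
  have "0 + \<alpha> \<le> l"
  proof (rule tendsto_le[OF _ lim])
    show "((\<lambda>t::real. ln (r / K) / t + \<alpha>) \<longlongrightarrow> 0 + \<alpha>) at_top"
      by (intro tendsto_add tendsto_const tendsto_divide_0[OF tendsto_const]
          filterlim_at_top_imp_at_infinity filterlim_ident)
    show "\<forall>\<^sub>F t in at_top. ln (r / K) / t + \<alpha> \<le> ln (growth t x v) / t"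
      using eventually_gt_at_top[of 0]
    proof eventually_elim
      fix t :: real assume t: "t > 0"
      have uv: "unit x v \<in> F x" unfolding unit_def by (intro subspace_scale subspace_F x v)
      have gr: "growth t x (unit x v) = growth t x v / r"
        by (simp add: growth_unit[OF x v(2)] r_def)
      have p: "growth t x v / r > 0" using growth_pos[OF x v(2), of t] r by simp
      have "1 \<le> growth t x v / r * fnorm F (- t) (\<phi> t x)"
        using growth_forward[of F x "unit x v" t, OF F_mem x uv tnorm_unit[OF v(2)]] gr by simp
      also have "\<dots> \<le> growth t x v / r * (K * exp (- \<alpha> * t))"
        using d flow_in[OF x] t p by (intro mult_left_mono) auto
      finally have "r / K * exp (\<alpha> * t) \<le> growth t x v"
        using r K by (simp add: exp_minus field_simps)
      moreover have "0 < r / K * exp (\<alpha> * t)" using r K by simp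
      ultimately have "ln (r / K * exp (\<alpha> * t)) \<le> ln (growth t x v)"
        using growth_pos[OF x v(2), of t] by (subst ln_le_cancel_iff)
      moreover have "ln (r / K * exp (\<alpha> * t)) = ln (r / K) + \<alpha> * t" using K r by (subst ln_mult) auto
      ultimately have "(ln (r / K) + \<alpha> * t) / t \<le> ln (growth t x v) / t"
        using t by (intro divide_right_mono) auto
      then show "ln (r / K) / t + \<alpha> \<le> ln (growth t x v) / t" using t by (simp add: add_divide_distrib)
    qed
  qed simp
  then show ?thesis using \<alpha> by simp
qed

text \<open>The witness for the converse direction, where all estimates hold at each point of
  \<Lambda>.\<close>

lemma total_probability_self: "total_probability \<phi> \<Lambda> \<Lambda>"
  unfolding total_probability_def
proof (intro conjI allI impI)
  fix \<mu> assume "invariant_prob \<phi> \<Lambda> \<mu>"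
  then have "prob_space \<mu>" "space \<mu> = \<Lambda>" by (simp_all add: invariant_prob_def)
  then show "emeasure \<mu> \<Lambda> = 1" using prob_space.emeasure_space_1 by metis
qed simp

lemma contracting_iff:
  "contracting_exponents_condition A g \<phi> \<Lambda> E F \<longleftrightarrow> partially_hyperbolic A g \<phi> \<Lambda> E F"
proof
  assume "contracting_exponents_condition A g \<phi> \<Lambda> E F"
  then obtain Y where "total_probability \<phi> \<Lambda> Y"
    "\<forall>x\<in>Y. (\<forall>l\<in>exponents E x. l < 0) \<and> negative_growth_gap A g \<phi> E F x"
    unfolding contracting_exponents_condition_def by blast
  then show "partially_hyperbolic A g \<phi> \<Lambda> E F"
    unfolding partially_hyperbolic_def using dominated_of_gap contracted_of_exponents by blast
next
  assume "partially_hyperbolic A g \<phi> \<Lambda> E F"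
  then show "contracting_exponents_condition A g \<phi> \<Lambda> E F"
    unfolding contracting_exponents_condition_def partially_hyperbolic_def
    using total_probability_self gap_of_dominated exponents_of_contracted by blast
qed

lemma expanding_iff:
  "expanding_exponents_condition A g \<phi> \<Lambda> E F \<longleftrightarrow> partially_hyperbolic_expanding A g \<phi> \<Lambda> E F"
proof
  assume "expanding_exponents_condition A g \<phi> \<Lambda> E F"
  then obtain Y where "total_probability \<phi> \<Lambda> Y"
    "\<forall>x\<in>Y. (\<forall>l\<in>exponents F x. 0 < l) \<and> negative_growth_gap A g \<phi> E F x"
    unfolding expanding_exponents_condition_def by blast
  then show "partially_hyperbolic_expanding A g \<phi> \<Lambda> E F"
    unfolding partially_hyperbolic_expanding_def using dominated_of_gap expanded_of_exponents by blast
next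
  assume "partially_hyperbolic_expanding A g \<phi> \<Lambda> E F"
  then show "expanding_exponents_condition A g \<phi> \<Lambda> E F"
    unfolding expanding_exponents_condition_def partially_hyperbolic_expanding_def
    using total_probability_self gap_of_dominated exponents_of_expanded by blast
qed

end

lemma (in manifold_flow) split_flow_exists:
  assumes "continuous_invariant_splitting A \<phi> \<Lambda> E F"
  shows "\<exists>C \<rho> K. split_flow A g X \<phi> \<Lambda> E F C \<rho> K"
proof -
  obtain C \<rho> K where "(\<forall>i::nat. C i \<in> A \<and> continuous_on UNIV (\<rho> i :: 'm \<Rightarrow> real) \<and> closed (K i) \<and> K i \<subseteq> fst (C i) \<and>
     (\<forall>y. y \<notin> K i \<longrightarrow> \<rho> i y = 0)) \<and> (\<forall>x\<in>\<Lambda>. \<exists>i. \<rho> i x \<noteq> 0)"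
    using bump_cover by (elim exE)
  then have "split_flow A g X \<phi> \<Lambda> E F C \<rho> K"
    by unfold_locales (use assms in simp_all)
  then show ?thesis by blast
qed

theorem corollary1p7:
  fixes A :: "('m::{t2_space,second_countable_topology}, 'e::euclidean_space) atlas"
    and g :: "'m \<Rightarrow> 'e \<Rightarrow> 'e \<Rightarrow> real"
    and X :: "'m \<Rightarrow> 'e"
    and \<phi> :: "real \<Rightarrow> 'm \<Rightarrow> 'm"
    and \<Lambda> :: "'m set"
  assumes "smooth_atlas A" and "riemannian_metric A g"
    and "compact (UNIV :: 'm set)" and "connected (UNIV :: 'm set)"
    and "DIM('e) \<ge> 3"
    and "C1_vector_field A X" and "inwardly_transverse A X" and "flow_of A X \<phi>"
    and "compact \<Lambda>" and "invariant_set A X \<phi> \<Lambda>"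
    and "\<forall>\<sigma>\<in>\<Lambda>. X \<sigma> = 0 \<longrightarrow> hyperbolic_singularity A X \<sigma>"
  shows "(\<forall>E F. continuous_invariant_splitting A \<phi> \<Lambda> E F \<longrightarrow>
            (contracting_exponents_condition A g \<phi> \<Lambda> E F \<longleftrightarrow> partially_hyperbolic A g \<phi> \<Lambda> E F) \<and>
            (expanding_exponents_condition A g \<phi> \<Lambda> E F \<longleftrightarrow>
               partially_hyperbolic_expanding A g \<phi> \<Lambda> E F)) \<and>
         ((\<exists>E F. continuous_invariant_splitting A \<phi> \<Lambda> E F \<and>
                 contracting_exponents_condition A g \<phi> \<Lambda> E F) \<longleftrightarrow>
            (\<exists>E F. partially_hyperbolic A g \<phi> \<Lambda> E F)) \<and>
         ((\<exists>E F. continuous_invariant_splitting A \<phi> \<Lambda> E F \<and>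
                 expanding_exponents_condition A g \<phi> \<Lambda> E F) \<longleftrightarrow>
            (\<exists>E F. partially_hyperbolic_expanding A g \<phi> \<Lambda> E F))"
proof -
  interpret manifold_flow A g X \<phi> \<Lambda> by unfold_locales fact+
  have main: "(contracting_exponents_condition A g \<phi> \<Lambda> E F \<longleftrightarrow> partially_hyperbolic A g \<phi> \<Lambda> E F) \<and>
      (expanding_exponents_condition A g \<phi> \<Lambda> E F \<longleftrightarrow> partially_hyperbolic_expanding A g \<phi> \<Lambda> E F)"
    if E: "continuous_invariant_splitting A \<phi> \<Lambda> E F" for E F
  proof -
    obtain C \<rho> K where "split_flow A g X \<phi> \<Lambda> E F C \<rho> K" using split_flow_exists[OF E] by blast
    then show ?thesis using split_flow.contracting_iff split_flow.expanding_iff by blast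
  qed
  \<comment> \<open>Both notions of partial hyperbolicity contain a continuous invariant splitting,
    so the equivalences for a fixed pair carry over to those about existence.\<close>
  moreover have "continuous_invariant_splitting A \<phi> \<Lambda> E F"
    if "partially_hyperbolic A g \<phi> \<Lambda> E F \<or> partially_hyperbolic_expanding A g \<phi> \<Lambda> E F" for E F
    using that unfolding partially_hyperbolic_def partially_hyperbolic_expanding_def dominated_splitting_def by blast
  ultimately show ?thesis by blast
qed

end
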